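(* Let $k$ be an $F$-finite field of prime characteristic $p$, let $G$ be a simple connected graph on the vertex set $[d]=\{1,\dots,d\}$, let $R=k[x_1,\dots,x_d,y_1,\dots,y_d]$, and let $J_G\subseteq R$ be the binomial edge ideal of $G$. Suppose that $G$ is one of the following graphs: 1) a complete multipartite graph; 2) a graph such that $|\operatorname{Ass}(J_G)|\le 2$; 3) a closed graph such that $J_G$ is unmixed. Then the symbolic Rees algebra $\mathcal R^s(J_G)$ is strongly $F$-regular.
   Context: A graph is simple if it is undirected, without loops and without multiple edges. For a simple graph $G$ with vertex set $[d]$ and edge set $E$, the binomial edge ideal is $J_G=(x_iy_j-x_jy_i \mid \{i,j\}\in E)\subseteq R$; it is a radical ideal. $\operatorname{Ass}(J)$ denotes the set of associated primes of $R/J$. $J_G$ is unmixed if all its associated primes have the same height. A field $k$ of characteristic $p$ is $F$-finite if $k$ is a finite extension of $k^p$. Multipartite: the vertex set has a partition into nonempty subsets $V_1,\dots,V_l$ such that no two vertices in the same $V_i$ are adjacent; complete multipartite: moreover every $u\in V_i$ and $v\in V_j$ with $i\ne j$ are adjacent. Closed graph: a simple graph with $d$ vertices and edge set $E$ whose vertices can be labeled by $[d]$ so that whenever $\{i,k\}\in E$ and $i<j<k$, then $\{i,j\}\in E$ and $\{j,k\}\in E$. Symbolic powers: for a radical ideal $I$ in a Noetherian ring $R$ with minimal primes $\mathfrak q_1,\dots,\mathfrak q_m$, $I^{(n)}=\bigcap_{i=1}^m (\mathfrak q_i^nR_{\mathfrak q_i}\cap R)$ for $n\ge 1$, and $I^{(0)}=R$.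 The symbolic Rees algebra is $\mathcal R^s(I)=\bigoplus_{n\ge0}I^{(n)}t^n\subseteq R[t]$. Strongly $F$-regular: a domain $A$ of prime characteristic $p$ is strongly $F$-regular if for every nonzero $c\in A$ there is $e\ge1$ such that the $A$-linear map $A\to A^{1/p^e}$, $1\mapsto c^{1/p^e}$, splits (has an $A$-linear left inverse). *)

theory Defs
  imports
    "HOL-Algebra.Algebraic_Closure_Type"
    "HOL-Algebra.Ideal_Product"
    "HOL-Algebra.QuotRing"
    "HOL-Algebra.Embedded_Algebras"
    "HOL-Algebra.Module"
    "HOL-Computational_Algebra.Computational_Algebra"
    "HOL-Library.Poly_Mapping"
    "HOL-Library.Extended_Nat"
    "HOL-Library.Disjoint_Sets"
begin

section \<open>Graphs\<close>

definition simple_graph :: "'v set \<Rightarrow> 'v set set \<Rightarrow> bool" where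
  "simple_graph V E \<longleftrightarrow> finite V \<and> (\<forall>e\<in>E. \<exists>u\<in>V. \<exists>v\<in>V. u \<noteq> v \<and> e = {u, v})"

definition connected_graph :: "'v set \<Rightarrow> 'v set set \<Rightarrow> bool" where
  "connected_graph V E \<longleftrightarrow>
     V \<noteq> {} \<and> (\<forall>u\<in>V. \<forall>v\<in>V. (u, v) \<in> {(a, b). {a, b} \<in> E}\<^sup>*)"

definition complete_multipartite :: "'v set \<Rightarrow> 'v set set \<Rightarrow> bool" where
  "complete_multipartite V E \<longleftrightarrow>
     (\<exists>P. partition_on V P \<and>
       (\<forall>A\<in>P. \<forall>u\<in>A. \<forall>v\<in>A. {u, v} \<notin> E) \<and>
       (\<forall>A\<in>P. \<forall>B\<in>P. A \<noteq> B \<longrightarrow> (\<forall>u\<in>A. \<forall>v\<in>B. {u, v} \<in> E)))"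

text \<open>\<open>l\<close> is the labelling; it may differ from the names the vertices already have.\<close>

definition closed_graph :: "'v set \<Rightarrow> 'v set set \<Rightarrow> bool" where
  "closed_graph V E \<longleftrightarrow>
     (\<exists>l. bij_betw l V {1..card V} \<and>
       (\<forall>u\<in>V. \<forall>v\<in>V. \<forall>w\<in>V. {u, w} \<in> E \<and> l u < l v \<and> l v < l w
          \<longrightarrow> {u, v} \<in> E \<and> {v, w} \<in> E))"


section \<open>Commutative algebra\<close>

subsection \<open>Associated primes, height, unmixed ideals\<close>

definition quotient_module :: "('a, 'b) ring_scheme \<Rightarrow> 'a set \<Rightarrow> ('a, 'a set) module" where
  "quotient_module R J =
     \<lparr>carrier = carrier (R Quot J), monoid.mult = monoid.mult (R Quot J), one = \<one>\<^bsub>R Quot J\<^esub>,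
      zero = \<zero>\<^bsub>R Quot J\<^esub>, add = ring.add (R Quot J),
      module.smult = (\<lambda>r m. (J +>\<^bsub>R\<^esub> r) \<otimes>\<^bsub>R Quot J\<^esub> m)\<rparr>"

definition associated_primes ::
    "('a, 'b) ring_scheme \<Rightarrow> ('a, 'm, 'c) module_scheme \<Rightarrow> 'a set set" where
  "associated_primes R M =
     {P. primeideal P R \<and>
         (\<exists>m\<in>carrier M. P = {r \<in> carrier R. r \<odot>\<^bsub>M\<^esub> m = \<zero>\<^bsub>M\<^esub>})}"

definition Ass :: "('a, 'b) ring_scheme \<Rightarrow> 'a set \<Rightarrow> 'a set set" where
  "Ass R J = associated_primes R (quotient_module R J)"

definition height :: "('a, 'b) ring_scheme \<Rightarrow> 'a set \<Rightarrow> enat" where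
  "height R P =
     (SUP n \<in> {n. \<exists>Q :: nat \<Rightarrow> 'a set.
                    (\<forall>i\<le>n. primeideal (Q i) R) \<and> (\<forall>i<n. Q i \<subset> Q (Suc i)) \<and> Q n = P}.
        enat n)"

definition unmixed :: "('a, 'b) ring_scheme \<Rightarrow> 'a set \<Rightarrow> bool" where
  "unmixed R J \<longleftrightarrow> (\<forall>P\<in>Ass R J. \<forall>Q\<in>Ass R J. height R P = height R Q)"

definition minimal_primes :: "('a, 'b) ring_scheme \<Rightarrow> 'a set \<Rightarrow> 'a set set" where
  "minimal_primes R I =
     {P. primeideal P R \<and> I \<subseteq> P \<and> (\<forall>Q. primeideal Q R \<and> I \<subseteq> Q \<and> Q \<subseteq> P \<longrightarrow> Q = P)}"


subsection \<open>Symbolic powers and the symbolic Rees algebra\<close>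

text \<open>
  From here on, a domain is given as a subring \<open>A\<close> of some type of class \<open>idom\<close>.
\<close>

definition ring_on :: "'a::comm_ring_1 set \<Rightarrow> 'a ring" where
  "ring_on A = ring_of_type_algebra\<lparr>carrier := A\<rparr>"

definition to_fract :: "'a::idom \<Rightarrow> 'a fract" where
  "to_fract a = Fraction_Field.Fract a 1"

text \<open>The localization of \<open>A\<close> at a prime \<open>q\<close>, as a subring of a field containing \<open>Frac A\<close>.\<close>

definition localization :: "'a::idom set \<Rightarrow> 'a set \<Rightarrow> 'a fract set" where
  "localization A q = {Fraction_Field.Fract a s | a s. a \<in> A \<and> s \<in> A - q}"

text \<open>
  \<open>q\<^sup>n A\<^sub>q \<inter> A\<close>; here \<open>q\<^sup>n\<close> is the power in the monoid of ideals under the ideal product.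
\<close>

definition contracted_power :: "'a::idom set \<Rightarrow> 'a set \<Rightarrow> nat \<Rightarrow> 'a set" where
  "contracted_power A q n =
     {f \<in> A. to_fract f \<in>
        Idl\<^bsub>ring_on (localization A q)\<^esub> (to_fract ` (q [^]\<^bsub>ideals_set (ring_on A)\<^esub> n))}"

definition symbolic_power :: "'a::idom set \<Rightarrow> 'a set \<Rightarrow> nat \<Rightarrow> 'a set" where
  "symbolic_power A I n =
     (if n = 0 then A
      else A \<inter> (\<Inter>q \<in> minimal_primes (ring_on A) I. contracted_power A q n))"

definition symbolic_Rees_algebra :: "'a::idom set \<Rightarrow> 'a set \<Rightarrow> 'a poly set" where
  "symbolic_Rees_algebra A I = {f. \<forall>n. Polynomial.coeff f n \<in> symbolic_power A I n}"


subsection \<open>Strong F-regularity\<close>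

definition F_finite :: "'k::field itself \<Rightarrow> bool" where
  "F_finite TYPE('k) \<longleftrightarrow>
     ring.finite_dimension (ring_of_type_algebra :: 'k ring) (range (\<lambda>x. x ^ CHAR('k))) UNIV"

definition to_closure :: "'a::idom \<Rightarrow> 'a fract alg_closure" where
  "to_closure a = to_ac (to_fract a)"

text \<open>
  \<open>A\<^bsup>1/p^e\<^esup>\<close> consists of the \<open>p^e\<close>-th roots of elements of \<open>A\<close> in an algebraically closed field
  containing \<open>A\<close>, where \<open>p\<close> is the characteristic.
\<close>

definition root_ring :: "'a::idom set \<Rightarrow> nat \<Rightarrow> 'a fract alg_closure set" where
  "root_ring A e = {z. z ^ (CHAR('a) ^ e) \<in> to_closure ` A}"

definition linear_to_base ::
    "'a::idom set \<Rightarrow> 'a fract alg_closure set \<Rightarrow> ('a fract alg_closure \<Rightarrow> 'a) \<Rightarrow> bool" where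
  "linear_to_base A M \<phi> \<longleftrightarrow>
     (\<forall>u\<in>M. \<phi> u \<in> A) \<and>
     (\<forall>u\<in>M. \<forall>v\<in>M. \<phi> (u + v) = \<phi> u + \<phi> v) \<and>
     (\<forall>a\<in>A. \<forall>u\<in>M. \<phi> (to_closure a * u) = a * \<phi> u)"

text \<open>
  Roots are unique in characteristic \<open>p\<close>, so the \<open>z\<close> below is \<open>c\<^bsup>1/p^e\<^esup>\<close>, and \<open>\<phi>\<close> is a left
  inverse of the \<open>A\<close>-linear map sending \<open>1\<close> to it.
\<close>

definition strongly_F_regular :: "'a::idom set \<Rightarrow> bool" where
  "strongly_F_regular A \<longleftrightarrow>
     domain (ring_on A) \<and> prime CHAR('a) \<and>
     (\<forall>c\<in>A - {0}. \<exists>e\<ge>1. \<exists>z\<in>root_ring A e. z ^ (CHAR('a) ^ e) = to_closure c \<and>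
        (\<exists>\<phi>. linear_to_base A (root_ring A e) \<phi> \<and> (\<forall>a\<in>A. \<phi> (to_closure a * z) = a)))"


section \<open>Binomial edge ideals\<close>

datatype indet = Xvar nat | Yvar nat

text \<open>
  The order on the indeterminates serves only to make the type of polynomials an instance of
  \<open>idom\<close>.
\<close>

fun indet_code :: "indet \<Rightarrow> nat" where
  "indet_code (Xvar i) = 2 * i"
| "indet_code (Yvar i) = 2 * i + 1"

lemma indet_code_inject: "indet_code u = indet_code v \<longleftrightarrow> u = v"
  by (cases u; cases v) (simp; presburger)+

instantiation indet :: linorder
begin

definition less_eq_indet :: "indet \<Rightarrow> indet \<Rightarrow> bool" where
  "u \<le> v \<longleftrightarrow> indet_code u \<le> indet_code v"

definition less_indet :: "indet \<Rightarrow> indet \<Rightarrow> bool" where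
  "u < v \<longleftrightarrow> indet_code u < indet_code v"

instance
  by standard (auto simp: less_eq_indet_def less_indet_def indet_code_inject)

end

type_synonym 'k xy_poly = "(indet \<Rightarrow>\<^sub>0 nat) \<Rightarrow>\<^sub>0 'k"

definition x_var :: "nat \<Rightarrow> 'k::field xy_poly" where
  "x_var i = Poly_Mapping.single (Poly_Mapping.single (Xvar i) 1) 1"

definition y_var :: "nat \<Rightarrow> 'k::field xy_poly" where
  "y_var i = Poly_Mapping.single (Poly_Mapping.single (Yvar i) 1) 1"

text \<open>The subring \<open>k[x\<^sub>1, \<dots>, x\<^sub>d, y\<^sub>1, \<dots>, y\<^sub>d]\<close>.\<close>

definition xy_polys :: "nat \<Rightarrow> 'k::field xy_poly set" where
  "xy_polys d =
     {f. \<forall>m \<in> Poly_Mapping.keys f. Poly_Mapping.keys m \<subseteq> Xvar ` {1..d} \<union> Yvar ` {1..d}}"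

definition binomial_edge_ideal :: "nat \<Rightarrow> nat set set \<Rightarrow> 'k::field xy_poly set" where
  "binomial_edge_ideal d E =
     Idl\<^bsub>ring_on (xy_polys d)\<^esub> {x_var i * y_var j - x_var j * y_var i | i j. {i, j} \<in> E}"

end

theory Submission
  imports Defs
begin

text \<open>
  Let \<open>Q = p\<^sup>e\<close> and let \<open>P\<close> be a prime that is locally generated by \<open>h\<close> elements. By the pigeonhole
  principle, a \<open>p\<^sup>-\<^sup>e\<close>-linear map \<open>\<psi>\<close> sends \<open>P\<^sup>n\<close> into \<open>P\<^sup>s\<close>, locally at \<open>P\<close>, as soon as
  \<open>n + Q > Q s + h (Q - 1)\<close>. So if \<open>F\<close> lies in \<open>P\<^sup>h\<close> for every minimal prime \<open>P\<close> of \<open>J\<close>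
  (with \<open>h\<close> depending on \<open>P\<close>) and \<open>m = Q - 1 - N\<close> with \<open>h N < Q\<close>, then \<open>\<psi> (F\<^sup>m \<cdot> _)\<close> maps the
  symbolic power of exponent \<open>Q s\<close> into the one of exponent \<open>s\<close>, and applied coefficientwise it
  is a \<open>p\<^sup>-\<^sup>e\<close>-linear endomorphism of the symbolic Rees algebra. If moreover the leading
  monomial of \<open>F\<close> is squarefree, all exponents in the leading monomial of \<open>F\<^sup>m c\<close> are below \<open>Q\<close> once
  \<open>N\<close> bounds the exponents in the leading monomial of \<open>c \<noteq> 0\<close>, so that \<open>\<psi>\<close> can be chosen with
  \<open>\<psi> (F\<^sup>m c) = 1\<close>.

  For a permutation \<open>\<sigma>\<close> of the vertices, \<open>F\<close> is the product of the 2-minors on consecutive columns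
  \<open>\<sigma> i, \<sigma> (i + 1)\<close> with the two variables \<open>y\<close> of \<open>\<sigma> 1\<close> and \<open>x\<close> of \<open>\<sigma> d\<close>; its leading monomial is the
  product of all variables. A minimal prime of \<open>J\<close> is determined by a set \<open>S\<close> of vertices whose
  variables it contains: the remaining generators say that the columns in one connected
  component of \<open>G - S\<close> are proportional. It is locally generated by \<open>2 |S| + \<Sum> (|C| - 1)\<close> elements, \<open>C\<close>
  ranging over the components, and \<open>F\<close> has at least that order along it if \<open>\<sigma>\<close> lists every component
  contiguously. In all three cases one \<open>\<sigma>\<close> works for all minimal primes: for complete
  multipartite graphs the components are single vertices unless \<open>S\<close> is empty, for closed graphs the
  labelling is such a \<open>\<sigma>\<close>, and if there are at most two associated primes, then at most one minimal
  prime has a nonempty \<open>S\<close>.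
\<close>

subsection \<open>Ideals in a subring of a domain\<close>

text \<open>Elementwise counterparts of \<open>ideal\<close> and \<open>primeideal\<close> over
  \<open>ring_on A\<close>, identified with them by \<open>ideal_ring_on\<close> and
  \<open>prime_ring_on\<close>. Closure under negation comes from multiplying by -1, which lies in
  \<open>A\<close> in the locale below.\<close>

definition ideal_in :: "'a::comm_ring_1 set \<Rightarrow> 'a set \<Rightarrow> bool" where
  "ideal_in A I \<longleftrightarrow> I \<subseteq> A \<and> 0 \<in> I \<and> (\<forall>a\<in>I. \<forall>b\<in>I. a + b \<in> I) \<and> (\<forall>a\<in>A. \<forall>b\<in>I. a * b \<in> I)"

definition prime_in :: "'a::comm_ring_1 set \<Rightarrow> 'a set \<Rightarrow> bool" where
  "prime_in A P \<longleftrightarrow>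
     ideal_in A P \<and> 1 \<notin> P \<and> (\<forall>a\<in>A. \<forall>b\<in>A. a * b \<in> P \<longrightarrow> a \<in> P \<or> b \<in> P)"

definition ideal_power :: "'a::comm_ring_1 set \<Rightarrow> 'a set \<Rightarrow> nat \<Rightarrow> 'a set" where
  "ideal_power A q n = q [^]\<^bsub>ideals_set (ring_on A)\<^esub> n"

lemma ring_on_simps [simp]:
  "carrier (ring_on A) = A" "x \<otimes>\<^bsub>ring_on A\<^esub> y = x * y" "x \<oplus>\<^bsub>ring_on A\<^esub> y = x + y"
  "\<one>\<^bsub>ring_on A\<^esub> = 1" "\<zero>\<^bsub>ring_on A\<^esub> = 0"
  by (simp_all add: ring_on_def ring_of_type_algebra_def)

locale idom_subset =
  fixes A :: "'a::idom set"
  assumes zero_mem: "0 \<in> A" and one_mem: "1 \<in> A"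
    and add_mem: "a \<in> A \<Longrightarrow> b \<in> A \<Longrightarrow> a + b \<in> A"
    and uminus_mem: "a \<in> A \<Longrightarrow> - a \<in> A"
    and mult_mem: "a \<in> A \<Longrightarrow> b \<in> A \<Longrightarrow> a * b \<in> A"
begin

lemma diff_mem: "a \<in> A \<Longrightarrow> b \<in> A \<Longrightarrow> a - b \<in> A"
  using add_mem[of a "- b"] uminus_mem[of b] by simp

lemma power_mem: "a \<in> A \<Longrightarrow> a ^ n \<in> A"
  by (induction n) (auto intro: one_mem mult_mem)

lemma prod_mem: "(\<And>i. i \<in> I \<Longrightarrow> f i \<in> A) \<Longrightarrow> prod f I \<in> A"
  by (induction I rule: infinite_finite_induct) (auto intro: one_mem mult_mem)

lemma cring_ring_on: "cring (ring_on A)"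
proof (rule cringI)
  show "abelian_group (ring_on A)"
    by (rule abelian_groupI)
       (auto intro: add_mem zero_mem simp: algebra_simps intro!: bexI[of _ "- x" for x] uminus_mem)
  show "Group.comm_monoid (ring_on A)"
    by (rule comm_monoidI) (auto intro: mult_mem one_mem simp: algebra_simps)
qed (auto simp: algebra_simps)

lemma ring_ring_on: "ring (ring_on A)"
  using cring_ring_on by (simp add: cring_def)

lemma domain_ring_on: "domain (ring_on A)"
  using cring_ring_on by (rule domainI) auto

lemma ideal_ring_on: "ideal I (ring_on A) \<longleftrightarrow> ideal_in A I"
proof
  assume I: "ideal I (ring_on A)"
  interpret I: ideal I "ring_on A" by (rule I)
  show "ideal_in A I"
    unfolding ideal_in_def
    using I.a_subset additive_subgroup.zero_closed[OF I.is_additive_subgroup]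
      additive_subgroup.a_closed[OF I.is_additive_subgroup] I.I_l_closed by simp
next
  assume I: "ideal_in A I"
  show "ideal I (ring_on A)"
  proof (rule idealI[OF ring_ring_on])
    have m: "- b \<in> I" if "b \<in> I" for b
    proof -
      have "(- 1) * b \<in> I"
        using I that one_mem uminus_mem unfolding ideal_in_def by blast
      then show ?thesis by simp
    qed
    have inv: "inv\<^bsub>add_monoid (ring_on A)\<^esub> x = - x" if "x \<in> A" for x
    proof -
      interpret r: ring "ring_on A" by (rule ring_ring_on)
      have "\<ominus>\<^bsub>ring_on A\<^esub> x = - x"
        using r.minus_equality[of "- x" x] uminus_mem[OF that] that by simp
      then show ?thesis by (simp add: a_inv_def)
    qed
    show "subgroup I (add_monoid (ring_on A))"
      using I m inv by unfold_locales (auto simp: ideal_in_def subset_iff)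
    fix a x assume "a \<in> I" "x \<in> carrier (ring_on A)"
    then have "x * a \<in> I" using I by (simp add: ideal_in_def)
    then show "x \<otimes>\<^bsub>ring_on A\<^esub> a \<in> I" "a \<otimes>\<^bsub>ring_on A\<^esub> x \<in> I" by (simp_all add: mult.commute)
  qed
qed

lemma prime_ring_on: "primeideal P (ring_on A) \<longleftrightarrow> prime_in A P"
proof
  assume P: "primeideal P (ring_on A)"
  interpret P: primeideal P "ring_on A" by (rule P)
  have i: "ideal_in A P" using P.is_ideal by (simp add: ideal_ring_on)
  have "1 \<notin> P"
  proof
    assume "1 \<in> P"
    then have "A \<subseteq> P" using i unfolding ideal_in_def by (metis mult.right_neutral subsetI)
    then show False using P.I_notcarr i by (auto simp: ideal_in_def)
  qed
  then show "prime_in A P"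
    using i P.I_prime by (auto simp: prime_in_def)
next
  assume P: "prime_in A P"
  show "primeideal P (ring_on A)"
    by (rule primeidealI)
       (use P one_mem cring_ring_on in \<open>auto simp: ideal_ring_on prime_in_def\<close>)
qed

lemma prime_in_imp_ideal: "prime_in A P \<Longrightarrow> ideal_in A P"
  by (simp add: prime_in_def)

lemma ideal_uminus: "ideal_in A I \<Longrightarrow> b \<in> I \<Longrightarrow> - b \<in> I"
  unfolding ideal_in_def
  using one_mem uminus_mem[of 1] by (metis mult_minus1)

lemma ideal_mult_right: "ideal_in A I \<Longrightarrow> b \<in> I \<Longrightarrow> a \<in> A \<Longrightarrow> b * a \<in> I"
  unfolding ideal_in_def by (simp add: mult.commute)

lemma ideal_mult_left: "ideal_in A I \<Longrightarrow> b \<in> I \<Longrightarrow> a \<in> A \<Longrightarrow> a * b \<in> I"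
  unfolding ideal_in_def by simp

lemma ideal_add: "ideal_in A I \<Longrightarrow> b \<in> I \<Longrightarrow> a \<in> I \<Longrightarrow> a + b \<in> I"
  unfolding ideal_in_def by simp

lemma ideal_diff: "ideal_in A I \<Longrightarrow> a \<in> I \<Longrightarrow> b \<in> I \<Longrightarrow> a - b \<in> I"
  using ideal_add[of I "- b" a] ideal_uminus[of I b] by simp

lemma ideal_sum: "ideal_in A I \<Longrightarrow> (\<And>x. x \<in> N \<Longrightarrow> f x \<in> I) \<Longrightarrow> sum f N \<in> I"
  by (induction N rule: infinite_finite_induct) (auto simp: ideal_in_def)

lemma prime_mult_notin:
  "prime_in A P \<Longrightarrow> a \<in> A - P \<Longrightarrow> b \<in> A - P \<Longrightarrow> a * b \<in> A - P"
  unfolding prime_in_def by (auto intro: mult_mem)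

lemma prime_power_notin: "prime_in A P \<Longrightarrow> a \<in> A - P \<Longrightarrow> a ^ n \<in> A - P"
  by (induction n) (auto simp: prime_in_def intro: mult_mem one_mem)

lemma prime_prod_notin:
  "prime_in A P \<Longrightarrow> (\<And>i. i \<in> I \<Longrightarrow> f i \<in> A - P) \<Longrightarrow> prod f I \<in> A - P"
proof (induction I rule: infinite_finite_induct)
  case (insert x F)
  then show ?case using prime_mult_notin[of P "f x" "prod f F"] by simp
qed (auto simp: prime_in_def intro: one_mem)

lemma ideal_genideal:
  assumes "N \<subseteq> A"
  shows "ideal_in A (Idl\<^bsub>ring_on A\<^esub> N)" "N \<subseteq> Idl\<^bsub>ring_on A\<^esub> N"
    "ideal_in A I \<Longrightarrow> N \<subseteq> I \<Longrightarrow> Idl\<^bsub>ring_on A\<^esub> N \<subseteq> I"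
proof -
  interpret r: ring "ring_on A" by (rule ring_ring_on)
  show "ideal_in A (Idl\<^bsub>ring_on A\<^esub> N)" "N \<subseteq> Idl\<^bsub>ring_on A\<^esub> N"
    "ideal_in A I \<Longrightarrow> N \<subseteq> I \<Longrightarrow> Idl\<^bsub>ring_on A\<^esub> N \<subseteq> I"
    using r.genideal_ideal[of N] r.genideal_self[of N] r.genideal_minimal[of I N] assms
    by (auto simp flip: ideal_ring_on)
qed

section \<open>Powers of an ideal\<close>

lemma ideal_power_0 [simp]: "ideal_power A q 0 = A"
  by (simp add: ideal_power_def ideals_set_def)

lemma ideal_power_Suc [simp]:
  "ideal_power A q (Suc n) = ideal_prod (ring_on A) (ideal_power A q n) q"
  by (simp add: ideal_power_def ideals_set_def)

lemma ideal_ideal_power: "ideal_in A q \<Longrightarrow> ideal_in A (ideal_power A q n)"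
proof (induction n)
  case 0
  then show ?case by (auto simp: ideal_in_def zero_mem add_mem mult_mem)
next
  case (Suc n)
  then show ?case
    using ring.ideal_prod_is_ideal[OF ring_ring_on] by (auto simp flip: ideal_ring_on)
qed

lemma ideal_power_SucI:
  "a \<in> ideal_power A q n \<Longrightarrow> b \<in> q \<Longrightarrow> a * b \<in> ideal_power A q (Suc n)"
  using ideal_prod.prod[of a "ideal_power A q n" b q "ring_on A"] by simp

text \<open>\<open>ideal_prod\<close> is an inductive set generated by products under addition, so a
  property stable under sums has to be checked on products only.\<close>

lemma ideal_power_Suc_induct [consumes 1, case_names prod sum]:
  assumes "f \<in> ideal_power A q (Suc n)"
    and "\<And>a b. a \<in> ideal_power A q n \<Longrightarrow> b \<in> q \<Longrightarrow> Q (a * b)"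
    and "\<And>a b. a \<in> ideal_power A q (Suc n) \<Longrightarrow> b \<in> ideal_power A q (Suc n) \<Longrightarrow> Q a \<Longrightarrow> Q b \<Longrightarrow> Q (a + b)"
  shows "Q f"
  using assms(1) unfolding ideal_power_Suc
  by (induction rule: ideal_prod.induct) (use assms(2,3) in auto)

lemma ideal_power_Suc_subset:
  assumes "ideal_in A q" shows "ideal_power A q (Suc n) \<subseteq> ideal_power A q n"
proof
  fix f assume "f \<in> ideal_power A q (Suc n)"
  then show "f \<in> ideal_power A q n"
  proof (induction rule: ideal_power_Suc_induct)
    case (prod a b)
    then show ?case
      using ideal_mult_right[OF ideal_ideal_power[OF assms], of a n b] assms
      by (auto simp: ideal_in_def)
  next
    case (sum a b)
    then show ?case using ideal_ideal_power[OF assms, of n] by (auto simp: ideal_in_def)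
  qed
qed

lemma ideal_power_mono:
  assumes "ideal_in A q" "m \<le> n" shows "ideal_power A q n \<subseteq> ideal_power A q m"
  using assms(2)
proof (induction n rule: dec_induct)
  case (step n)
  then show ?case using ideal_power_Suc_subset[OF assms(1), of n] by (meson subset_trans)
qed auto

lemma ideal_power_mult:
  assumes "ideal_in A q" "a \<in> ideal_power A q m" "b \<in> ideal_power A q n"
  shows "a * b \<in> ideal_power A q (m + n)"
  using assms(3)
proof (induction n arbitrary: b)
  case 0
  then show ?case
    using ideal_mult_right[OF ideal_ideal_power[OF assms(1)] assms(2)] by simp
next
  case (Suc n)
  from Suc.prems show ?case
  proof (induction rule: ideal_power_Suc_induct)
    case (prod c d)
    then show ?case
      using ideal_power_SucI[OF Suc.IH[OF prod(1)] prod(2)] by (simp add: mult.assoc)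
  next
    case (sum c d)
    then show ?case using ideal_ideal_power[OF assms(1), of "m + Suc n"]
      by (metis distrib_left ideal_in_def)
  qed
qed

lemma ideal_power_1: "ideal_in A q \<Longrightarrow> b \<in> q \<Longrightarrow> b \<in> ideal_power A q 1"
  using ideal_power_SucI[of 1 q 0 b] one_mem by simp

lemma ideal_power_power:
  "ideal_in A q \<Longrightarrow> b \<in> ideal_power A q m \<Longrightarrow> b ^ n \<in> ideal_power A q (m * n)"
proof (induction n)
  case (Suc n)
  then show ?case using ideal_power_mult[of q b m "b ^ n" "m * n"] by simp
qed (auto intro: one_mem)

lemma ideal_power_prod:
  assumes "ideal_in A q" "\<And>i. i \<in> I \<Longrightarrow> f i \<in> ideal_power A q (k i)"
  shows "prod f I \<in> ideal_power A q (sum k I)"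
  using assms(2)
proof (induction I rule: infinite_finite_induct)
  case (insert x F)
  then show ?case using ideal_power_mult[OF assms(1), of "f x" "k x" "prod f F" "sum k F"] by simp
qed (auto intro: one_mem)

text \<open>The fractions with numerator in the power of \<open>q\<close> and denominator outside
  \<open>q\<close> already form an ideal \<open>K\<close> of the localization, hence exhaust the
  extended ideal. Comparing fractions clears the denominator; from here on localizations are
  replaced by multipliers \<open>s\<close> outside \<open>q\<close>.\<close>

lemma contracted_power_iff:
  assumes q: "prime_in A q"
  shows "f \<in> contracted_power A q n \<longleftrightarrow> f \<in> A \<and> (\<exists>s\<in>A - q. s * f \<in> ideal_power A q n)"
proof -
  let ?L = "localization A q" and ?I = "ideal_power A q n"
  have iq: "ideal_in A ?I" by (rule ideal_ideal_power[OF prime_in_imp_ideal[OF q]])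
  have s0: "s \<noteq> 0" if "s \<in> A - q" for s
    using that q by (auto simp: prime_in_def ideal_in_def)
  have LI: "Fraction_Field.Fract a s \<in> ?L" if "a \<in> A" "s \<in> A - q" for a s
    using that by (auto simp: localization_def)
  have one: "1 \<in> A - q" using q one_mem by (auto simp: prime_in_def)
  interpret L: idom_subset ?L
  proof
    show "0 \<in> ?L" using LI[OF zero_mem one] by (simp add: Zero_fract_def)
    show "1 \<in> ?L" using LI[OF one_mem one] by (simp add: One_fract_def)
    show "a + b \<in> ?L" "a * b \<in> ?L" if ab: "a \<in> ?L" "b \<in> ?L" for a b
    proof -
      obtain x s y t where *: "a = Fraction_Field.Fract x s" "b = Fraction_Field.Fract y t" "x \<in> A" "y \<in> A"
        "s \<in> A - q" "t \<in> A - q"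
        using ab by (auto simp: localization_def)
      have st: "s * t \<in> A - q" using *(5,6) prime_mult_notin[OF q] by blast
      show "a + b \<in> ?L" "a * b \<in> ?L"
        using LI[OF _ st, of "x * t + y * s"] LI[OF _ st, of "x * y"] * s0
        by (auto intro: add_mem mult_mem)
    qed
    show "- a \<in> ?L" if "a \<in> ?L" for a
    proof -
      obtain x s where "a = Fraction_Field.Fract x s" "x \<in> A" "s \<in> A - q"
        using \<open>a \<in> ?L\<close> by (auto simp: localization_def)
      then show ?thesis using LI[of "- x" s] uminus_mem by simp
    qed
  qed
  have sub: "to_fract ` ?I \<subseteq> ?L"
    using iq LI[OF _ one] by (auto simp: to_fract_def ideal_in_def)
  define K where "K = {Fraction_Field.Fract a s | a s. a \<in> ?I \<and> s \<in> A - q}"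
  have KI: "Fraction_Field.Fract a s \<in> K" if "a \<in> ?I" "s \<in> A - q" for a s
    using that by (auto simp: K_def)
  have K: "ideal_in ?L K"
    unfolding ideal_in_def
  proof (intro conjI ballI)
    show "K \<subseteq> ?L" using iq LI by (auto simp: K_def ideal_in_def)
    show "0 \<in> K" using KI[OF _ one, of 0] iq by (simp add: Zero_fract_def ideal_in_def)
    fix a b assume b: "b \<in> K"
    then obtain y t where y: "b = Fraction_Field.Fract y t" "y \<in> ?I" "t \<in> A - q"
      by (auto simp: K_def)
    { assume "a \<in> K"
      then obtain x s where x: "a = Fraction_Field.Fract x s" "x \<in> ?I" "s \<in> A - q"
        by (auto simp: K_def)
      have "x * t + y * s \<in> ?I"
        using ideal_add[OF iq] ideal_mult_right[OF iq] x y by blast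
      then show "a + b \<in> K"
        using KI[OF _ prime_mult_notin[OF q x(3) y(3)], of "x * t + y * s"] x y s0 by simp }
    { assume "a \<in> ?L"
      then obtain x s where x: "a = Fraction_Field.Fract x s" "x \<in> A" "s \<in> A - q"
        by (auto simp: localization_def)
      have "x * y \<in> ?I" using ideal_mult_left[OF iq] x y by blast
      then show "a * b \<in> K"
        using KI[OF _ prime_mult_notin[OF q x(3) y(3)], of "x * y"] x y s0 by simp }
  qed
  have "to_fract f \<in> Idl\<^bsub>ring_on ?L\<^esub> (to_fract ` ?I) \<longleftrightarrow> (\<exists>s\<in>A - q. s * f \<in> ?I)" if f: "f \<in> A"
  proof
    assume "to_fract f \<in> Idl\<^bsub>ring_on ?L\<^esub> (to_fract ` ?I)"
    moreover have "to_fract ` ?I \<subseteq> K"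
      using KI[OF _ one] by (auto simp: to_fract_def)
    ultimately have "to_fract f \<in> K" using L.ideal_genideal(3)[OF sub K] by blast
    then obtain a s where a: "to_fract f = Fraction_Field.Fract a s" "a \<in> ?I" "s \<in> A - q"
      by (auto simp: K_def)
    then have "s * f = a" using s0[OF a(3)] by (simp add: to_fract_def eq_fract mult.commute)
    then show "\<exists>s\<in>A - q. s * f \<in> ?I" using a by blast
  next
    assume "\<exists>s\<in>A - q. s * f \<in> ?I"
    then obtain s where s: "s \<in> A - q" "s * f \<in> ?I" by blast
    have "to_fract (s * f) \<in> Idl\<^bsub>ring_on ?L\<^esub> (to_fract ` ?I)"
      using L.ideal_genideal(2)[OF sub] s by blast
    then have "Fraction_Field.Fract 1 s * to_fract (s * f) \<in> Idl\<^bsub>ring_on ?L\<^esub> (to_fract ` ?I)"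
      using L.ideal_mult_left[OF L.ideal_genideal(1)[OF sub]] LI[OF one_mem s(1)] by blast
    moreover have "Fraction_Field.Fract 1 s * to_fract (s * f) = to_fract f"
      using s0[OF s(1)] by (simp add: to_fract_def eq_fract)
    ultimately show "to_fract f \<in> Idl\<^bsub>ring_on ?L\<^esub> (to_fract ` ?I)" by simp
  qed
  then show ?thesis by (auto simp: contracted_power_def simp flip: ideal_power_def)
qed

section \<open>Symbolic powers and the symbolic Rees algebra\<close>

lemma minimal_primes_iff:
  "P \<in> minimal_primes (ring_on A) I \<longleftrightarrow>
     prime_in A P \<and> I \<subseteq> P \<and> (\<forall>Q. prime_in A Q \<and> I \<subseteq> Q \<and> Q \<subseteq> P \<longrightarrow> Q = P)"
  by (simp add: minimal_primes_def prime_ring_on)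

text \<open>For exponent 0 the multiplier \<open>s = 1\<close> always works, so the special clause
  of the definition is absorbed and one criterion serves all exponents.\<close>

lemma symbolic_power_iff:
  "f \<in> symbolic_power A I n \<longleftrightarrow>
     f \<in> A \<and> (\<forall>q\<in>minimal_primes (ring_on A) I. \<exists>s\<in>A - q. s * f \<in> ideal_power A q n)"
proof (cases "n = 0")
  case True
  have "\<exists>s\<in>A - q. s * f \<in> A" if "q \<in> minimal_primes (ring_on A) I" "f \<in> A" for q
    using that one_mem by (intro bexI[of _ 1]) (auto simp: minimal_primes_iff prime_in_def)
  with True show ?thesis by (auto simp: symbolic_power_def)
next
  case False
  then show ?thesis
    by (auto simp: symbolic_power_def contracted_power_iff minimal_primes_iff)
qed

lemma ideal_symbolic_power: "ideal_in A (symbolic_power A I n)"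
  unfolding ideal_in_def
proof (intro conjI ballI)
  note id = ideal_ideal_power[OF prime_in_imp_ideal]
  show "symbolic_power A I n \<subseteq> A" by (auto simp: symbolic_power_iff)
  show "0 \<in> symbolic_power A I n"
    using id one_mem zero_mem
    by (auto simp: symbolic_power_iff minimal_primes_iff prime_in_def[of A] ideal_in_def)
  fix a b assume b: "b \<in> symbolic_power A I n"
  { assume a: "a \<in> symbolic_power A I n"
    show "a + b \<in> symbolic_power A I n"
      unfolding symbolic_power_iff
    proof (intro conjI ballI)
      show "a + b \<in> A" using a b by (auto simp: symbolic_power_iff intro: add_mem)
      fix q assume q: "q \<in> minimal_primes (ring_on A) I"
      then have pq: "prime_in A q" by (simp add: minimal_primes_iff)
      obtain s t where st: "s \<in> A - q" "t \<in> A - q" "s * a \<in> ideal_power A q n" "t * b \<in> ideal_power A q n"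
        using a b q by (meson symbolic_power_iff)
      have "t * (s * a) + s * (t * b) \<in> ideal_power A q n"
        using ideal_add[OF id[OF pq]] ideal_mult_left[OF id[OF pq]] st by blast
      then show "\<exists>s\<in>A - q. s * (a + b) \<in> ideal_power A q n"
        using prime_mult_notin[OF pq st(1,2)] by (intro bexI[of _ "s * t"]) (auto simp: algebra_simps)
    qed }
  { assume a: "a \<in> A"
    show "a * b \<in> symbolic_power A I n"
      unfolding symbolic_power_iff
    proof (intro conjI ballI)
      show "a * b \<in> A" using a b by (auto simp: symbolic_power_iff intro: mult_mem)
      fix q assume q: "q \<in> minimal_primes (ring_on A) I"
      then have pq: "prime_in A q" by (simp add: minimal_primes_iff)
      obtain t where t: "t \<in> A - q" "t * b \<in> ideal_power A q n"
        using b q by (meson symbolic_power_iff)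
      have "a * (t * b) \<in> ideal_power A q n"
        using ideal_mult_left[OF id[OF pq] t(2) a] .
      then show "\<exists>s\<in>A - q. s * (a * b) \<in> ideal_power A q n"
        using t by (intro bexI[of _ t]) (auto simp: algebra_simps)
    qed }
qed

lemma symbolic_power_mult:
  assumes "a \<in> symbolic_power A I m" "b \<in> symbolic_power A I n"
  shows "a * b \<in> symbolic_power A I (m + n)"
  unfolding symbolic_power_iff
proof (intro conjI ballI)
  show "a * b \<in> A" using assms by (auto simp: symbolic_power_iff intro: mult_mem)
  fix q assume q: "q \<in> minimal_primes (ring_on A) I"
  then have pq: "prime_in A q" by (simp add: minimal_primes_iff)
  obtain s t where st: "s \<in> A - q" "t \<in> A - q" "s * a \<in> ideal_power A q m" "t * b \<in> ideal_power A q n"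
    using assms q by (meson symbolic_power_iff)
  have "(s * a) * (t * b) \<in> ideal_power A q (m + n)"
    using ideal_power_mult[OF prime_in_imp_ideal[OF pq] st(3,4)] .
  then show "\<exists>s\<in>A - q. s * (a * b) \<in> ideal_power A q (m + n)"
    using prime_mult_notin[OF pq st(1,2)] by (intro bexI[of _ "s * t"]) (auto simp: algebra_simps)
qed

lemma idom_subset_symbolic_Rees: "idom_subset (symbolic_Rees_algebra A I)"
proof
  note sp = ideal_symbolic_power[of I]
  show "0 \<in> symbolic_Rees_algebra A I"
    using sp by (auto simp: symbolic_Rees_algebra_def ideal_in_def)
  show "1 \<in> symbolic_Rees_algebra A I"
  proof -
    have "0 \<in> symbolic_power A I n" "1 \<in> symbolic_power A I 0" for n
      using sp[of n] one_mem by (auto simp: ideal_in_def symbolic_power_def[of _ _ 0])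
    then show ?thesis
      by (auto simp: symbolic_Rees_algebra_def coeff_pCons one_pCons split: nat.split)
  qed
  show "a + b \<in> symbolic_Rees_algebra A I" "- a \<in> symbolic_Rees_algebra A I"
    if "a \<in> symbolic_Rees_algebra A I" "b \<in> symbolic_Rees_algebra A I" for a b
    using that ideal_add[OF sp] ideal_uminus[OF sp] by (auto simp: symbolic_Rees_algebra_def)
  show "a * b \<in> symbolic_Rees_algebra A I"
    if ab: "a \<in> symbolic_Rees_algebra A I" "b \<in> symbolic_Rees_algebra A I" for a b
    unfolding symbolic_Rees_algebra_def
  proof (safe, unfold coeff_mult, rule ideal_sum[OF sp])
    fix n i :: nat assume "i \<in> {..n}"
    then show "Polynomial.coeff a i * Polynomial.coeff b (n - i) \<in> symbolic_power A I n"
      using symbolic_power_mult[of "Polynomial.coeff a i" I i "Polynomial.coeff b (n - i)" "n - i"] ab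
      by (auto simp: symbolic_Rees_algebra_def)
  qed
qed

end

section \<open>Splittings from maps that are linear up to Frobenius\<close>

lemma to_closure_hom:
  "to_closure (0::'a::idom) = 0" "to_closure (1::'a) = 1"
  "to_closure (a + b :: 'a) = to_closure a + to_closure b"
  "to_closure (a * b :: 'a) = to_closure a * to_closure b"
  "to_closure (a :: 'a) = to_closure b \<longleftrightarrow> a = b"
  by (simp_all add: to_closure_def to_fract_def eq_fract flip: Zero_fract_def One_fract_def to_ac_add to_ac_mult)

lemma to_closure_power: "to_closure (a ^ n) = to_closure a ^ n"
  by (induction n) (auto simp: to_closure_hom)

lemma CHAR_fract: "CHAR('a::idom fract) = CHAR('a)"
proof (rule CHAR_eqI)
  have e: "of_nat n = (to_fract (of_nat n) :: 'a fract)" for n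
    by (simp add: to_fract_def of_nat_fract)
  show "of_nat CHAR('a) = (0 :: 'a fract)" by (simp add: e) (simp add: to_fract_def Zero_fract_def)
  show "CHAR('a) dvd n" if "of_nat n = (0 :: 'a fract)" for n
    using that by (simp add: e to_fract_def Zero_fract_def eq_fract of_nat_eq_0_iff_char_dvd)
qed

text \<open>Raising to the power \<open>Q = p^e\<close> identifies the ring of roots with
  \<open>A\<close>. Under this identification a linear map from the roots to \<open>A\<close> is an
  additive \<open>\<Psi>\<close> on \<open>A\<close> with
  \<open>\<Psi> (a ^ Q * b) = a * \<Psi> b\<close>, and splitting off the root of \<open>c\<close>
  means \<open>\<Psi> c = 1\<close>.\<close>

lemma strongly_F_regularI:
  fixes A :: "'a::idom set"
  assumes A: "idom_subset A" and p: "prime CHAR('a)"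
    and split: "\<And>c. c \<in> A \<Longrightarrow> c \<noteq> 0 \<Longrightarrow> \<exists>e\<ge>1. \<exists>\<Psi>. (\<forall>a\<in>A. \<Psi> a \<in> A) \<and>
      (\<forall>a\<in>A. \<forall>b\<in>A. \<Psi> (a + b) = \<Psi> a + \<Psi> b) \<and>
      (\<forall>a\<in>A. \<forall>b\<in>A. \<Psi> (a ^ (CHAR('a) ^ e) * b) = a * \<Psi> b) \<and> \<Psi> c = 1"
  shows "strongly_F_regular A"
  unfolding strongly_F_regular_def
proof (intro conjI ballI)
  interpret idom_subset A by (rule A)
  show "domain (ring_on A)" by (rule domain_ring_on)
  show "prime CHAR('a)" by (rule p)
  fix c assume "c \<in> A - {0}"
  then obtain e \<Psi> where e: "e \<ge> 1" and \<Psi>: "\<And>a. a \<in> A \<Longrightarrow> \<Psi> a \<in> A"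
    "\<And>a b. a \<in> A \<Longrightarrow> b \<in> A \<Longrightarrow> \<Psi> (a + b) = \<Psi> a + \<Psi> b"
    "\<And>a b. a \<in> A \<Longrightarrow> b \<in> A \<Longrightarrow> \<Psi> (a ^ (CHAR('a) ^ e) * b) = a * \<Psi> b" and c: "c \<in> A" "\<Psi> c = 1"
    using split[of c] by blast
  define Q where "Q = CHAR('a) ^ e"
  have Q0: "Q > 0" using p by (simp add: Q_def prime_gt_0_nat)
  obtain z where z: "z ^ Q = to_closure c"
    using nth_root_exists[OF Q0] by blast
  \<comment> \<open>The element of \<open>A\<close> represented by \<open>z ^ Q\<close>; it is
    unique because \<open>to_closure\<close> is injective.\<close>
  define root where "root z = (THE a. a \<in> A \<and> z ^ Q = to_closure a)" for z
  have root: "root z = a" if "a \<in> A" "z ^ Q = to_closure a" for z a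
    unfolding root_def using that by (intro the_equality) (auto simp: to_closure_hom(5))
  have mem: "\<exists>a\<in>A. z ^ Q = to_closure a" if "z \<in> root_ring A e" for z
    using that by (auto simp: root_ring_def Q_def)
  have add: "(u + v) ^ Q = u ^ Q + v ^ Q" for u v :: "'a fract alg_closure"
    by (rule freshmans_dream'[where n = e]) (use p in \<open>auto simp: Q_def CHAR_fract\<close>)
  have "linear_to_base A (root_ring A e) (\<lambda>z. \<Psi> (root z))"
    unfolding linear_to_base_def
  proof (intro conjI ballI)
    fix u v assume uv: "u \<in> root_ring A e"
    then obtain a where a: "a \<in> A" "u ^ Q = to_closure a" using mem by blast
    show "\<Psi> (root u) \<in> A" using root[OF a] \<Psi> a by simp
    { assume "v \<in> root_ring A e"
      then obtain b where b: "b \<in> A" "v ^ Q = to_closure b" using mem by blast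
      have "root (u + v) = a + b"
        by (rule root) (use a b in \<open>auto simp: add to_closure_hom intro: add_mem\<close>)
      then show "\<Psi> (root (u + v)) = \<Psi> (root u) + \<Psi> (root v)"
        using root[OF a] root[OF b] \<Psi> a b by simp }
    { fix b assume b: "b \<in> A"
      have "root (to_closure b * u) = b ^ Q * a"
        by (rule root)
           (use a b in \<open>auto simp: power_mult_distrib to_closure_hom to_closure_power intro: mult_mem power_mem\<close>)
      then show "\<Psi> (root (to_closure b * u)) = b * \<Psi> (root u)"
        using root[OF a] \<Psi> a b by (simp add: Q_def) }
  qed
  moreover have "\<Psi> (root (to_closure a * z)) = a" if a: "a \<in> A" for a
  proof -
    have "root (to_closure a * z) = a ^ Q * c"
      by (rule root)
         (use a c z in \<open>auto simp: power_mult_distrib to_closure_hom to_closure_power intro: mult_mem power_mem\<close>)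
    then show ?thesis using \<Psi> a c by (simp add: Q_def)
  qed
  moreover have "z \<in> root_ring A e" using z c by (auto simp: root_ring_def Q_def)
  ultimately show "\<exists>e\<ge>1. \<exists>z\<in>root_ring A e. z ^ (CHAR('a) ^ e) = to_closure c \<and>
        (\<exists>\<phi>. linear_to_base A (root_ring A e) \<phi> \<and> (\<forall>a\<in>A. \<phi> (to_closure a * z) = a))"
    using e z unfolding Q_def by (intro exI[of _ e] conjI bexI[of _ z] exI[of _ "\<lambda>z. \<Psi> (root z)"]) auto
qed

subsection \<open>Single monomials and Frobenius\<close>

lemma CHAR_poly_mapping: "CHAR('a::comm_monoid_add \<Rightarrow>\<^sub>0 'b::comm_semiring_1) = CHAR('b)"
proof (rule CHAR_eqI)
  have e: "of_nat n = (0 :: 'a \<Rightarrow>\<^sub>0 'b) \<longleftrightarrow> of_nat n = (0 :: 'b)" for n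
  proof
    assume "of_nat n = (0 :: 'a \<Rightarrow>\<^sub>0 'b)"
    then have "Poly_Mapping.lookup (of_nat n :: 'a \<Rightarrow>\<^sub>0 'b) 0 = 0" by simp
    then show "of_nat n = (0 :: 'b)" by (simp only: of_nat_single comp_apply lookup_single_eq)
  next
    assume "of_nat n = (0 :: 'b)"
    then show "of_nat n = (0 :: 'a \<Rightarrow>\<^sub>0 'b)" by (simp only: of_nat_single comp_apply single_zero)
  qed
  show "of_nat CHAR('b) = (0 :: 'a \<Rightarrow>\<^sub>0 'b)" by (simp only: e of_nat_CHAR)
  show "CHAR('b) dvd n" if "of_nat n = (0 :: 'a \<Rightarrow>\<^sub>0 'b)" for n
    using that by (simp only: e of_nat_eq_0_iff_char_dvd)
qed

lemma poly_mapping_eq_sum_single: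
  "f = (\<Sum>m\<in>Poly_Mapping.keys f. Poly_Mapping.single m (Poly_Mapping.lookup f m))"
  by (rule poly_mapping_eqI) (simp add: lookup_sum lookup_single when_def in_keys_iff)

lemma lookup_single_mult_add:
  fixes m n :: "'m::cancel_comm_monoid_add" and f :: "'m \<Rightarrow>\<^sub>0 'b::semiring_0"
  shows "Poly_Mapping.lookup (Poly_Mapping.single m c * f) (m + n) = c * Poly_Mapping.lookup f n"
proof -
  have "Poly_Mapping.lookup (Poly_Mapping.single m c * f) (m + n) =
    (\<Sum>l. (c * (\<Sum>q. Poly_Mapping.lookup f q when m + n = l + q)) when m = l)"
    unfolding lookup_mult lookup_single by (rule Sum_any.cong) (simp add: when_def)
  also have "\<dots> = c * (\<Sum>q. Poly_Mapping.lookup f q when m + n = m + q)"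
    by (rule Sum_any_when_equal')
  also have "\<dots> = c * (\<Sum>q. Poly_Mapping.lookup f q when n = q)"
    by (simp only: add_left_cancel)
  also have "\<dots> = c * Poly_Mapping.lookup f n" by (simp only: Sum_any_when_equal')
  finally show ?thesis .
qed

lemma lookup_single_mult_eq_0:
  fixes m k :: "'m::cancel_comm_monoid_add" and f :: "'m \<Rightarrow>\<^sub>0 'b::semiring_0"
  assumes "\<And>n. k \<noteq> m + n"
  shows "Poly_Mapping.lookup (Poly_Mapping.single m c * f) k = 0"
proof (rule ccontr)
  assume "Poly_Mapping.lookup (Poly_Mapping.single m c * f) k \<noteq> 0"
  then have "k \<in> Poly_Mapping.keys (Poly_Mapping.single m c * f)" by (simp add: in_keys_iff)
  then obtain n where "k = m + n"
    using keys_mult[of "Poly_Mapping.single m c" f] by (auto split: if_splits)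
  with assms show False by blast
qed

lemma single_power:
  "Poly_Mapping.single m (c::'b::comm_semiring_1) ^ n =
     Poly_Mapping.single (Poly_Mapping.map ((*) n) (m :: 'v \<Rightarrow>\<^sub>0 nat)) (c ^ n)"
proof (induction n)
  case 0
  have "Poly_Mapping.map ((*) 0) m = 0"
    by (rule poly_mapping_eqI) (simp add: map.rep_eq)
  then show ?case by (simp only: power_0 single_one)
next
  case (Suc n)
  have "m + Poly_Mapping.map ((*) n) m = Poly_Mapping.map ((*) (Suc n)) m"
    by (rule poly_mapping_eqI) (simp add: map.rep_eq lookup_add when_def)
  then show ?case by (simp only: power_Suc Suc mult_single)
qed

text \<open>Let \<open>k\<close> act on itself by sending \<open>(a, b)\<close> to
  \<open>a ^ Q * b\<close>. This is a vector space because \<open>Q\<close> is a power of the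
  characteristic, and the independent set consisting of \<open>a0\<close> extends to a basis, which
  gives a linear functional with value 1 at \<open>a0\<close>.\<close>

lemma frobenius_functional:
  fixes a0 :: "'k::field"
  assumes p: "prime CHAR('k)" and Q: "Q = CHAR('k) ^ e" and a0: "a0 \<noteq> 0"
  obtains \<pi> :: "'k \<Rightarrow> 'k" where "\<And>a b. \<pi> (a + b) = \<pi> a + \<pi> b"
    "\<And>a b. \<pi> (a ^ Q * b) = a * \<pi> b" "\<pi> a0 = 1"
proof -
  have Q0: "Q > 0" using p by (simp add: Q prime_gt_0_nat)
  interpret v: vector_space_pair "\<lambda>a b :: 'k. a ^ Q * b" "\<lambda>a b :: 'k. a * b"
    by unfold_locales
      (auto simp: algebra_simps power_mult_distrib freshmans_dream'[OF p Q])
  have "v.vs1.independent {a0}" using a0 Q0 by simp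
  then obtain g where g: "Vector_Spaces.linear (\<lambda>a b :: 'k. a ^ Q * b) (\<lambda>a b :: 'k. a * b) g" "g a0 = 1"
    using v.linear_independent_extend[of "{a0}" "\<lambda>_. 1"] by auto
  interpret g: Vector_Spaces.linear "\<lambda>a b :: 'k. a ^ Q * b" "\<lambda>a b :: 'k. a * b" g by (rule g(1))
  show thesis by (rule that[of g]) (use g in \<open>auto simp: g.add g.scale\<close>)
qed

subsection \<open>Leading monomials\<close>

text \<open>Monomials are compared through a key \<open>\<kappa>\<close>, so that the single order
  on the type of exponents can be turned into a different monomial order for each permutation of the
  vertices.\<close>

definition lead :: "(('v \<Rightarrow>\<^sub>0 nat) \<Rightarrow> 'w::linorder) \<Rightarrow> (('v \<Rightarrow>\<^sub>0 nat) \<Rightarrow>\<^sub>0 'k::zero) \<Rightarrow> ('v \<Rightarrow>\<^sub>0 nat) \<Rightarrow> bool" where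
  "lead \<kappa> f m \<longleftrightarrow> m \<in> Poly_Mapping.keys f \<and> (\<forall>n\<in>Poly_Mapping.keys f. \<kappa> n \<le> \<kappa> m)"

locale monomial_order =
  fixes \<kappa> :: "('v::linorder \<Rightarrow>\<^sub>0 nat) \<Rightarrow> 'w::linordered_cancel_ab_semigroup_add"
  assumes key_add: "\<kappa> (m + n) = \<kappa> m + \<kappa> n" and key_inj: "inj \<kappa>"
    and key_less: "n \<noteq> 0 \<Longrightarrow> \<kappa> m < \<kappa> (m + n)"
begin

lemma lead_exists:
  assumes "f \<noteq> 0" obtains m where "lead \<kappa> f m"
proof -
  have ne: "Poly_Mapping.keys f \<noteq> {}"
    using assms by (metis Poly_Mapping.keys_eq_empty)
  then have "Max (\<kappa> ` Poly_Mapping.keys f) \<in> \<kappa> ` Poly_Mapping.keys f"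
    by (intro Max_in) auto
  then obtain m where "m \<in> Poly_Mapping.keys f" "\<kappa> m = Max (\<kappa> ` Poly_Mapping.keys f)" by auto
  then show thesis by (intro that) (auto simp: lead_def)
qed

text \<open>By strict monotonicity of addition, \<open>(m, n)\<close> is the only pair of occurring
  monomials with sum \<open>m + n\<close>. The coefficient there is a product of two nonzero field
  elements.\<close>

lemma lead_mult:
  fixes f g :: "('v \<Rightarrow>\<^sub>0 nat) \<Rightarrow>\<^sub>0 'k::field"
  assumes f: "lead \<kappa> f m" and g: "lead \<kappa> g n"
  shows "lead \<kappa> (f * g) (m + n)"
proof -
  have uniq: "l = m \<and> q = n"
    if "l \<in> Poly_Mapping.keys f" "q \<in> Poly_Mapping.keys g" "m + n = l + q" for l q
  proof -
    have *: "\<kappa> l \<le> \<kappa> m" "\<kappa> q \<le> \<kappa> n" using that f g by (auto simp: lead_def)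
    have e: "\<kappa> m + \<kappa> n = \<kappa> l + \<kappa> q" using that(3) by (metis key_add)
    have "\<kappa> l = \<kappa> m"
    proof (rule ccontr)
      assume "\<kappa> l \<noteq> \<kappa> m"
      then have "\<kappa> l + \<kappa> q < \<kappa> m + \<kappa> n" using * by (intro add_less_le_mono) auto
      with e show False by simp
    qed
    then have "l = m" using key_inj by (auto dest: injD)
    with that show ?thesis by auto
  qed
  have "Poly_Mapping.lookup (f * g) (m + n) =
    (\<Sum>l. (Poly_Mapping.lookup f m * Poly_Mapping.lookup g n) when l = m)"
    unfolding lookup_mult
  proof (rule Sum_any.cong)
    fix l
    have "(Poly_Mapping.lookup f l * (\<Sum>q. Poly_Mapping.lookup g q when m + n = l + q)) =
      (Poly_Mapping.lookup f l * (\<Sum>q. (Poly_Mapping.lookup g n when l = m) when q = n))"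
    proof (cases "l \<in> Poly_Mapping.keys f")
      case True
      have "(\<Sum>q. Poly_Mapping.lookup g q when m + n = l + q) =
            (\<Sum>q. (Poly_Mapping.lookup g n when l = m) when q = n)"
      proof (rule Sum_any.cong)
        fix q
        show "(Poly_Mapping.lookup g q when m + n = l + q) =
            ((Poly_Mapping.lookup g n when l = m) when q = n)"
          using uniq[OF True, of q] by (auto simp: when_def in_keys_iff)
      qed
      then show ?thesis by simp
    qed (simp add: in_keys_iff)
    then show "Poly_Mapping.lookup f l * (\<Sum>q. Poly_Mapping.lookup g q when m + n = l + q) =
         (Poly_Mapping.lookup f m * Poly_Mapping.lookup g n when l = m)"
      by (auto simp: when_def)
  qed
  then have "m + n \<in> Poly_Mapping.keys (f * g)"
    using f g by (simp add: lead_def in_keys_iff)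
  moreover have "\<kappa> k \<le> \<kappa> (m + n)" if "k \<in> Poly_Mapping.keys (f * g)" for k
    using keys_mult[of f g] that f g by (fastforce simp: lead_def key_add intro: add_mono)
  ultimately show ?thesis by (simp add: lead_def)
qed

lemma lead_1: "lead \<kappa> 1 0"
  by (simp add: lead_def)

lemma lead_power:
  fixes f :: "('v \<Rightarrow>\<^sub>0 nat) \<Rightarrow>\<^sub>0 'k::field"
  assumes "lead \<kappa> f m" shows "lead \<kappa> (f ^ n) (\<Sum>i<n. m)"
  by (induction n) (auto simp: lead_1 add.commute intro: lead_mult[OF assms] simp del: sum_constant)

lemma lead_prod:
  fixes f :: "'i \<Rightarrow> ('v \<Rightarrow>\<^sub>0 nat) \<Rightarrow>\<^sub>0 'k::field"
  assumes "\<And>i. i \<in> I \<Longrightarrow> lead \<kappa> (f i) (m i)" shows "lead \<kappa> (prod f I) (sum m I)"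
  using assms by (induction I rule: infinite_finite_induct) (auto intro: lead_1 lead_mult)

end

subsection \<open>Cartier operators on polynomials\<close>

definition polys_in :: "'v set \<Rightarrow> (('v \<Rightarrow>\<^sub>0 nat) \<Rightarrow>\<^sub>0 'k::zero) set" where
  "polys_in V = {f. \<forall>m\<in>Poly_Mapping.keys f. Poly_Mapping.keys m \<subseteq> V}"

lemma polys_in_single:
  "Poly_Mapping.keys m \<subseteq> V \<Longrightarrow> Poly_Mapping.single m c \<in> polys_in V"
  by (auto simp: polys_in_def)

lemma idom_subset_polys_in:
  "idom_subset (polys_in V :: (('v::linorder \<Rightarrow>\<^sub>0 nat) \<Rightarrow>\<^sub>0 'k::field) set)"
proof
  show "0 \<in> (polys_in V :: (('v::linorder \<Rightarrow>\<^sub>0 nat) \<Rightarrow>\<^sub>0 'k::field) set)" by (simp add: polys_in_def)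
  show "1 \<in> (polys_in V :: (('v::linorder \<Rightarrow>\<^sub>0 nat) \<Rightarrow>\<^sub>0 'k::field) set)" by (simp add: polys_in_def)
  fix f g :: "('v \<Rightarrow>\<^sub>0 nat) \<Rightarrow>\<^sub>0 'k" assume f: "f \<in> polys_in V"
  show "- f \<in> polys_in V" using f by (auto simp: polys_in_def in_keys_iff)
  assume g: "g \<in> polys_in V"
  show "f + g \<in> polys_in V" using f g keys_add[of f g] by (auto simp: polys_in_def)
  show "f * g \<in> polys_in V"
    using f g keys_mult[of f g] by (fastforce simp: polys_in_def dest: subsetD[OF keys_add])
qed

text \<open>
  With \<open>\<pi>\<close> linear over the \<open>Q\<close>-th powers of constants and all exponents of \<open>\<alpha>\<close> below \<open>Q\<close>, this is the
  coordinate of the basis element \<open>\<alpha>\<close> of the polynomials over their \<open>Q\<close>-th powers, followed by the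
  \<open>Q\<close>-th root.
\<close>

definition cartier :: "('k \<Rightarrow> 'k) \<Rightarrow> nat \<Rightarrow> ('v \<Rightarrow>\<^sub>0 nat) \<Rightarrow> (('v \<Rightarrow>\<^sub>0 nat) \<Rightarrow>\<^sub>0 'k::zero) \<Rightarrow> (('v \<Rightarrow>\<^sub>0 nat) \<Rightarrow>\<^sub>0 'k)" where
  "cartier \<pi> Q \<alpha> f = Abs_poly_mapping (\<lambda>n. \<pi> (Poly_Mapping.lookup f (\<alpha> + Poly_Mapping.map ((*) Q) n)))"

lemma lookup_map_times [simp]:
  "Poly_Mapping.lookup (Poly_Mapping.map ((*) Q) n) i = (Q :: nat) * Poly_Mapping.lookup n i"
  by (simp add: map.rep_eq when_def)

text \<open>\<open>Abs_poly_mapping\<close> may be evaluated because the support is finite: it is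
  contained in the preimage of the support of \<open>f\<close> under the injective map sending
  \<open>n\<close> to \<open>\<alpha> + Q n\<close>.\<close>

lemma lookup_cartier:
  assumes "\<pi> 0 = 0" "Q > 0"
  shows "Poly_Mapping.lookup (cartier \<pi> Q \<alpha> f) n = \<pi> (Poly_Mapping.lookup f (\<alpha> + Poly_Mapping.map ((*) Q) n))"
proof -
  let ?h = "\<lambda>n. \<alpha> + Poly_Mapping.map ((*) Q) n"
  have inj: "inj ?h"
  proof (rule injI)
    fix m n assume "?h m = ?h n"
    then have "Poly_Mapping.map ((*) Q) m = Poly_Mapping.map ((*) Q) n" by simp
    then have "Q * Poly_Mapping.lookup m i = Q * Poly_Mapping.lookup n i" for i
      by (metis lookup_map_times)
    then show "m = n" using assms(2) by (intro poly_mapping_eqI) simp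
  qed
  have "finite (?h -` Poly_Mapping.keys f)"
    by (rule finite_vimageI[OF finite_keys inj])
  moreover have "{n. \<pi> (Poly_Mapping.lookup f (?h n)) \<noteq> 0} \<subseteq> ?h -` Poly_Mapping.keys f"
    by (auto simp: in_keys_iff assms(1))
  ultimately have "finite {n. \<pi> (Poly_Mapping.lookup f (?h n)) \<noteq> 0}"
    using finite_subset by blast
  then show ?thesis by (simp add: cartier_def)
qed

locale cartier_operator =
  fixes \<pi> :: "'k::field \<Rightarrow> 'k" and Q e :: nat and \<alpha> :: "'v::linorder \<Rightarrow>\<^sub>0 nat"
  assumes p: "prime CHAR('k)" and Q: "Q = CHAR('k) ^ e"
    and \<pi>_add: "\<pi> (a + b) = \<pi> a + \<pi> b" and \<pi>_scale: "\<pi> (a ^ Q * b) = a * \<pi> b"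
    and \<alpha>: "Poly_Mapping.lookup \<alpha> i < Q"
begin

abbreviation "\<psi> \<equiv> cartier \<pi> Q \<alpha>"

lemma Q_pos: "Q > 0" using p by (simp add: Q prime_gt_0_nat)

lemma \<pi>_0: "\<pi> 0 = 0" using \<pi>_add[of 0 0] by (metis add.right_neutral add_left_cancel)

lemmas lookup_\<psi> = lookup_cartier[where \<pi> = \<pi>, OF \<pi>_0 Q_pos]

lemma \<psi>_add: "\<psi> (f + g) = \<psi> f + \<psi> g"
  by (rule poly_mapping_eqI) (simp add: lookup_\<psi> lookup_add \<pi>_add)

lemma \<psi>_0: "\<psi> 0 = 0"
  by (rule poly_mapping_eqI) (simp add: lookup_\<psi> \<pi>_0)

lemma \<psi>_sum: "\<psi> (sum f I) = (\<Sum>i\<in>I. \<psi> (f i))"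
  by (induction I rule: infinite_finite_induct) (auto simp: \<psi>_0 \<psi>_add)

text \<open>Frobenius is additive, so \<open>g ^ Q\<close> is the sum of the powers of the terms of
  \<open>g\<close>, and a single term merely shifts the exponents at which coefficients are
  read.\<close>

lemma \<psi>_scale: "\<psi> (g ^ Q * f) = g * \<psi> f"
proof -
  have single: "\<psi> (Poly_Mapping.single m c ^ Q * f) = Poly_Mapping.single m c * \<psi> f" for m c
  proof (rule poly_mapping_eqI)
    fix n
    show "Poly_Mapping.lookup (\<psi> (Poly_Mapping.single m c ^ Q * f)) n =
      Poly_Mapping.lookup (Poly_Mapping.single m c * \<psi> f) n"
    proof (cases "\<exists>n'. n = m + n'")
      case True
      then obtain n' where n: "n = m + n'" by blast
      have "\<alpha> + Poly_Mapping.map ((*) Q) n =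
          Poly_Mapping.map ((*) Q) m + (\<alpha> + Poly_Mapping.map ((*) Q) n')"
        by (rule poly_mapping_eqI) (simp add: n lookup_add algebra_simps)
      then show ?thesis
        by (simp add: lookup_\<psi> single_power lookup_single_mult_add n \<pi>_scale)
    next
      case False
      \<comment> \<open>Here the exponents of \<open>\<alpha>\<close> being below \<open>Q\<close>
        matter: if \<open>\<alpha> + Q n\<close> were divisible by \<open>Q m\<close>, then
        \<open>m\<close> would divide \<open>n\<close>. So both sides have coefficient 0.\<close>
      have "\<alpha> + Poly_Mapping.map ((*) Q) n \<noteq> Poly_Mapping.map ((*) Q) m + k" for k
      proof
        assume "\<alpha> + Poly_Mapping.map ((*) Q) n = Poly_Mapping.map ((*) Q) m + k"
        then have *: "Poly_Mapping.lookup \<alpha> i + Q * Poly_Mapping.lookup n i =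
           Q * Poly_Mapping.lookup m i + Poly_Mapping.lookup k i" for i
          by (metis lookup_add lookup_map_times)
        have "Q * Poly_Mapping.lookup m i < Q * Suc (Poly_Mapping.lookup n i)" for i
        proof -
          have "Q * Poly_Mapping.lookup m i \<le> Poly_Mapping.lookup \<alpha> i + Q * Poly_Mapping.lookup n i"
            using *[of i] by linarith
          then show ?thesis using \<alpha>[of i] by simp
        qed
        then have "Poly_Mapping.lookup m i \<le> Poly_Mapping.lookup n i" for i
          by (metis less_Suc_eq_le mult_less_cancel1)
        then have "n = m + (n - m)"
          by (intro poly_mapping_eqI) (simp add: lookup_add lookup_minus)
        with False show False by blast
      qed
      then show ?thesis using False
        by (simp add: lookup_\<psi> single_power lookup_single_mult_eq_0 \<pi>_0)
    qed
  qed
  have "g ^ Q = (\<Sum>m\<in>Poly_Mapping.keys g. Poly_Mapping.single m (Poly_Mapping.lookup g m) ^ Q)"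
    by (subst poly_mapping_eq_sum_single[of g], rule freshmans_dream_sum'[where n = e])
       (use p Q in \<open>auto simp: CHAR_poly_mapping\<close>)
  then have "\<psi> (g ^ Q * f) =
      (\<Sum>m\<in>Poly_Mapping.keys g. Poly_Mapping.single m (Poly_Mapping.lookup g m)) * \<psi> f"
    by (simp add: sum_distrib_right \<psi>_sum single)
  then show ?thesis by (simp only: poly_mapping_eq_sum_single[symmetric])
qed

lemma \<psi>_mem: "f \<in> polys_in V \<Longrightarrow> \<psi> f \<in> polys_in V"
  unfolding polys_in_def
proof safe
  fix n i assume f: "\<forall>m\<in>Poly_Mapping.keys f. Poly_Mapping.keys m \<subseteq> V"
    and n: "n \<in> Poly_Mapping.keys (\<psi> f)" and i: "i \<in> Poly_Mapping.keys n"
  have "\<pi> (Poly_Mapping.lookup f (\<alpha> + Poly_Mapping.map ((*) Q) n)) \<noteq> 0"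
    using n by (simp only: in_keys_iff lookup_\<psi> not_False_eq_True)
  then have "\<alpha> + Poly_Mapping.map ((*) Q) n \<in> Poly_Mapping.keys f"
    unfolding in_keys_iff using \<pi>_0 by metis
  moreover have "i \<in> Poly_Mapping.keys (\<alpha> + Poly_Mapping.map ((*) Q) n)"
    using i Q_pos by (simp add: in_keys_iff lookup_add)
  ultimately show "i \<in> V" using f by blast
qed

text \<open>The coefficient at \<open>n\<close> is read off \<open>f\<close> at
  \<open>\<alpha> + Q n\<close>. For \<open>n \<noteq> 0\<close> this lies strictly above the
  leading monomial \<open>\<alpha>\<close>, where \<open>f\<close> has no terms; for
  \<open>n = 0\<close> it is the leading coefficient.\<close>

lemma \<psi>_eq_1:
  assumes "monomial_order \<kappa>" "lead \<kappa> f \<alpha>" "\<pi> (Poly_Mapping.lookup f \<alpha>) = 1"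
  shows "\<psi> f = 1"
proof (rule poly_mapping_eqI)
  interpret monomial_order \<kappa> by (rule assms(1))
  fix n
  show "Poly_Mapping.lookup (\<psi> f) n = Poly_Mapping.lookup 1 n"
  proof (cases "n = 0")
    case True
    have "Poly_Mapping.map ((*) Q) 0 = (0 :: 'v \<Rightarrow>\<^sub>0 nat)" by (rule poly_mapping_eqI) simp
    with True assms(3) show ?thesis by (simp add: lookup_\<psi>)
  next
    case False
    then obtain i where "Poly_Mapping.lookup n i \<noteq> 0"
      by (metis lookup_zero poly_mapping_eqI)
    then have "Poly_Mapping.map ((*) Q) n \<noteq> 0"
      using Q_pos by (metis lookup_map_times lookup_zero mult_is_0 not_gr_zero)
    then have "\<kappa> \<alpha> < \<kappa> (\<alpha> + Poly_Mapping.map ((*) Q) n)" by (rule key_less)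
    then have "\<alpha> + Poly_Mapping.map ((*) Q) n \<notin> Poly_Mapping.keys f"
      using assms(2) by (auto simp: lead_def)
    then show ?thesis using False by (simp add: lookup_\<psi> in_keys_iff \<pi>_0 lookup_one)
  qed
qed

end

text \<open>\<open>N\<close> bounds the exponents of the leading monomial of \<open>c\<close> and is
  fixed before \<open>Q\<close>, which may still be taken large. With \<open>m = Q - 1 - N\<close>
  and \<open>\<mu>\<close> squarefree, the leading exponents of \<open>F ^ m * c\<close> are at most
  \<open>m + N = Q - 1\<close>.\<close>

lemma exists_cartier_operator:
  fixes F c :: "('v::linorder \<Rightarrow>\<^sub>0 nat) \<Rightarrow>\<^sub>0 'k::field"
  assumes p: "prime CHAR('k)" and \<kappa>: "monomial_order \<kappa>"
    and F: "lead \<kappa> F \<mu>" and \<mu>: "\<And>i. Poly_Mapping.lookup \<mu> i \<le> 1" and c: "c \<noteq> 0"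
  obtains N where "\<And>Q e. Q = CHAR('k) ^ e \<Longrightarrow> N < Q \<Longrightarrow>
    \<exists>\<pi> \<alpha>. cartier_operator \<pi> Q e \<alpha> \<and> cartier \<pi> Q \<alpha> (F ^ (Q - 1 - N) * c) = 1"
proof -
  interpret monomial_order \<kappa> by (rule \<kappa>)
  obtain \<gamma> where \<gamma>: "lead \<kappa> c \<gamma>" using lead_exists[OF c] .
  define N where "N = Max (insert 0 (Poly_Mapping.lookup \<gamma> ` Poly_Mapping.keys \<gamma>))"
  have N: "Poly_Mapping.lookup \<gamma> i \<le> N" for i
    by (cases "i \<in> Poly_Mapping.keys \<gamma>") (auto simp: N_def in_keys_iff)
  show thesis
  proof (rule that[of N])
    fix Q e assume Q: "Q = CHAR('k) ^ e" "N < Q"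
    define m where "m = Q - 1 - N"
    define \<alpha> where "\<alpha> = (\<Sum>i<m. \<mu>) + \<gamma>"
    have lead: "lead \<kappa> (F ^ m * c) \<alpha>"
      unfolding \<alpha>_def by (intro lead_mult lead_power F \<gamma>)
    have \<alpha>: "Poly_Mapping.lookup \<alpha> i < Q" for i
    proof -
      have "Poly_Mapping.lookup \<alpha> i = m * Poly_Mapping.lookup \<mu> i + Poly_Mapping.lookup \<gamma> i"
        by (simp add: \<alpha>_def lookup_add lookup_sum del: sum_constant) simp
      also have "\<dots> \<le> m * 1 + N" by (intro add_mono mult_left_mono \<mu> N) auto
      finally show ?thesis using Q by (simp add: m_def)
    qed
    have "Poly_Mapping.lookup (F ^ m * c) \<alpha> \<noteq> 0" using lead by (simp add: lead_def in_keys_iff)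
    then obtain \<pi> where \<pi>: "\<And>a b. \<pi> (a + b) = \<pi> a + \<pi> b" "\<And>a b. \<pi> (a ^ Q * b) = a * \<pi> b"
      "\<pi> (Poly_Mapping.lookup (F ^ m * c) \<alpha>) = 1"
      using frobenius_functional[OF p Q(1)] by blast
    interpret cartier_operator \<pi> Q e \<alpha>
      by unfold_locales (use p Q \<pi> \<alpha> in auto)
    show "\<exists>\<pi> \<alpha>. cartier_operator \<pi> Q e \<alpha> \<and> cartier \<pi> Q \<alpha> (F ^ (Q - 1 - N) * c) = 1"
      using cartier_operator_axioms \<psi>_eq_1[OF \<kappa> lead \<pi>(3)] unfolding m_def by blast
  qed
qed

subsection \<open>A criterion for strong F-regularity\<close>

text \<open>For finite \<open>K\<close> and all \<open>z i\<close> in \<open>A\<close> this is the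
  \<open>n\<close>-th power of the ideal generated by the \<open>z i\<close>, in the form of
  explicit sums of monomials, to which the pigeonhole argument can be applied.\<close>

inductive_set generated_power :: "'a::comm_ring_1 set \<Rightarrow> 'i set \<Rightarrow> ('i \<Rightarrow> 'a) \<Rightarrow> nat \<Rightarrow> 'a set"
  for A :: "'a set" and K :: "'i set" and z :: "'i \<Rightarrow> 'a" and n :: nat where
  zero: "0 \<in> generated_power A K z n"
| monomial: "a \<in> A \<Longrightarrow> sum e K \<ge> n \<Longrightarrow> a * (\<Prod>i\<in>K. z i ^ e i) \<in> generated_power A K z n"
| add: "f \<in> generated_power A K z n \<Longrightarrow> g \<in> generated_power A K z n \<Longrightarrow> f + g \<in> generated_power A K z n"

text \<open>For a prime \<open>P\<close> this says, with denominators cleared, that the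
  \<open>z i\<close> generate the maximal ideal of the localization at \<open>P\<close>.\<close>

definition locally_generated :: "'a::comm_ring_1 set \<Rightarrow> 'a set \<Rightarrow> 'i set \<Rightarrow> ('i \<Rightarrow> 'a) \<Rightarrow> bool" where
  "locally_generated A P K z \<longleftrightarrow> finite K \<and> z ` K \<subseteq> P \<and>
     (\<forall>f\<in>P. \<exists>t\<in>A - P. t * f \<in> generated_power A K z 1)"

context idom_subset
begin

lemma generated_power_mult_left:
  assumes "f \<in> generated_power A K z n" "b \<in> A" shows "b * f \<in> generated_power A K z n"
  using assms(1)
proof induction
  case (monomial a e)
  then show ?case
    using generated_power.monomial[of "b * a" A n e K z] assms(2) by (auto simp: mult.assoc mult_mem)
qed (auto simp: distrib_left intro: generated_power.intros)

lemma generated_power_mult: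
  assumes "f \<in> generated_power A K z m" "g \<in> generated_power A K z n"
  shows "f * g \<in> generated_power A K z (m + n)"
  using assms(1)
proof induction
  case (monomial a e)
  show ?case using assms(2)
  proof induction
    case (monomial b e')
    have "a * (\<Prod>i\<in>K. z i ^ e i) * (b * (\<Prod>i\<in>K. z i ^ e' i)) =
        a * b * (\<Prod>i\<in>K. z i ^ (e i + e' i))"
      by (simp add: power_add prod.distrib mult_ac)
    moreover have "m + n \<le> (\<Sum>i\<in>K. e i + e' i)"
      using \<open>m \<le> sum e K\<close> monomial by (simp add: sum.distrib)
    ultimately show ?case
      using generated_power.monomial[of "a * b" A "m + n" "\<lambda>i. e i + e' i" K z] mult_mem \<open>a \<in> A\<close> monomial
      by (simp only:)
  qed (auto simp: distrib_left intro: generated_power.intros)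
qed (auto simp: distrib_right intro: generated_power.intros)

lemma ideal_generated_power:
  assumes "z ` K \<subseteq> A" shows "ideal_in A (generated_power A K z n)"
  unfolding ideal_in_def
proof (intro conjI ballI)
  show "generated_power A K z n \<subseteq> A"
  proof
    fix f assume "f \<in> generated_power A K z n"
    then show "f \<in> A"
      by induction (use assms in \<open>auto intro!: zero_mem add_mem mult_mem prod_mem power_mem\<close>)
  qed
qed (auto intro: generated_power.intros generated_power_mult_left)

lemma generated_power_generator:
  assumes "finite K" "i \<in> K" shows "z i \<in> generated_power A K z 1"
proof -
  have "(\<Prod>j\<in>K. z j ^ (if j = i then 1 else 0)) = z i"
    using assms by (subst prod.remove[of K i]) auto
  then show ?thesis
    using generated_power.monomial[of 1 A 1 "\<lambda>j. if j = i then 1 else 0" K z] assms one_mem by simp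
qed

lemma locally_generated_power:
  assumes P: "prime_in A P" and z: "locally_generated A P K z" and f: "f \<in> ideal_power A P n"
  shows "\<exists>t\<in>A - P. t * f \<in> generated_power A K z n"
  using f
proof (induction n arbitrary: f)
  case 0
  have "f * (\<Prod>i\<in>K. z i ^ 0) \<in> generated_power A K z 0"
    by (rule generated_power.monomial) (use 0 in auto)
  then show ?case using P one_mem by (intro bexI[of _ 1]) (auto simp: prime_in_def)
next
  case (Suc n)
  from Suc.prems show ?case
  proof (induction rule: ideal_power_Suc_induct)
    case (prod a b)
    obtain t where t: "t \<in> A - P" "t * a \<in> generated_power A K z n" using Suc.IH[OF prod(1)] by blast
    obtain u where u: "u \<in> A - P" "u * b \<in> generated_power A K z 1"
      using z prod(2) unfolding locally_generated_def by blast
    have "(t * a) * (u * b) \<in> generated_power A K z (n + 1)"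
      by (rule generated_power_mult[OF t(2) u(2)])
    then show ?case using prime_mult_notin[OF P t(1) u(1)]
      by (intro bexI[of _ "t * u"]) (auto simp: mult_ac)
  next
    case (sum a b)
    then obtain t u where t: "t \<in> A - P" "t * a \<in> generated_power A K z (Suc n)"
      and u: "u \<in> A - P" "u * b \<in> generated_power A K z (Suc n)" by blast
    have "u * (t * a) + t * (u * b) \<in> generated_power A K z (Suc n)"
      by (rule generated_power.add; rule generated_power_mult_left) (use t u in auto)
    then show ?case using prime_mult_notin[OF P t(1) u(1)]
      by (intro bexI[of _ "t * u"]) (auto simp: algebra_simps)
  qed
qed

text \<open>
  Pigeonhole: a monomial in \<open>h\<close> elements of degree exceeding \<open>h (Q - 1) + Q (s - 1)\<close> is divisible
  by the \<open>Q\<close>-th power of a monomial of degree \<open>s\<close>, which \<open>\<psi>\<close> lets through.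
\<close>

lemma cartier_generated_power:
  assumes P: "ideal_in A P" and z: "z ` K \<subseteq> P" and Q: "Q > 0"
    and \<psi>: "\<And>f. f \<in> A \<Longrightarrow> \<psi> f \<in> A" "\<And>f g. \<psi> (f + g) = \<psi> f + \<psi> g" "\<And>f g. \<psi> (g ^ Q * f) = g * \<psi> f" "\<psi> 0 = 0"
    and f: "f \<in> generated_power A K z n" and n: "Q * s + card K * (Q - 1) < n + Q"
  shows "\<psi> f \<in> ideal_power A P s"
  using f
proof induction
  case zero
  then show ?case using ideal_ideal_power[OF P] \<psi>(4) by (auto simp: ideal_in_def)
next
  case (monomial a e)
  \<comment> \<open>Division with remainder of each exponent by \<open>Q\<close>: the quotients form
    the \<open>Q\<close>-th power that passes through \<open>\<psi>\<close>, the remainders stay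
    inside.\<close>
  define q where "q i = e i div Q" for i
  define r where "r i = e i mod Q" for i
  have "(\<Prod>i\<in>K. z i ^ e i) = (\<Prod>i\<in>K. z i ^ q i) ^ Q * (\<Prod>i\<in>K. z i ^ r i)"
  proof -
    have "z i ^ e i = (z i ^ q i) ^ Q * z i ^ r i" for i
      unfolding q_def r_def by (metis div_mult_mod_eq power_add power_mult)
    then show ?thesis by (simp add: prod.distrib prod_power_distrib)
  qed
  then have eq: "\<psi> (a * (\<Prod>i\<in>K. z i ^ e i)) = (\<Prod>i\<in>K. z i ^ q i) * \<psi> (a * (\<Prod>i\<in>K. z i ^ r i))"
    using \<psi>(3)[of "\<Prod>i\<in>K. z i ^ q i" "a * (\<Prod>i\<in>K. z i ^ r i)"] by (simp add: mult_ac)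
  have zA: "z i \<in> A" if "i \<in> K" for i using z P that by (auto simp: ideal_in_def)
  have "(\<Sum>i\<in>K. e i) \<le> (\<Sum>i\<in>K. Q * q i + (Q - 1))"
  proof (rule sum_mono)
    fix i
    have "e i = Q * q i + r i" by (simp add: q_def r_def)
    moreover have "r i < Q" using Q by (simp add: r_def)
    ultimately show "e i \<le> Q * q i + (Q - 1)" by linarith
  qed
  also have "\<dots> = Q * (\<Sum>i\<in>K. q i) + card K * (Q - 1)" by (simp add: sum.distrib sum_distrib_left)
  \<comment> \<open>Each remainder costs at most \<open>Q - 1\<close>. The surplus \<open>Q\<close>
    left by the hypothesis on \<open>n\<close> gives only
    \<open>s < Suc (sum of the quotients)\<close>, which for integers is the inequality
    wanted.\<close>
  finally have "Q * s < Q * (\<Sum>i\<in>K. q i) + Q" using monomial n by linarith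
  then have "Q * s < Q * Suc (\<Sum>i\<in>K. q i)" by simp
  then have s: "s \<le> (\<Sum>i\<in>K. q i)" by (metis less_Suc_eq_le mult_less_cancel1)
  have "(\<Prod>i\<in>K. z i ^ q i) \<in> ideal_power A P (\<Sum>i\<in>K. q i)"
  proof (rule ideal_power_prod[OF P])
    fix i assume "i \<in> K"
    then have "z i \<in> ideal_power A P 1" using z by (intro ideal_power_1[OF P]) auto
    then show "z i ^ q i \<in> ideal_power A P (q i)" using ideal_power_power[OF P, of "z i" 1 "q i"] by simp
  qed
  then have "(\<Prod>i\<in>K. z i ^ q i) \<in> ideal_power A P s" using ideal_power_mono[OF P s] by blast
  moreover have "\<psi> (a * (\<Prod>i\<in>K. z i ^ r i)) \<in> A"
    using monomial zA by (intro \<psi>(1) mult_mem prod_mem power_mem) auto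
  ultimately show ?case
    unfolding eq using ideal_mult_right[OF ideal_ideal_power[OF P]] by blast
next
  case (add f g)
  then show ?case using ideal_ideal_power[OF P] \<psi>(2) by (auto simp: ideal_in_def)
qed

end

text \<open>The uniform bound \<open>h\<close> on the number of local generators lets one exponent
  \<open>e\<close> work for all minimal primes simultaneously.\<close>

theorem strongly_F_regular_symbolic_Rees:
  fixes V :: "'v::linorder set" and R I :: "(('v \<Rightarrow>\<^sub>0 nat) \<Rightarrow>\<^sub>0 'k::field) set"
  assumes p: "prime CHAR('k)" and R: "R = polys_in V"
    and \<kappa>: "monomial_order \<kappa>" and F: "lead \<kappa> F \<mu>" and \<mu>: "\<And>i. Poly_Mapping.lookup \<mu> i \<le> 1"
    and FR: "F \<in> R"
    and P: "\<And>P. P \<in> minimal_primes (ring_on R) I \<Longrightarrow>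
      \<exists>(K :: 'i set) z. locally_generated R P K z \<and> card K \<le> h \<and> F \<in> ideal_power R P (card K)"
  shows "strongly_F_regular (symbolic_Rees_algebra R I)"
proof (rule strongly_F_regularI)
  interpret R: idom_subset R unfolding R by (rule idom_subset_polys_in)
  define A where "A = symbolic_Rees_algebra R I"
  show "idom_subset (symbolic_Rees_algebra R I)" by (rule R.idom_subset_symbolic_Rees)
  have CHAR: "CHAR((('v \<Rightarrow>\<^sub>0 nat) \<Rightarrow>\<^sub>0 'k) poly) = CHAR('k)"
    by (simp add: CHAR_poly_mapping)
  show "prime CHAR((('v \<Rightarrow>\<^sub>0 nat) \<Rightarrow>\<^sub>0 'k) poly)" using p by (simp only: CHAR)
  fix c :: "(('v \<Rightarrow>\<^sub>0 nat) \<Rightarrow>\<^sub>0 'k) poly" assume c: "c \<in> symbolic_Rees_algebra R I" "c \<noteq> 0"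
  \<comment> \<open>The splitting is aimed at the leading coefficient of \<open>c\<close>: in degree
    \<open>s > 0\<close> the map \<open>\<Psi>\<close> below reads the coefficient of degree
    \<open>j + Q * s\<close>, which exceeds the degree of \<open>c\<close>.\<close>
  define j where "j = Polynomial.degree c"
  have cj: "Polynomial.coeff c j \<noteq> 0" using c by (simp add: j_def)
  obtain N where N: "\<And>Q e. Q = CHAR('k) ^ e \<Longrightarrow> N < Q \<Longrightarrow>
    \<exists>\<pi> \<alpha>. cartier_operator \<pi> Q e \<alpha> \<and> cartier \<pi> Q \<alpha> (F ^ (Q - 1 - N) * Polynomial.coeff c j) = 1"
    using exists_cartier_operator[OF p \<kappa> F \<mu> cj] by blast
  \<comment> \<open>Since \<open>e < Q\<close>, this makes \<open>Q\<close> exceed \<open>N\<close>,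
    \<open>h * N\<close> and \<open>j\<close>, the three bounds used below.\<close>
  define e where "e = Suc (N + h * N + j)"
  define Q where "Q = CHAR('k) ^ e"
  have "e < Q" unfolding Q_def using p by (intro less_exp[THEN order_less_le_trans] power_mono) (auto dest: prime_ge_2_nat)
  then have Q: "N < Q" "h * N < Q" "j < Q" by (auto simp: e_def)
  obtain \<pi> \<alpha> where "cartier_operator \<pi> Q e \<alpha>"
    and one: "cartier \<pi> Q \<alpha> (F ^ (Q - 1 - N) * Polynomial.coeff c j) = 1"
    using N[OF Q_def Q(1)] by blast
  then interpret C: cartier_operator \<pi> Q e \<alpha> by simp
  define m where "m = Q - 1 - N"
  \<comment> \<open>The Cartier operator applied to the coefficients whose degree is
    \<open>j\<close> modulo \<open>Q\<close>. The cutoff at the degree of \<open>g\<close> loses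
    nothing, as \<open>coeff_\<Psi>\<close> shows.\<close>
  define \<Psi> where "\<Psi> g = (\<Sum>s\<le>Polynomial.degree g.
      Polynomial.monom (C.\<psi> (F ^ m * Polynomial.coeff g (j + Q * s))) s)" for g
  have coeff_\<Psi>: "Polynomial.coeff (\<Psi> g) s = C.\<psi> (F ^ m * Polynomial.coeff g (j + Q * s))" for g s
  proof (cases "s \<le> Polynomial.degree g")
    case True
    then show ?thesis by (simp add: \<Psi>_def coeff_sum)
  next
    case False
    then have "Polynomial.degree g < j + Q * s"
      using C.Q_pos by (metis leI mult_le_mono1 nat_mult_1 Suc_leI One_nat_def order_trans trans_le_add2)
    then show ?thesis using False by (simp add: \<Psi>_def coeff_sum coeff_eq_0 C.\<psi>_0)
  qed
  have \<Psi>_add: "\<Psi> (f + g) = \<Psi> f + \<Psi> g" for f g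
    by (rule poly_eqI) (simp add: coeff_\<Psi> distrib_left C.\<psi>_add)
  have \<Psi>_sum: "\<Psi> (sum f M) = (\<Sum>i\<in>M. \<Psi> (f i))" for f and M :: "nat set"
  proof -
    have "\<Psi> 0 = 0" using \<Psi>_add[of 0 0] by (metis add.right_neutral add_left_cancel)
    then show ?thesis by (induction M rule: infinite_finite_induct) (auto simp: \<Psi>_add)
  qed
  have \<Psi>_monom: "\<Psi> (Polynomial.monom x i ^ Q * f) = Polynomial.monom x i * \<Psi> f" for x i f
  proof (rule poly_eqI)
    fix s
    have m: "Polynomial.monom x i ^ Q = Polynomial.monom (x ^ Q) (i * Q)" by (simp add: monom_power)
    show "Polynomial.coeff (\<Psi> (Polynomial.monom x i ^ Q * f)) s = Polynomial.coeff (Polynomial.monom x i * \<Psi> f) s"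
    proof (cases "i \<le> s")
      case True
      then have "j + Q * s - i * Q = j + Q * (s - i)" "\<not> j + Q * s < i * Q"
        by (auto simp: diff_mult_distrib2 mult.commute not_less intro: trans_le_add2)
      then have "Polynomial.coeff (\<Psi> (Polynomial.monom x i ^ Q * f)) s =
          C.\<psi> (F ^ m * (x ^ Q * Polynomial.coeff f (j + Q * (s - i))))"
        by (simp add: coeff_\<Psi> m coeff_monom_mult)
      also have "F ^ m * (x ^ Q * Polynomial.coeff f (j + Q * (s - i))) =
          x ^ Q * (F ^ m * Polynomial.coeff f (j + Q * (s - i)))"
        by (rule mult.left_commute)
      finally show ?thesis using True by (simp add: C.\<psi>_scale coeff_monom_mult coeff_\<Psi>)
    next
      case False
      \<comment> \<open>For \<open>s < i\<close> the left side has to vanish too; it does because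
        \<open>j < Q\<close> gives \<open>j + Q * s < Q * Suc s\<close>, below the lowest degree of
        the product.\<close>
      then have "Q * Suc s \<le> Q * i" by (intro mult_le_mono2) simp
      then have "j + Q * s < i * Q" using Q(3) by (simp add: mult.commute)
      then show ?thesis using False by (simp add: coeff_\<Psi> m coeff_monom_mult C.\<psi>_0)
    qed
  qed
  have \<Psi>_scale: "\<Psi> (g ^ Q * f) = g * \<Psi> f" for g f
  proof -
    define M where "M i = Polynomial.monom (Polynomial.coeff g i) i" for i
    have g: "g = (\<Sum>i\<le>Polynomial.degree g. M i)" unfolding M_def by (rule poly_as_sum_of_monoms[symmetric])
    have "g ^ Q = (\<Sum>i\<le>Polynomial.degree g. M i) ^ Q" using g by simp
    also have "\<dots> = (\<Sum>i\<le>Polynomial.degree g. M i ^ Q)"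
      by (rule freshmans_dream_sum'[where n = e]) (use p in \<open>simp_all only: CHAR Q_def\<close>)
    finally have "\<Psi> (g ^ Q * f) = (\<Sum>i\<le>Polynomial.degree g. M i) * \<Psi> f"
      by (simp add: sum_distrib_right \<Psi>_sum) (simp add: M_def \<Psi>_monom)
    then show ?thesis using g by simp
  qed
  have "\<Psi> c = 1"
  proof (rule poly_eqI)
    fix s show "Polynomial.coeff (\<Psi> c) s = Polynomial.coeff 1 s"
    proof (cases "s = 0")
      case True
      then show ?thesis using one by (simp add: coeff_\<Psi> m_def)
    next
      case False
      then have "Polynomial.degree c < j + Q * s" using C.Q_pos by (simp add: j_def)
      then show ?thesis using False by (simp add: coeff_\<Psi> coeff_eq_0 C.\<psi>_0)
    qed
  qed
  moreover have "\<Psi> a \<in> A" if a: "a \<in> A" for a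
    unfolding A_def symbolic_Rees_algebra_def
  proof safe
    fix s
    define g where "g = Polynomial.coeff a (j + Q * s)"
    have g: "g \<in> symbolic_power R I (j + Q * s)"
      using a by (auto simp: g_def A_def symbolic_Rees_algebra_def)
    have gR: "g \<in> R" using g by (simp add: R.symbolic_power_iff)
    have "C.\<psi> (F ^ m * g) \<in> symbolic_power R I s"
      unfolding R.symbolic_power_iff
    proof (intro conjI ballI)
      show "C.\<psi> (F ^ m * g) \<in> R"
        using R.mult_mem[OF R.power_mem[OF FR] gR] C.\<psi>_mem unfolding R by blast
      fix q assume q: "q \<in> minimal_primes (ring_on R) I"
      then have pq: "prime_in R q" by (simp add: R.minimal_primes_iff)
      note iq = R.prime_in_imp_ideal[OF pq]
      obtain K :: "'i set" and z where K: "locally_generated R q K z" "card K \<le> h" "F \<in> ideal_power R q (card K)"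
        using P[OF q] by blast
      obtain t where t: "t \<in> R - q" "t * g \<in> ideal_power R q (j + Q * s)"
        using g q by (meson R.symbolic_power_iff)
      have "F ^ m * (t * g) \<in> ideal_power R q (card K * m + (j + Q * s))"
        by (rule R.ideal_power_mult[OF iq R.ideal_power_power[OF iq K(3)] t(2)])
      then obtain u where u: "u \<in> R - q" "u * (F ^ m * (t * g)) \<in> generated_power R K z (card K * m + (j + Q * s))"
        using R.locally_generated_power[OF pq K(1)] by blast
      \<comment> \<open>Multiplying by the further factor \<open>v ^ (Q - 1)\<close> turns the
        combined multiplier \<open>u * t\<close> into a \<open>Q\<close>-th power, which comes out
        of the Cartier operator as \<open>v\<close>.\<close>
      define v where "v = u * t"
      have v: "v \<in> R - q" unfolding v_def by (rule R.prime_mult_notin[OF pq u(1) t(1)])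
      have "v ^ (Q - 1) * (u * (F ^ m * (t * g))) \<in> generated_power R K z (card K * m + (j + Q * s))"
        using R.generated_power_mult_left[OF u(2)] v R.power_mem by blast
      also have "v ^ (Q - 1) * (u * (F ^ m * (t * g))) = v ^ Q * (F ^ m * g)"
        using C.Q_pos by (simp add: v_def power_eq_if[of _ Q] mult_ac)
      finally have vg: "v ^ Q * (F ^ m * g) \<in> generated_power R K z (card K * m + (j + Q * s))" .
      \<comment> \<open>The deficit caused by using \<open>F ^ m\<close> in place of
        \<open>F ^ (Q - 1)\<close> is \<open>card K * N\<close>, which is at most
        \<open>h * N\<close> and so below \<open>Q\<close>.\<close>
      have "card K * (Q - 1) = card K * m + card K * N"
        using Q(1) by (simp add: m_def flip: add_mult_distrib2)
      moreover have "card K * N < Q" using K(2) Q(2) by (meson mult_le_mono1 order_le_less_trans)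
      ultimately have *: "Q * s + card K * (Q - 1) < card K * m + (j + Q * s) + Q" by linarith
      have "C.\<psi> (v ^ Q * (F ^ m * g)) \<in> ideal_power R q s"
      proof (rule R.cartier_generated_power[OF iq _ C.Q_pos _ C.\<psi>_add C.\<psi>_scale C.\<psi>_0 vg *])
        show "z ` K \<subseteq> q" using K(1) by (simp add: locally_generated_def)
        show "C.\<psi> f \<in> R" if "f \<in> R" for f using C.\<psi>_mem that unfolding R by blast
      qed
      then show "\<exists>t\<in>R - q. t * C.\<psi> (F ^ m * g) \<in> ideal_power R q s"
        using v by (auto simp: C.\<psi>_scale)
    qed
    then show "Polynomial.coeff (\<Psi> a) s \<in> symbolic_power R I s" by (simp add: coeff_\<Psi> g_def)
  qed
  ultimately show "\<exists>e\<ge>1. \<exists>\<Psi>. (\<forall>a\<in>symbolic_Rees_algebra R I. \<Psi> a \<in> symbolic_Rees_algebra R I) \<and>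
      (\<forall>a\<in>symbolic_Rees_algebra R I. \<forall>b\<in>symbolic_Rees_algebra R I. \<Psi> (a + b) = \<Psi> a + \<Psi> b) \<and>
      (\<forall>a\<in>symbolic_Rees_algebra R I. \<forall>b\<in>symbolic_Rees_algebra R I.
        \<Psi> (a ^ (CHAR((('v \<Rightarrow>\<^sub>0 nat) \<Rightarrow>\<^sub>0 'k) poly) ^ e) * b) = a * \<Psi> b) \<and> \<Psi> c = 1"
    using \<Psi>_add \<Psi>_scale unfolding CHAR A_def Q_def
    by (intro exI[of _ e] conjI exI[of _ \<Psi>]) (auto simp: e_def)
qed

lemma to_fract_hom:
  "to_fract (0::'a::idom) = 0" "to_fract (1::'a) = 1"
  "to_fract (a + b :: 'a) = to_fract a + to_fract b"
  "to_fract (a * b :: 'a) = to_fract a * to_fract b"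
  "to_fract (a - b :: 'a) = to_fract a - to_fract b"
  "to_fract (a :: 'a) = 0 \<longleftrightarrow> a = 0"
  by (simp_all add: to_fract_def Zero_fract_def One_fract_def eq_fract)

subsection \<open>Evaluation and induction on polynomials\<close>

locale poly_eval =
  fixes c :: "'k::field \<Rightarrow> 'f::comm_ring_1" and h :: "'v \<Rightarrow> 'f"
  assumes c_0: "c 0 = 0" and c_1: "c 1 = 1"
    and c_add: "c (a + b) = c a + c b" and c_mult: "c (a * b) = c a * c b"
begin

definition eval_monomial :: "('v \<Rightarrow>\<^sub>0 nat) \<Rightarrow> 'f" where
  "eval_monomial m = (\<Prod>i\<in>Poly_Mapping.keys m. h i ^ Poly_Mapping.lookup m i)"

definition eval :: "(('v \<Rightarrow>\<^sub>0 nat) \<Rightarrow>\<^sub>0 'k) \<Rightarrow> 'f" where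
  "eval f = (\<Sum>m\<in>Poly_Mapping.keys f. c (Poly_Mapping.lookup f m) * eval_monomial m)"

lemma eval_monomial_superset:
  "finite M \<Longrightarrow> Poly_Mapping.keys m \<subseteq> M \<Longrightarrow>
    eval_monomial m = (\<Prod>i\<in>M. h i ^ Poly_Mapping.lookup m i)"
  unfolding eval_monomial_def by (rule prod.mono_neutral_left) (auto simp: in_keys_iff)

lemma eval_monomial_add: "eval_monomial (m + n) = eval_monomial m * eval_monomial n"
proof -
  let ?M = "Poly_Mapping.keys m \<union> Poly_Mapping.keys n"
  have "Poly_Mapping.keys (m + n) \<subseteq> ?M" by (rule keys_add)
  then show ?thesis
    by (subst (1 2 3) eval_monomial_superset[of ?M]) (auto simp: lookup_add power_add prod.distrib)
qed

lemma eval_superset: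
  "finite M \<Longrightarrow> Poly_Mapping.keys f \<subseteq> M \<Longrightarrow>
    eval f = (\<Sum>m\<in>M. c (Poly_Mapping.lookup f m) * eval_monomial m)"
  unfolding eval_def by (rule sum.mono_neutral_left) (auto simp: in_keys_iff c_0)

lemma eval_add: "eval (f + g) = eval f + eval g"
proof -
  let ?M = "Poly_Mapping.keys f \<union> Poly_Mapping.keys g"
  have "Poly_Mapping.keys (f + g) \<subseteq> ?M" by (rule keys_add)
  then show ?thesis
    by (subst (1 2 3) eval_superset[of ?M]) (auto simp: lookup_add c_add distrib_right sum.distrib)
qed

lemma eval_0: "eval 0 = 0"
  by (simp add: eval_def)

lemma eval_sum: "eval (sum f M) = (\<Sum>i\<in>M. eval (f i))"
  by (induction M rule: infinite_finite_induct) (auto simp: eval_0 eval_add)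

lemma eval_single: "eval (Poly_Mapping.single m a) = c a * eval_monomial m"
  by (cases "a = 0") (auto simp: eval_def c_0)

lemma eval_mult: "eval (f * g) = eval f * eval g"
proof -
  let ?s = "\<lambda>f m. Poly_Mapping.single m (Poly_Mapping.lookup f m)"
  have "f * g = (\<Sum>m\<in>Poly_Mapping.keys f. \<Sum>n\<in>Poly_Mapping.keys g. ?s f m * ?s g n)"
    by (subst (1) poly_mapping_eq_sum_single[of f], subst (1) poly_mapping_eq_sum_single[of g])
       (simp add: sum_product)
  also have "eval \<dots> = (\<Sum>m\<in>Poly_Mapping.keys f. \<Sum>n\<in>Poly_Mapping.keys g. eval (?s f m) * eval (?s g n))"
    by (simp add: eval_sum eval_single mult_single c_mult eval_monomial_add mult_ac)
  also have "\<dots> = eval f * eval g"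
    by (simp only: sum_product eval_single) (simp add: eval_def[of f] eval_def[of g] sum_product)
  finally show ?thesis .
qed

lemma eval_const: "eval (Poly_Mapping.single 0 a) = c a"
  by (simp add: eval_single eval_monomial_def)

lemma eval_1: "eval 1 = 1"
  using eval_const[of 1] by (simp add: c_1)

lemma eval_var: "eval (Poly_Mapping.single (Poly_Mapping.single i 1) 1) = h i"
  by (simp add: eval_single eval_monomial_def c_1)

lemma eval_diff: "eval (f - g) = eval f - eval g"
  using eval_add[of "f - g" g] by (simp add: algebra_simps)

end

lemma prod_single:
  "(\<Prod>i\<in>M. Poly_Mapping.single (m i) (1::'k::comm_semiring_1)) = Poly_Mapping.single (sum m M) 1"
  by (induction M rule: infinite_finite_induct) (auto simp: mult_single)

lemma single_eq_prod_vars: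
  "Poly_Mapping.single m (a::'k::comm_semiring_1) = Poly_Mapping.single 0 a *
     (\<Prod>i\<in>Poly_Mapping.keys m. Poly_Mapping.single (Poly_Mapping.single i 1) 1 ^ Poly_Mapping.lookup m i)"
proof -
  have *: "Poly_Mapping.map ((*) n) (Poly_Mapping.single i 1) = Poly_Mapping.single i n" for n :: nat and i :: 'b
    by (rule poly_mapping_eqI) (simp add: map.rep_eq lookup_single when_def)
  show ?thesis
    by (simp only: single_power * power_one prod_single mult_single
        poly_mapping_eq_sum_single[symmetric] add_0 mult_1_right)
qed

lemma polys_in_induct [consumes 1, case_names const var add mult]:
  fixes f :: "('v::linorder \<Rightarrow>\<^sub>0 nat) \<Rightarrow>\<^sub>0 'k::field"
  assumes "f \<in> polys_in V"
    and const: "\<And>a. P (Poly_Mapping.single 0 a)"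
    and var: "\<And>i. i \<in> V \<Longrightarrow> P (Poly_Mapping.single (Poly_Mapping.single i 1) 1)"
    and add: "\<And>f g. f \<in> polys_in V \<Longrightarrow> g \<in> polys_in V \<Longrightarrow> P f \<Longrightarrow> P g \<Longrightarrow> P (f + g)"
    and mult: "\<And>f g. f \<in> polys_in V \<Longrightarrow> g \<in> polys_in V \<Longrightarrow> P f \<Longrightarrow> P g \<Longrightarrow> P (f * g)"
  shows "P f"
proof -
  interpret idom_subset "polys_in V :: (('v \<Rightarrow>\<^sub>0 nat) \<Rightarrow>\<^sub>0 'k) set" by (rule idom_subset_polys_in)
  let ?P = "\<lambda>f. f \<in> polys_in V \<and> P f"
  have one: "?P 1" using const[of 1] one_mem by simp
  have prod: "?P (prod g M)" if "\<And>i. i \<in> M \<Longrightarrow> ?P (g i)" for g and M :: "'v set"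
    using that by (induction M rule: infinite_finite_induct) (auto simp: one intro: mult mult_mem)
  have pow: "?P (g ^ n)" if "?P g" for g n
    using that by (induction n) (auto simp: one intro: mult mult_mem)
  have c: "?P (Poly_Mapping.single 0 a)" for a using const by (auto intro: polys_in_single)
  have single: "?P (Poly_Mapping.single m a)" if m: "Poly_Mapping.keys m \<subseteq> V" for m a
  proof -
    have *: "?P (\<Prod>i\<in>Poly_Mapping.keys m. Poly_Mapping.single (Poly_Mapping.single i 1) 1 ^ Poly_Mapping.lookup m i)"
      by (intro prod pow conjI var polys_in_single) (use m in auto)
    have "?P (Poly_Mapping.single 0 a *
      (\<Prod>i\<in>Poly_Mapping.keys m. Poly_Mapping.single (Poly_Mapping.single i 1) 1 ^ Poly_Mapping.lookup m i))"
      by (rule conjI; rule mult_mem mult) (use c[of a] * in \<open>auto simp del: One_nat_def\<close>)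
    then show ?thesis by (simp only: single_eq_prod_vars[symmetric])
  qed
  have sum: "?P (sum g M)" if "\<And>i. i \<in> M \<Longrightarrow> ?P (g i)" for g and M :: "('v \<Rightarrow>\<^sub>0 nat) set"
    using that c[of 0] by (induction M rule: infinite_finite_induct) (auto intro: add add_mem)
  have "?P (\<Sum>m\<in>Poly_Mapping.keys f. Poly_Mapping.single m (Poly_Mapping.lookup f m))"
    by (rule sum, rule single) (use assms(1) in \<open>auto simp: polys_in_def\<close>)
  then show ?thesis by (simp only: poly_mapping_eq_sum_single[symmetric])
qed

subsection \<open>Rank one specializations\<close>

definition minor :: "nat \<Rightarrow> nat \<Rightarrow> 'k::field xy_poly" where
  "minor i j = x_var i * y_var j - x_var j * y_var i"

definition side :: "bool \<Rightarrow> nat \<Rightarrow> 'k::field xy_poly" where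
  "side b j = (if b then x_var j else y_var j)"

lemma xy_polys_eq: "xy_polys d = polys_in (Xvar ` {1..d} \<union> Yvar ` {1..d})"
  by (simp add: xy_polys_def polys_in_def)

lemma idom_subset_xy_polys: "idom_subset (xy_polys d :: 'k::field xy_poly set)"
  unfolding xy_polys_eq by (rule idom_subset_polys_in)

lemma var_mem:
  "j \<in> {1..d} \<Longrightarrow> x_var j \<in> xy_polys d" "j \<in> {1..d} \<Longrightarrow> y_var j \<in> xy_polys d"
  "j \<in> {1..d} \<Longrightarrow> side b j \<in> xy_polys d"
  unfolding xy_polys_eq x_var_def y_var_def side_def by (auto intro!: polys_in_single)

lemma minor_mem: "i \<in> {1..d} \<Longrightarrow> j \<in> {1..d} \<Longrightarrow> minor i j \<in> xy_polys d"
  unfolding minor_def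
  by (intro idom_subset.diff_mem[OF idom_subset_xy_polys] idom_subset.mult_mem[OF idom_subset_xy_polys] var_mem)

lemma var_neq_0: "x_var j \<noteq> 0" "y_var j \<noteq> 0" "side b j \<noteq> 0"
  unfolding x_var_def y_var_def side_def by (metis lookup_single_eq lookup_zero zero_neq_one)+

lemma minor_neq_0:
  assumes "i \<noteq> j" shows "minor i j \<noteq> (0 :: 'k::field xy_poly)"
proof
  assume "minor i j = (0 :: 'k xy_poly)"
  then have "Poly_Mapping.single (Poly_Mapping.single (Xvar i) 1 + Poly_Mapping.single (Yvar j) 1) (1::'k) =
     Poly_Mapping.single (Poly_Mapping.single (Xvar j) (1::nat) + Poly_Mapping.single (Yvar i) 1) 1"
    by (simp add: minor_def x_var_def y_var_def mult_single)
  then have "Poly_Mapping.single (Xvar i) 1 + Poly_Mapping.single (Yvar j) 1 =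
     Poly_Mapping.single (Xvar j) (1::nat) + Poly_Mapping.single (Yvar i) 1"
    by (metis keys_single singleton_inject zero_neq_one)
  then have "Poly_Mapping.lookup (Poly_Mapping.single (Xvar i) 1 + Poly_Mapping.single (Yvar j) 1) (Xvar i) =
     Poly_Mapping.lookup (Poly_Mapping.single (Xvar j) (1::nat) + Poly_Mapping.single (Yvar i) 1) (Xvar i)"
    by simp
  then show False using assms by (simp add: lookup_add lookup_single when_def)
qed

text \<open>
  The indices in \<open>S\<close> are killed; every other column \<open>j\<close> becomes proportional to the column of its
  representative \<open>r j\<close>, the proportionality factor being read off in the row selected by \<open>b\<close>.
\<close>

locale rank_one_datum =
  fixes d :: nat and S :: "nat set" and r :: "nat \<Rightarrow> nat" and b :: "nat \<Rightarrow> bool"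
  assumes S: "S \<subseteq> {1..d}"
    and r_mem: "j \<in> {1..d} - S \<Longrightarrow> r j \<in> {1..d} - S"
    and r_idem: "j \<in> {1..d} - S \<Longrightarrow> r (r j) = r j"
begin

definition T :: "nat set" where "T = {j \<in> {1..d} - S. r j \<noteq> j}"

text \<open>Index set of the generators. A minor of \<open>j\<close> with its representative is
  indexed by \<open>Xvar j\<close>, which is free since \<open>j\<close> lies outside
  \<open>S\<close>; thus indeterminates index both kinds of generators.\<close>

definition K :: "indet set" where "K = Xvar ` (S \<union> T) \<union> Yvar ` S"

definition z :: "indet \<Rightarrow> 'k::field xy_poly" where
  "z u = (case u of Xvar j \<Rightarrow> if j \<in> S then x_var j else minor (r j) j | Yvar j \<Rightarrow> y_var j)"

definition pivot :: "nat \<Rightarrow> 'k::field xy_poly" where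
  "pivot j = side (b (r j)) (r j)"

definition s :: "'k::field xy_poly" where "s = (\<Prod>j\<in>T. pivot j)"

definition ratio :: "nat \<Rightarrow> 'k::field xy_poly fract" where
  "ratio j = to_fract (side (b (r j)) j) / to_fract (pivot j)"

text \<open>Parametrization of the matrices in question: column \<open>j\<close> becomes
  \<open>ratio j\<close> times the column of \<open>r j\<close>. Representatives and the entries in
  the selected rows are left fixed. The values lie in a field, so the kernel is prime, and the only
  denominators are pivots, whose product over \<open>T\<close> is \<open>s\<close>.\<close>

definition image_var :: "indet \<Rightarrow> 'k::field xy_poly fract" where
  "image_var u = (case u of
     Xvar j \<Rightarrow> if j \<in> S then 0 else ratio j * to_fract (x_var (r j))
   | Yvar j \<Rightarrow> if j \<in> S then 0 else ratio j * to_fract (y_var (r j)))"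

lemma finite_S: "finite S" using S finite_subset by blast

lemma finite_T: "finite T" by (simp add: T_def)

lemma finite_K: "finite K" by (simp add: K_def finite_S finite_T)

lemma card_K: "card K = 2 * card S + card T"
proof -
  have "card K = card (Xvar ` (S \<union> T)) + card (Yvar ` S)"
    unfolding K_def by (rule card_Un_disjoint) (auto simp: finite_S finite_T)
  also have "\<dots> = card (S \<union> T) + card S"
    by (simp add: card_image inj_on_def)
  also have "card (S \<union> T) = card S + card T"
    by (rule card_Un_disjoint) (auto simp: finite_S finite_T T_def)
  finally show ?thesis by simp
qed

lemma r_neq: "j \<in> T \<Longrightarrow> r j \<in> {1..d} - S" using r_mem by (auto simp: T_def)

lemma z_image_subset:
  fixes I :: "'k::field xy_poly set"
  shows "z ` K \<subseteq> I \<longleftrightarrow> (\<forall>j\<in>S. x_var j \<in> I \<and> y_var j \<in> I) \<and> (\<forall>j\<in>T. minor (r j) j \<in> I)"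
proof -
  have "(z (Xvar j) :: 'k xy_poly) = (if j \<in> S then x_var j else minor (r j) j)"
    "(z (Yvar j) :: 'k xy_poly) = y_var j" for j
    by (simp_all add: z_def)
  moreover have "j \<notin> S" if "j \<in> T" for j using that by (simp add: T_def)
  ultimately show ?thesis unfolding K_def image_Un Un_subset_iff image_subset_iff ball_simps by auto
qed

lemma z_mem: "z ` K \<subseteq> xy_polys d"
proof -
  have "j \<in> {1..d}" if "j \<in> S \<or> j \<in> T" for j using that S by (auto simp: T_def)
  then show ?thesis using r_neq unfolding z_image_subset by (auto intro!: var_mem minor_mem)
qed

lemma s_mem: "s \<in> xy_polys d"
  unfolding s_def pivot_def
  using r_neq by (intro idom_subset.prod_mem[OF idom_subset_xy_polys] var_mem) auto

lemma pivot_neq_0: "pivot j \<noteq> 0" by (simp add: pivot_def var_neq_0)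

lemma ratio_neq_0: "ratio j \<noteq> 0"
  by (simp add: ratio_def pivot_neq_0 var_neq_0 to_fract_hom)

lemma ratio_rep: "j \<in> {1..d} - S \<Longrightarrow> r j = j \<Longrightarrow> ratio j = 1"
  by (simp add: ratio_def pivot_def to_fract_hom var_neq_0)

definition \<theta> :: "'k::field xy_poly \<Rightarrow> 'k xy_poly fract" where
  "\<theta> = poly_eval.eval (\<lambda>a. to_fract (Poly_Mapping.single 0 a)) image_var"

lemma poly_eval: "poly_eval (\<lambda>a :: 'k::field. to_fract (Poly_Mapping.single 0 a :: 'k xy_poly))"
  by unfold_locales (auto simp: to_fract_hom single_add mult_single simp flip: to_fract_hom(4))

lemmas \<theta>_hom =
  poly_eval.eval_add[OF poly_eval, of image_var, folded \<theta>_def]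
  poly_eval.eval_mult[OF poly_eval, of image_var, folded \<theta>_def]
  poly_eval.eval_diff[OF poly_eval, of image_var, folded \<theta>_def]
  poly_eval.eval_0[OF poly_eval, of image_var, folded \<theta>_def]
  poly_eval.eval_1[OF poly_eval, of image_var, folded \<theta>_def]

lemmas \<theta>_const = poly_eval.eval_const[OF poly_eval, of image_var, folded \<theta>_def]
lemmas \<theta>_indet = poly_eval.eval_var[OF poly_eval, of image_var, folded \<theta>_def]

lemma \<theta>_var: "\<theta> (x_var j) = image_var (Xvar j)" "\<theta> (y_var j) = image_var (Yvar j)"
  by (simp_all add: x_var_def y_var_def \<theta>_indet[unfolded One_nat_def])

definition ker :: "'k::field xy_poly set" where "ker = {f \<in> xy_polys d. \<theta> f = 0}"

lemma prime_ker: "prime_in (xy_polys d) (ker :: 'k::field xy_poly set)"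
  unfolding prime_in_def ideal_in_def ker_def
  by (auto simp: \<theta>_hom intro!: idom_subset.zero_mem[OF idom_subset_xy_polys]
      idom_subset.add_mem[OF idom_subset_xy_polys] idom_subset.mult_mem[OF idom_subset_xy_polys])

text \<open>The substitution \<open>\<theta>\<close> can be carried out inside the polynomial ring
  modulo the generators, at the cost of a power of \<open>s\<close>. For an indeterminate this is
  one relation between its column and that of the representative; sums and products follow by
  combining congruences.\<close>

lemma clear_denominators:
  fixes f :: "'k::field xy_poly"
  assumes f: "f \<in> xy_polys d" and I: "ideal_in (xy_polys d) I" "z ` K \<subseteq> I"
  shows "\<exists>N. \<exists>g\<in>xy_polys d. to_fract g = to_fract (s ^ N) * \<theta> f \<and> s ^ N * f - g \<in> I"
proof -
  interpret R: idom_subset "xy_polys d :: 'k xy_poly set" by (rule idom_subset_xy_polys)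
  have zero: "0 \<in> I" using I by (simp add: ideal_in_def)
  note sN = R.power_mem[OF s_mem]
  from f show ?thesis unfolding xy_polys_eq
  proof (induction rule: polys_in_induct)
    case (const a)
    then show ?case using zero
      by (intro exI[of _ 0] bexI[of _ "Poly_Mapping.single 0 a"])
         (auto simp: \<theta>_const to_fract_hom intro: polys_in_single)
  next
    case (var u)
    then obtain j where j: "j \<in> {1..d}" "u = Xvar j \<or> u = Yvar j" by auto
    define w where "w = (Poly_Mapping.single (Poly_Mapping.single u 1) 1 :: 'k xy_poly)"
    have w: "w = x_var j \<and> u = Xvar j \<or> w = y_var j \<and> u = Yvar j"
      using j by (auto simp: w_def x_var_def y_var_def)
    have \<theta>w: "\<theta> w = image_var u" unfolding w_def by (rule \<theta>_indet)
    have wR: "w \<in> xy_polys d" using w var_mem[OF j(1)] by auto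
    have "\<exists>N. \<exists>g\<in>xy_polys d. to_fract g = to_fract (s ^ N) * image_var u \<and> s ^ N * w - g \<in> I"
    proof -
      \<comment> \<open>A variable of \<open>S\<close> lies in \<open>I\<close> and is replaced by
        0, and a representative is fixed, both with exponent 0. Only columns in \<open>T\<close>
        need a factor \<open>s\<close>.\<close>
      consider "j \<in> S" | "j \<notin> S" "r j = j" | "j \<in> T" using j by (auto simp: T_def)
      then show ?thesis
      proof cases
        case 1
        then have "w = z u" "u \<in> K" using w by (auto simp: z_def K_def)
        then have "w \<in> I" using I by auto
        then show ?thesis using 1 w R.zero_mem
          by (intro exI[of _ 0] bexI[of _ 0]) (auto simp: to_fract_hom image_var_def)
      next
        case 2
        then show ?thesis using w wR j zero
          by (intro exI[of _ 0] bexI[of _ w]) (auto simp: to_fract_hom image_var_def ratio_rep)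
      next
        case 3
        then have jS: "j \<notin> S" "r j \<in> {1..d}" using r_neq by (auto simp: T_def)
        define s' where "s' = (\<Prod>i\<in>T - {j}. pivot i :: 'k xy_poly)"
        have s: "s = pivot j * s'" unfolding s_def s'_def by (rule prod.remove[OF finite_T 3])
        have s'R: "s' \<in> xy_polys d"
          unfolding s'_def pivot_def using r_neq by (intro R.prod_mem var_mem) auto
        define w' where "w' = (if u = Xvar j then x_var (r j) else y_var (r j) :: 'k xy_poly)"
        have w'R: "w' \<in> xy_polys d" using jS by (auto simp: w'_def intro: var_mem)
        have im: "image_var u = ratio j * to_fract w'"
          using w jS by (auto simp: image_var_def w'_def)
        have "to_fract (s' * side (b (r j)) j * w') = to_fract (s ^ 1) * image_var u"
          by (simp add: im s ratio_def to_fract_hom pivot_neq_0)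
        moreover have "s ^ 1 * w - s' * side (b (r j)) j * w' \<in> I"
        proof -
          have m: "minor (r j) j \<in> I"
            using I(2) 3 unfolding z_image_subset by blast
          \<comment> \<open>The difference is 0 if \<open>w\<close> is in the selected row, and
            otherwise the minor up to a sign that depends on the row.\<close>
          have "pivot j * w - side (b (r j)) j * w' \<in> {0, minor (r j) j, - minor (r j) j}"
            using w by (auto simp: pivot_def side_def w'_def minor_def algebra_simps)
          then have "pivot j * w - side (b (r j)) j * w' \<in> I"
            using m zero R.ideal_uminus[OF I(1) m] by auto
          from R.ideal_mult_left[OF I(1) this s'R] show ?thesis
            by (simp add: s algebra_simps)
        qed
        moreover have "s' * side (b (r j)) j * w' \<in> xy_polys d"
          using j s'R w'R by (intro R.mult_mem var_mem) auto
        ultimately show ?thesis by blast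
      qed
    qed
    then show ?case unfolding w_def[symmetric] \<theta>w xy_polys_eq .
  next
    case (add f1 f2)
    then obtain N1 g1 N2 g2 where *: "g1 \<in> xy_polys d" "g2 \<in> xy_polys d"
      "to_fract g1 = to_fract (s ^ N1) * \<theta> f1" "to_fract g2 = to_fract (s ^ N2) * \<theta> f2"
      "s ^ N1 * f1 - g1 \<in> I" "s ^ N2 * f2 - g2 \<in> I" unfolding xy_polys_eq by blast
    have "s ^ N2 * (s ^ N1 * f1 - g1) + s ^ N1 * (s ^ N2 * f2 - g2) \<in> I"
      by (intro R.ideal_add[OF I(1)] R.ideal_mult_left[OF I(1)] * sN)
    also have "s ^ N2 * (s ^ N1 * f1 - g1) + s ^ N1 * (s ^ N2 * f2 - g2) =
        s ^ (N1 + N2) * (f1 + f2) - (s ^ N2 * g1 + s ^ N1 * g2)"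
      by (simp add: power_add algebra_simps)
    finally have "s ^ (N1 + N2) * (f1 + f2) - (s ^ N2 * g1 + s ^ N1 * g2) \<in> I" .
    moreover have "to_fract (s ^ N2 * g1 + s ^ N1 * g2) = to_fract (s ^ (N1 + N2)) * \<theta> (f1 + f2)"
      by (simp add: to_fract_hom power_add \<theta>_hom *(3,4) algebra_simps)
    moreover have "s ^ N2 * g1 + s ^ N1 * g2 \<in> xy_polys d"
      by (intro R.add_mem R.mult_mem sN *)
    ultimately show ?case unfolding xy_polys_eq[symmetric] by blast
  next
    case (mult f1 f2)
    then obtain N1 g1 N2 g2 where *: "g1 \<in> xy_polys d" "g2 \<in> xy_polys d"
      "to_fract g1 = to_fract (s ^ N1) * \<theta> f1" "to_fract g2 = to_fract (s ^ N2) * \<theta> f2"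
      "s ^ N1 * f1 - g1 \<in> I" "s ^ N2 * f2 - g2 \<in> I" unfolding xy_polys_eq by blast
    have f1: "f1 \<in> xy_polys d" using mult by (simp add: xy_polys_eq)
    have "s ^ N1 * f1 * (s ^ N2 * f2 - g2) + g2 * (s ^ N1 * f1 - g1) \<in> I"
      by (intro R.ideal_add[OF I(1)] R.ideal_mult_left[OF I(1)] R.mult_mem * sN f1)
    also have "s ^ N1 * f1 * (s ^ N2 * f2 - g2) + g2 * (s ^ N1 * f1 - g1) =
        s ^ (N1 + N2) * (f1 * f2) - g1 * g2"
      by (simp add: power_add algebra_simps)
    finally have "s ^ (N1 + N2) * (f1 * f2) - g1 * g2 \<in> I" .
    moreover have "to_fract (g1 * g2) = to_fract (s ^ (N1 + N2)) * \<theta> (f1 * f2)"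
      by (simp add: to_fract_hom power_add \<theta>_hom *(3,4) mult_ac)
    moreover have "g1 * g2 \<in> xy_polys d"
      by (intro R.mult_mem *)
    ultimately show ?case unfolding xy_polys_eq[symmetric] by blast
  qed
qed

text \<open>For \<open>f\<close> in the kernel the polynomial \<open>g\<close> of
  \<open>clear_denominators\<close> represents 0, so it is 0. The ideal \<open>I\<close> is left
  open: it will be a prime, the ideal of the generators, or a colon ideal.\<close>

lemma ker_saturation:
  fixes f :: "'k::field xy_poly"
  assumes "f \<in> ker" and "ideal_in (xy_polys d) I" "z ` K \<subseteq> I"
  shows "\<exists>N. s ^ N * f \<in> I"
proof -
  obtain N g where "to_fract g = to_fract (s ^ N) * \<theta> f" "s ^ N * f - g \<in> I"
    using clear_denominators[of f I] assms by (auto simp: ker_def)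
  moreover have "\<theta> f = 0" using assms(1) by (simp add: ker_def)
  ultimately show ?thesis by (metis diff_zero mult_zero_right to_fract_hom(6))
qed

lemma x_var_notin_ker: "j \<in> {1..d} - S \<Longrightarrow> (x_var j :: 'k::field xy_poly) \<notin> ker"
  by (simp add: ker_def \<theta>_var image_var_def ratio_neq_0 to_fract_hom var_neq_0)

text \<open>On columns outside \<open>S\<close> the minor is mapped to
  \<open>ratio i * ratio j\<close> times the minor of the representatives, and the ratios do not
  vanish.\<close>

lemma minor_in_ker:
  assumes ij: "i \<in> {1..d}" "j \<in> {1..d}"
  shows "(minor i j :: 'k::field xy_poly) \<in> ker \<longleftrightarrow> i \<in> S \<or> j \<in> S \<or> r i = r j"
proof -
  have "\<theta> (minor i j :: 'k xy_poly) = ratio i * ratio j * to_fract (minor (r i) (r j))" if "i \<notin> S" "j \<notin> S"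
    using that by (simp add: minor_def \<theta>_hom \<theta>_var image_var_def to_fract_hom algebra_simps)
  moreover have "\<theta> (minor i j :: 'k xy_poly) = 0" if "i \<in> S \<or> j \<in> S"
    using that by (auto simp: minor_def \<theta>_hom \<theta>_var image_var_def)
  moreover have "minor (r i) (r j) = (0 :: 'k xy_poly) \<longleftrightarrow> r i = r j"
    using minor_neq_0[of "r i" "r j"] by (auto simp: minor_def)
  moreover have "(minor i j :: 'k xy_poly) \<in> xy_polys d" using ij by (rule minor_mem)
  ultimately show ?thesis
    by (cases "i \<in> S \<or> j \<in> S") (auto simp: ker_def ratio_neq_0 to_fract_hom)
qed

lemma generators_in_ker: "z ` K \<subseteq> (ker :: 'k::field xy_poly set)"
proof -
  have "\<theta> (x_var j :: 'k xy_poly) = 0" "\<theta> (y_var j :: 'k xy_poly) = 0" if "j \<in> S" for j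
    using that by (auto simp: \<theta>_var image_var_def)
  moreover have "(minor (r j) j :: 'k xy_poly) \<in> ker" if "j \<in> T" for j
    using that r_neq[OF that] r_idem[of j] by (subst minor_in_ker) (auto simp: T_def)
  moreover have "j \<in> {1..d}" if "j \<in> S" for j using that S by auto
  ultimately show ?thesis unfolding z_image_subset by (auto simp: ker_def intro!: var_mem)
qed

lemma s_notin_prime:
  assumes "prime_in (xy_polys d) P" "\<And>j. j \<in> T \<Longrightarrow> pivot j \<notin> P"
  shows "s \<notin> (P :: 'k::field xy_poly set)"
proof -
  have "s \<in> xy_polys d - P"
    unfolding s_def
    by (rule idom_subset.prime_prod_notin[OF idom_subset_xy_polys assms(1)])
       (use assms(2) r_neq in \<open>auto simp: pivot_def intro!: var_mem\<close>)
  then show ?thesis by simp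
qed

lemma ker_subset_prime:
  fixes P :: "'k::field xy_poly set"
  assumes P: "prime_in (xy_polys d) P" and z: "z ` K \<subseteq> P" and pivot: "\<And>j. j \<in> T \<Longrightarrow> pivot j \<notin> P"
  shows "ker \<subseteq> P"
proof
  fix f assume f: "f \<in> (ker :: 'k xy_poly set)"
  have iP: "ideal_in (xy_polys d) P" using P by (simp add: prime_in_def)
  obtain N where "s ^ N * f \<in> P" using ker_saturation[OF f iP z] by blast
  moreover have "s ^ N \<in> xy_polys d - P"
    by (rule idom_subset.prime_power_notin[OF idom_subset_xy_polys P])
       (use s_notin_prime[OF P pivot] s_mem in auto)
  ultimately show "f \<in> P" using P f by (auto simp: prime_in_def ker_def)
qed

text \<open>Saturation with respect to the ideal of the generators: a power of \<open>s\<close> is a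
  legitimate multiplier because \<open>\<theta>\<close> fixes the pivots, so that \<open>s\<close>
  is outside the kernel.\<close>

lemma locally_generated_ker:
  "locally_generated (xy_polys d) (ker :: 'k::field xy_poly set) K z"
proof -
  interpret R: idom_subset "xy_polys d :: 'k xy_poly set" by (rule idom_subset_xy_polys)
  let ?W = "generated_power (xy_polys d) K (z :: indet \<Rightarrow> 'k xy_poly) 1"
  have "s \<notin> (ker :: 'k xy_poly set)"
  proof (rule s_notin_prime[OF prime_ker])
    fix j assume "j \<in> T"
    then have "r j \<in> {1..d} - S" by (rule r_neq)
    then show "(pivot j :: 'k xy_poly) \<notin> ker"
      by (auto simp: pivot_def side_def ker_def \<theta>_var image_var_def ratio_neq_0 to_fract_hom var_neq_0)
  qed
  then have sN: "s ^ N \<in> xy_polys d - (ker :: 'k xy_poly set)" for N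
    using R.prime_power_notin[OF prime_ker] s_mem by blast
  have "\<exists>t\<in>xy_polys d - ker. t * f \<in> ?W" if "f \<in> ker" for f
    using ker_saturation[OF that R.ideal_generated_power[OF z_mem]] R.generated_power_generator[OF finite_K] sN
    by blast
  then show ?thesis
    unfolding locally_generated_def using finite_K generators_in_ker by blast
qed

end

subsection \<open>The path polynomial\<close>

lemma poly_mapping_nat_pos:
  fixes m :: "'v::linorder \<Rightarrow>\<^sub>0 nat"
  assumes "m \<noteq> 0" shows "0 < m"
proof -
  have ne: "Poly_Mapping.keys m \<noteq> {}" using assms by simp
  \<comment> \<open>Exponent vectors are compared at the least index where they differ, so
    \<open>k\<close> decides the comparison with 0.\<close>
  define k where "k = Min (Poly_Mapping.keys m)"
  have "k \<in> Poly_Mapping.keys m" unfolding k_def using ne by (intro Min_in) auto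
  moreover have "k' \<notin> Poly_Mapping.keys m" if "k' < k" for k'
    using that Min_le[OF finite_keys, of k' m] unfolding k_def by (meson not_le)
  ultimately have "less_fun (Poly_Mapping.lookup 0) (Poly_Mapping.lookup m)"
    unfolding less_fun_def by (intro exI[of _ k]) (auto simp: in_keys_iff)
  then show ?thesis by (simp add: less_poly_mapping.rep_eq)
qed

text \<open>
  The given order on monomials is lexicographic with respect to the indices of the vertices; in
  \<open>order_key\<close> it is precomposed with \<open>\<sigma>\<close>, so that \<open>\<sigma> 1, \<sigma> 2, \<dots>\<close> become the significant indices in turn.
\<close>

definition relabel :: "(nat \<Rightarrow> nat) \<Rightarrow> indet \<Rightarrow> indet" where
  "relabel \<sigma> u = (case u of Xvar i \<Rightarrow> Xvar (\<sigma> i) | Yvar i \<Rightarrow> Yvar (\<sigma> i))"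

definition order_key :: "(nat \<Rightarrow> nat) \<Rightarrow> (indet \<Rightarrow>\<^sub>0 nat) \<Rightarrow> (indet \<Rightarrow>\<^sub>0 nat)" where
  "order_key \<sigma> = Poly_Mapping.map_key (relabel \<sigma>)"

text \<open>Bookkeeping for a path: the edge from \<open>i\<close> to \<open>Suc i\<close>
  contributes \<open>f\<close> at its left end and \<open>g\<close> at its right end, and the two
  extra terms supply what is missing at the ends of the path. It is used both for leading monomials
  and for orders along a prime.\<close>

lemma sum_shift_telescope:
  fixes f g :: "nat \<Rightarrow> 'a::comm_monoid_add"
  assumes "d \<ge> 1"
  shows "g 1 + (\<Sum>i\<in>{1..<d}. f i + g (Suc i)) + f d = (\<Sum>i\<in>{1..d}. f i + g i)"
  using assms
proof (induction d rule: dec_induct)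
  case (step n)
  then have "(\<Sum>i\<in>{1..Suc n}. f i + g i) =
      (g 1 + (\<Sum>i\<in>{1..<n}. f i + g (Suc i)) + f n) + (f (Suc n) + g (Suc n))" by simp
  moreover have "{1..<Suc n} = insert n {1..<n}" using step by auto
  ultimately show ?case by (simp add: add_ac)
qed (simp add: add.commute)

text \<open>\<open>\<sigma>\<close> permutes all natural numbers, which makes \<open>relabel\<close>
  a bijection on all indeterminates and \<open>order_key\<close> injective on all monomials.\<close>

locale vertex_order =
  fixes \<sigma> :: "nat \<Rightarrow> nat" and d :: nat
  assumes bij: "bij \<sigma>" and image: "\<sigma> ` {1..d} = {1..d}" and d: "d \<ge> 1"
begin

lemma \<sigma>_mem: "i \<in> {1..d} \<Longrightarrow> \<sigma> i \<in> {1..d}"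
  using image by blast

lemma \<sigma>_eq_iff: "\<sigma> i = \<sigma> j \<longleftrightarrow> i = j"
  using bij by (auto simp: bij_def inj_def)

lemma inj_relabel: "inj (relabel \<sigma>)"
  by (rule injI) (auto simp: relabel_def \<sigma>_eq_iff split: indet.splits)

lemma relabel_surj: "\<exists>v. u = relabel \<sigma> v"
proof -
  obtain j where j: "\<sigma> j = (case u of Xvar i \<Rightarrow> i | Yvar i \<Rightarrow> i)"
    using bij by (metis bij_pointE)
  show ?thesis
    by (cases u) (use j in \<open>auto simp: relabel_def intro: exI[of _ "Xvar j"] exI[of _ "Yvar j"]\<close>)
qed

lemma lookup_order_key: "Poly_Mapping.lookup (order_key \<sigma> m) u = Poly_Mapping.lookup m (relabel \<sigma> u)"
  by (simp add: order_key_def map_key.rep_eq[OF inj_relabel])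

lemma monomial_order: "monomial_order (order_key \<sigma>)"
proof
  show add: "order_key \<sigma> (m + n) = order_key \<sigma> m + order_key \<sigma> n" for m n
    by (simp add: order_key_def map_key_plus[OF inj_relabel])
  show inj: "inj (order_key \<sigma>)"
  proof (rule injI, rule poly_mapping_eqI)
    fix m n u assume eq: "order_key \<sigma> m = order_key \<sigma> n"
    obtain v where "u = relabel \<sigma> v" using relabel_surj by blast
    then show "Poly_Mapping.lookup m u = Poly_Mapping.lookup n u"
      using eq by (metis lookup_order_key)
  qed
  fix m n :: "indet \<Rightarrow>\<^sub>0 nat" assume "n \<noteq> 0"
  moreover have "order_key \<sigma> 0 = 0" by (rule poly_mapping_eqI) (simp add: lookup_order_key)
  ultimately have "order_key \<sigma> n \<noteq> 0" using injD[OF inj, of n 0] by auto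
  then show "order_key \<sigma> m < order_key \<sigma> (m + n)"
    using add_strict_left_mono[OF poly_mapping_nat_pos, of "order_key \<sigma> n" "order_key \<sigma> m"] by (simp add: add)
qed

abbreviation "mX i \<equiv> Poly_Mapping.single (Xvar i) (1::nat)"
abbreviation "mY i \<equiv> Poly_Mapping.single (Yvar i) (1::nat)"

lemma order_key_single:
  "order_key \<sigma> (mX (\<sigma> i)) = mX i" "order_key \<sigma> (mY (\<sigma> i)) = mY i"
  by (rule poly_mapping_eqI,
      auto simp: lookup_order_key lookup_single when_def relabel_def \<sigma>_eq_iff split: indet.splits)+

text \<open>After relabelling, \<open>Xvar i\<close> is the smallest indeterminate that occurs, and
  the monomial containing it is the larger one; so the diagonal term leads.\<close>

lemma lead_minor:
  assumes "i < j"
  shows "lead (order_key \<sigma>) (minor (\<sigma> i) (\<sigma> j) :: 'k::field xy_poly) (mX (\<sigma> i) + mY (\<sigma> j))"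
proof -
  interpret monomial_order "order_key \<sigma>" by (rule monomial_order)
  let ?m = "mX (\<sigma> i) + mY (\<sigma> j)" and ?n = "mX (\<sigma> j) + mY (\<sigma> i)"
  have eq: "(minor (\<sigma> i) (\<sigma> j) :: 'k xy_poly) = Poly_Mapping.single ?m 1 - Poly_Mapping.single ?n 1"
    by (simp add: minor_def x_var_def y_var_def mult_single)
  have "less_fun (Poly_Mapping.lookup (mX j + mY i)) (Poly_Mapping.lookup (mX i + mY j))"
    unfolding less_fun_def
    by (rule exI[of _ "Xvar i"])
       (use assms in \<open>auto simp: lookup_add lookup_single when_def less_indet_def\<close>)
  then have "mX j + mY i < mX i + mY j" by (simp add: less_poly_mapping.rep_eq)
  then have less: "order_key \<sigma> ?n < order_key \<sigma> ?m" unfolding key_add order_key_single .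
  then have ne: "?m \<noteq> ?n" by (metis less_irrefl)
  have "Poly_Mapping.keys (minor (\<sigma> i) (\<sigma> j) :: 'k xy_poly) \<subseteq> {?m, ?n}"
    unfolding eq by (auto simp: in_keys_iff lookup_minus lookup_single when_def split: if_splits)
  moreover have "?m \<in> Poly_Mapping.keys (minor (\<sigma> i) (\<sigma> j) :: 'k xy_poly)"
    unfolding eq in_keys_iff lookup_minus lookup_single using ne by simp
  ultimately show ?thesis using less unfolding lead_def by fastforce
qed

definition path_poly :: "'k::field xy_poly" where
  "path_poly = y_var (\<sigma> 1) * (\<Prod>i\<in>{1..<d}. minor (\<sigma> i) (\<sigma> (Suc i))) * x_var (\<sigma> d)"

lemma lead_path_poly:
  "lead (order_key \<sigma>) (path_poly :: 'k::field xy_poly) (\<Sum>i\<in>{1..d}. mX (\<sigma> i) + mY (\<sigma> i))"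
proof -
  interpret monomial_order "order_key \<sigma>" by (rule monomial_order)
  have "lead (order_key \<sigma>) (path_poly :: 'k xy_poly)
    (mY (\<sigma> 1) + (\<Sum>i\<in>{1..<d}. mX (\<sigma> i) + mY (\<sigma> (Suc i))) + mX (\<sigma> d))"
    unfolding path_poly_def
    by (intro lead_mult lead_prod lead_minor) (auto simp: lead_def x_var_def y_var_def)
  then show ?thesis by (simp only: sum_shift_telescope[OF d, of "\<lambda>i. mY (\<sigma> i)" "\<lambda>i. mX (\<sigma> i)"])
qed

lemma path_monomial_le_1: "Poly_Mapping.lookup (\<Sum>i\<in>{1..d}. mX (\<sigma> i) + mY (\<sigma> i)) u \<le> 1"
proof -
  define v where "v = (case u of Xvar v \<Rightarrow> v | Yvar v \<Rightarrow> v)"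
  have "Poly_Mapping.lookup (\<Sum>i\<in>{1..d}. mX (\<sigma> i) + mY (\<sigma> i)) u = (\<Sum>i\<in>{1..d}. if \<sigma> i = v then 1 else 0)"
    by (cases u) (simp_all add: v_def lookup_sum lookup_add lookup_single when_def del: One_nat_def)
  also have "\<dots> = card {i \<in> {1..d}. \<sigma> i = v}"
    by (simp only: card_eq_sum sum.inter_filter[OF finite_atLeastAtMost])
  also have "\<dots> \<le> 1"
  proof -
    have "finite {i \<in> {1..d}. \<sigma> i = v}" by simp
    from card_le_Suc0_iff_eq[OF this] show ?thesis by simp (metis \<sigma>_eq_iff)
  qed
  finally show ?thesis .
qed

lemma path_poly_mem: "(path_poly :: 'k::field xy_poly) \<in> xy_polys d"
proof -
  interpret R: idom_subset "xy_polys d :: 'k xy_poly set" by (rule idom_subset_xy_polys)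
  show ?thesis
    unfolding path_poly_def using d by (intro R.mult_mem R.prod_mem var_mem minor_mem \<sigma>_mem) auto
qed

text \<open>Every vertex occurs in two factors, one on its left and one on its right. A vertex of
  \<open>S\<close> contributes order 1 to both; a vertex of \<open>T\<close> contributes order 1 to
  the left one, which is a minor because the first vertex is not in \<open>T\<close>.\<close>

lemma path_poly_in_power:
  fixes P :: "'k::field xy_poly set"
  assumes P: "ideal_in (xy_polys d) P" and ST: "S \<subseteq> {1..d}" "T \<subseteq> {1..d} - S"
    and S: "\<And>j. j \<in> S \<Longrightarrow> x_var j \<in> P \<and> y_var j \<in> P"
    and T: "\<And>i. i \<in> {1..<d} \<Longrightarrow> \<sigma> (Suc i) \<in> T \<Longrightarrow> \<sigma> i \<notin> S \<and> minor (\<sigma> i) (\<sigma> (Suc i)) \<in> P"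
    and T1: "\<sigma> 1 \<notin> T"
  shows "path_poly \<in> ideal_power (xy_polys d) P (2 * card S + card T)"
proof -
  interpret R: idom_subset "xy_polys d :: 'k xy_poly set" by (rule idom_subset_xy_polys)
  define f where "f i = (if \<sigma> i \<in> S then 1 else 0 :: nat)" for i
  define g where "g i = f i + (if \<sigma> i \<in> T then 1 else 0 :: nat)" for i
  have pow: "w \<in> ideal_power (xy_polys d) P (if c then 1 else 0)" if "w \<in> xy_polys d" "c \<Longrightarrow> w \<in> P" for w c
    using that R.ideal_power_1[OF P] by auto
  have "minor (\<sigma> i) (\<sigma> (Suc i)) \<in> ideal_power (xy_polys d) P (f i + g (Suc i))" if i: "i \<in> {1..<d}" for i
  proof (cases "\<sigma> (Suc i) \<in> T")
    \<comment> \<open>The left neighbour of a vertex of \<open>T\<close> is not in \<open>S\<close>,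
      so order 1 suffices here and the minor itself provides it.\<close>
    case True
    then have "\<sigma> i \<notin> S" "minor (\<sigma> i) (\<sigma> (Suc i)) \<in> P" "\<sigma> (Suc i) \<notin> S" using T[OF i] ST by auto
    then show ?thesis using True R.ideal_power_1[OF P] by (simp add: f_def g_def)
  next
    case False
    have m: "\<sigma> i \<in> {1..d}" "\<sigma> (Suc i) \<in> {1..d}" using i \<sigma>_mem[of i] \<sigma>_mem[of "Suc i"] by auto
    have "x_var j \<in> ideal_power (xy_polys d) P (if j \<in> S then 1 else 0)"
      "y_var j \<in> ideal_power (xy_polys d) P (if j \<in> S then 1 else 0)" if "j \<in> {1..d}" for j
      using pow[of "x_var j" "j \<in> S"] pow[of "y_var j" "j \<in> S"] S[of j] var_mem[OF that] by auto
    note this[OF m(1), folded f_def] this[OF m(2), folded f_def]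
    then have "x_var (\<sigma> i) * y_var (\<sigma> (Suc i)) \<in> ideal_power (xy_polys d) P (f i + f (Suc i))"
      "y_var (\<sigma> i) * x_var (\<sigma> (Suc i)) \<in> ideal_power (xy_polys d) P (f i + f (Suc i))"
      by (auto intro!: R.ideal_power_mult[OF P])
    then have "minor (\<sigma> i) (\<sigma> (Suc i)) \<in> ideal_power (xy_polys d) P (f i + f (Suc i))"
      unfolding minor_def using R.ideal_diff[OF R.ideal_ideal_power[OF P]] by (simp add: mult.commute)
    then show ?thesis using False by (simp add: g_def)
  qed
  then have "(\<Prod>i\<in>{1..<d}. minor (\<sigma> i) (\<sigma> (Suc i))) \<in>
      ideal_power (xy_polys d) P (\<Sum>i\<in>{1..<d}. f i + g (Suc i))"
    by (rule R.ideal_power_prod[OF P])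
  moreover have "y_var (\<sigma> 1) \<in> ideal_power (xy_polys d) P (g 1)"
  proof -
    have "g 1 = (if \<sigma> 1 \<in> S then 1 else 0)" using T1 by (simp add: g_def f_def)
    then show ?thesis using S d by (simp only:) (intro pow var_mem \<sigma>_mem, auto)
  qed
  moreover have "x_var (\<sigma> d) \<in> ideal_power (xy_polys d) P (f d)"
    unfolding f_def using S d by (intro pow var_mem \<sigma>_mem) auto
  ultimately have "path_poly \<in> ideal_power (xy_polys d) P (g 1 + (\<Sum>i\<in>{1..<d}. f i + g (Suc i)) + f d)"
    unfolding path_poly_def by (intro R.ideal_power_mult[OF P])
  also have "g 1 + (\<Sum>i\<in>{1..<d}. f i + g (Suc i)) + f d = (\<Sum>i\<in>{1..d}. f i + g i)"
    by (rule sum_shift_telescope[OF d])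
  also have "(\<Sum>i\<in>{1..d}. f i + g i) = (\<Sum>j\<in>\<sigma> ` {1..d}. 2 * (if j \<in> S then 1 else 0) + (if j \<in> T then 1 else 0))"
    by (subst sum.reindex) (auto simp: inj_on_def \<sigma>_eq_iff f_def g_def intro!: sum.cong)
  also have "\<dots> = 2 * card S + card T"
  proof -
    have "{1..d} \<inter> S = S" "{1..d} \<inter> T = T" using ST by auto
    then show ?thesis
      by (simp only: image sum.distrib flip: sum_distrib_left) (simp add: sum.If_cases)
  qed
  finally show ?thesis .
qed

text \<open>The condition on \<open>\<sigma>\<close> says that a vertex outside \<open>S\<close>
  that is no representative directly follows a member of its own class. So every class is listed
  without gaps, starting from its representative.\<close>

theorem strongly_F_regular_if_path_contiguous:
  fixes I :: "'k::field xy_poly set"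
  assumes p: "prime CHAR('k)"
    and P: "\<And>P. P \<in> minimal_primes (ring_on (xy_polys d)) I \<Longrightarrow>
      \<exists>S r b. rank_one_datum d S r \<and> P = rank_one_datum.ker d S r b \<and>
        (\<forall>i\<in>{1..<d}. r (\<sigma> (Suc i)) \<noteq> \<sigma> (Suc i) \<and> \<sigma> (Suc i) \<notin> S \<longrightarrow> \<sigma> i \<notin> S \<and> r (\<sigma> i) = r (\<sigma> (Suc i))) \<and>
        (\<sigma> 1 \<notin> S \<longrightarrow> r (\<sigma> 1) = \<sigma> 1)"
  shows "strongly_F_regular (symbolic_Rees_algebra (xy_polys d) I)"
proof (rule strongly_F_regular_symbolic_Rees[OF p xy_polys_eq monomial_order lead_path_poly path_monomial_le_1 path_poly_mem])
  fix P assume "P \<in> minimal_primes (ring_on (xy_polys d)) I"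
  then obtain S r b where D: "rank_one_datum d S r" and ker: "P = rank_one_datum.ker d S r b"
    and c: "\<And>i. i \<in> {1..<d} \<Longrightarrow> r (\<sigma> (Suc i)) \<noteq> \<sigma> (Suc i) \<Longrightarrow> \<sigma> (Suc i) \<notin> S \<Longrightarrow> \<sigma> i \<notin> S \<and> r (\<sigma> i) = r (\<sigma> (Suc i))"
    and c1: "\<sigma> 1 \<notin> S \<Longrightarrow> r (\<sigma> 1) = \<sigma> 1"
    using P by metis
  interpret D: rank_one_datum d S r b by (rule D)
  interpret R: idom_subset "xy_polys d :: 'k xy_poly set" by (rule idom_subset_xy_polys)
  have "path_poly \<in> ideal_power (xy_polys d) P (2 * card S + card D.T)"
  proof (rule path_poly_in_power)
    show "ideal_in (xy_polys d) P" unfolding ker using D.prime_ker by (rule R.prime_in_imp_ideal)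
    show "S \<subseteq> {1..d}" by (rule D.S)
    show "D.T \<subseteq> {1..d} - S" by (auto simp: D.T_def)
    show "x_var j \<in> P \<and> y_var j \<in> P" if "j \<in> S" for j
      using D.generators_in_ker that unfolding ker D.z_image_subset by blast
    show "\<sigma> 1 \<notin> D.T" using c1 by (auto simp: D.T_def)
    fix i assume i: "i \<in> {1..<d}" and T: "\<sigma> (Suc i) \<in> D.T"
    have "\<sigma> i \<notin> S \<and> r (\<sigma> i) = r (\<sigma> (Suc i))" by (rule c[OF i]) (use T in \<open>auto simp: D.T_def\<close>)
    moreover have "\<sigma> i \<in> {1..d}" "\<sigma> (Suc i) \<in> {1..d}" using i \<sigma>_mem[of i] \<sigma>_mem[of "Suc i"] by auto
    ultimately show "\<sigma> i \<notin> S \<and> minor (\<sigma> i) (\<sigma> (Suc i)) \<in> P" unfolding ker by (simp add: D.minor_in_ker)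
  qed
  moreover have "card D.K \<le> 3 * d"
  proof -
    have "card S \<le> d" using card_mono[OF _ D.S] by simp
    moreover have "D.T \<subseteq> {1..d}" by (auto simp: D.T_def)
    then have "card D.T \<le> d" using card_mono[of "{1..d}" D.T] by simp
    ultimately show ?thesis by (simp add: D.card_K)
  qed
  ultimately show "\<exists>(K :: indet set) z. locally_generated (xy_polys d) P K z \<and> card K \<le> 3 * d \<and>
      path_poly \<in> ideal_power (xy_polys d) P (card K)"
    unfolding ker using D.locally_generated_ker
    by (intro exI[of _ D.K] exI[of _ D.z]) (simp add: D.card_K)
qed

end

subsection \<open>Minimal primes of binomial edge ideals\<close>

text \<open>
  Vertices whose two variables lie in \<open>P\<close>; they form the set \<open>S\<close> above, and the other vertices are
  called live.
\<close>

definition dead :: "nat \<Rightarrow> 'k::field xy_poly set \<Rightarrow> nat set" where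
  "dead d P = {j \<in> {1..d}. x_var j \<in> P \<and> y_var j \<in> P}"

definition live_edges :: "nat \<Rightarrow> nat set set \<Rightarrow> 'k::field xy_poly set \<Rightarrow> (nat \<times> nat) set" where
  "live_edges d E P = {(i, j). {i, j} \<in> E \<and> i \<notin> dead d P \<and> j \<notin> dead d P}"

text \<open>Components are taken in the graph induced on the live vertices. The earliest vertex in
  the order \<open>\<sigma>\<close> becomes the representative, as the path criterion
  demands.\<close>

definition class_position :: "nat \<Rightarrow> nat set set \<Rightarrow> 'k::field xy_poly set \<Rightarrow> (nat \<Rightarrow> nat) \<Rightarrow> nat \<Rightarrow> nat" where
  "class_position d E P \<sigma> j = (LEAST l. l \<in> {1..d} \<and> \<sigma> l \<notin> dead d P \<and> (\<sigma> l, j) \<in> (live_edges d E P)\<^sup>*)"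

definition class_first :: "nat \<Rightarrow> nat set set \<Rightarrow> 'k::field xy_poly set \<Rightarrow> (nat \<Rightarrow> nat) \<Rightarrow> nat \<Rightarrow> nat" where
  "class_first d E P \<sigma> j = \<sigma> (class_position d E P \<sigma> j)"

text \<open>Each of the two variables of column \<open>j\<close> times the minor of
  \<open>i, k\<close> is a combination of the other two minors, and one of these variables is
  outside \<open>P\<close>.\<close>

lemma minor_trans:
  fixes P :: "'k::field xy_poly set"
  assumes P: "prime_in (xy_polys d) P" and mem: "i \<in> {1..d}" "j \<in> {1..d} - dead d P" "k \<in> {1..d}"
    and ij: "minor i j \<in> P" and jk: "minor j k \<in> P"
  shows "minor i k \<in> P"
proof -
  interpret R: idom_subset "xy_polys d :: 'k xy_poly set" by (rule idom_subset_xy_polys)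
  have iP: "ideal_in (xy_polys d) P" using P by (rule R.prime_in_imp_ideal)
  have "(y_var j * minor i k :: 'k xy_poly) = y_var k * minor i j + y_var i * minor j k"
    "(x_var j * minor i k :: 'k xy_poly) = x_var k * minor i j + x_var i * minor j k"
    by (simp_all add: minor_def algebra_simps)
  moreover have "y_var k * minor i j + y_var i * minor j k \<in> P" "x_var k * minor i j + x_var i * minor j k \<in> P"
    by (intro R.ideal_add[OF iP] R.ideal_mult_left[OF iP] var_mem ij jk mem)+
  ultimately have "y_var j * minor i k \<in> P" "x_var j * minor i k \<in> P" by (simp_all only:)
  moreover have "minor i k \<in> xy_polys d" "x_var j \<in> xy_polys d" "y_var j \<in> xy_polys d"
    using mem by (auto intro!: minor_mem var_mem)
  ultimately have "x_var j \<in> P \<and> y_var j \<in> P \<or> minor i k \<in> P"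
    using P unfolding prime_in_def by blast
  then show ?thesis using mem by (auto simp: dead_def)
qed

lemma live_edges_sym: "(i, j) \<in> (live_edges d E P)\<^sup>* \<Longrightarrow> (j, i) \<in> (live_edges d E P)\<^sup>*"
proof -
  have "sym (live_edges d E P)" by (auto simp: sym_def live_edges_def insert_commute)
  then have "sym ((live_edges d E P)\<^sup>*)" by (rule sym_rtrancl)
  then show "(i, j) \<in> (live_edges d E P)\<^sup>* \<Longrightarrow> (j, i) \<in> (live_edges d E P)\<^sup>*" by (auto simp: sym_def)
qed

locale edge_ideal =
  fixes d :: nat and E :: "nat set set"
  assumes simple: "simple_graph {1..d} E"
begin

lemma edge_mem: "{i, j} \<in> E \<Longrightarrow> i \<in> {1..d} \<and> j \<in> {1..d} \<and> i \<noteq> j"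
proof -
  assume "{i, j} \<in> E"
  then obtain u v where "u \<in> {1..d}" "v \<in> {1..d}" "u \<noteq> v" "{i, j} = {u, v}"
    using simple unfolding simple_graph_def by blast
  then show ?thesis by (auto simp: doubleton_eq_iff)
qed

lemma edge_ideal_subset_iff:
  fixes I :: "'k::field xy_poly set"
  assumes "ideal_in (xy_polys d) I"
  shows "binomial_edge_ideal d E \<subseteq> I \<longleftrightarrow> (\<forall>i j. {i, j} \<in> E \<longrightarrow> minor i j \<in> I)"
proof -
  interpret R: idom_subset "xy_polys d :: 'k xy_poly set" by (rule idom_subset_xy_polys)
  have eq: "{x_var i * y_var j - x_var j * y_var i | i j. {i, j} \<in> E} = {minor i j | i j. {i, j} \<in> E}"
    by (simp add: minor_def)
  have "{minor i j | i j. {i, j} \<in> E} \<subseteq> (xy_polys d :: 'k xy_poly set)"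
    using edge_mem minor_mem by blast
  from R.ideal_genideal[OF this] show ?thesis
    unfolding binomial_edge_ideal_def eq using assms by blast
qed

lemma ideal_edge_ideal: "ideal_in (xy_polys d) (binomial_edge_ideal d E :: 'k::field xy_poly set)"
proof -
  interpret R: idom_subset "xy_polys d :: 'k xy_poly set" by (rule idom_subset_xy_polys)
  have eq: "{x_var i * y_var j - x_var j * y_var i | i j. {i, j} \<in> E} = {minor i j | i j. {i, j} \<in> E}"
    by (simp add: minor_def)
  have "{minor i j | i j. {i, j} \<in> E} \<subseteq> (xy_polys d :: 'k xy_poly set)"
    using edge_mem minor_mem by blast
  from R.ideal_genideal(1)[OF this] show ?thesis
    unfolding binomial_edge_ideal_def eq .
qed

lemma minor_in_edge_ideal: "{i, j} \<in> E \<Longrightarrow> (minor i j :: 'k::field xy_poly) \<in> binomial_edge_ideal d E"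
  using edge_ideal_subset_iff[OF ideal_edge_ideal] by blast

lemma prime_live_edges_minor:
  fixes P :: "'k::field xy_poly set"
  assumes P: "prime_in (xy_polys d) P" "binomial_edge_ideal d E \<subseteq> P"
    and "(i, j) \<in> (live_edges d E P)\<^sup>*" "i \<in> {1..d} - dead d P"
  shows "j \<in> {1..d} - dead d P \<and> minor i j \<in> P"
  using assms(3,4)
proof (induction rule: rtrancl_induct)
  case base
  have "0 \<in> P" using P(1) by (simp add: prime_in_def ideal_in_def)
  then show ?case using assms by (simp add: minor_def)
next
  case (step j k)
  then have jk: "{j, k} \<in> E" "j \<notin> dead d P" "k \<notin> dead d P" by (auto simp: live_edges_def)
  then have "minor j k \<in> P" using minor_in_edge_ideal P(2) by blast
  moreover have "k \<in> {1..d}" using edge_mem[OF jk(1)] by simp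
  ultimately show ?case
    using minor_trans[OF P(1), of i j k] step jk by auto
qed

abbreviation min_primes :: "'k::field xy_poly set set" where
  "min_primes \<equiv> minimal_primes (ring_on (xy_polys d)) (binomial_edge_ideal d E)"

lemma min_primesD:
  assumes "P \<in> min_primes"
  shows "prime_in (xy_polys d) P" "binomial_edge_ideal d E \<subseteq> P"
    "prime_in (xy_polys d) Q \<Longrightarrow> binomial_edge_ideal d E \<subseteq> Q \<Longrightarrow> Q \<subseteq> P \<Longrightarrow> Q = P"
  using assms idom_subset.minimal_primes_iff[OF idom_subset_xy_polys] by blast+

text \<open>The hypotheses place the kernel between the edge ideal and \<open>P\<close>, and it is
  prime, so minimality gives equality. The choice of \<open>b\<close> keeps the pivots outside
  \<open>P\<close>. \<open>S\<close> may be smaller than the dead set, which allows a dead vertex to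
  be revived.\<close>

lemma min_prime_eq_ker:
  fixes P :: "'k::field xy_poly set"
  assumes P: "P \<in> min_primes" and D: "rank_one_datum d S r"
    and S: "S \<subseteq> dead d P"
    and T: "\<And>j. j \<in> {1..d} - S \<Longrightarrow> r j \<noteq> j \<Longrightarrow> minor (r j) j \<in> P \<and> r j \<notin> dead d P"
    and b: "\<And>j. b j \<longleftrightarrow> x_var j \<notin> P"
    and edge: "\<And>i j. {i, j} \<in> E \<Longrightarrow> i \<notin> S \<Longrightarrow> j \<notin> S \<Longrightarrow> r i = r j"
  shows "P = rank_one_datum.ker d S r b"
proof -
  interpret D: rank_one_datum d S r b by (rule D)
  interpret R: idom_subset "xy_polys d :: 'k xy_poly set" by (rule idom_subset_xy_polys)
  have "D.ker \<subseteq> P"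
  proof (rule D.ker_subset_prime[OF min_primesD(1)[OF P]])
    show "D.z ` D.K \<subseteq> P"
      unfolding D.z_image_subset using S T by (auto simp: D.T_def dead_def)
    fix j assume "j \<in> D.T"
    then have "r j \<notin> dead d P" "r j \<in> {1..d}" using T D.r_neq by (auto simp: D.T_def)
    then show "D.pivot j \<notin> P" by (auto simp: D.pivot_def side_def b dead_def)
  qed
  moreover have "binomial_edge_ideal d E \<subseteq> (D.ker :: 'k xy_poly set)"
    unfolding edge_ideal_subset_iff[OF R.prime_in_imp_ideal[OF D.prime_ker]]
    using edge edge_mem D.minor_in_ker by blast
  ultimately show ?thesis using min_primesD(3)[OF P D.prime_ker] by blast
qed

context
  fixes P :: "'k::field xy_poly set" and \<sigma> :: "nat \<Rightarrow> nat"
  assumes P: "P \<in> min_primes" and \<sigma>: "vertex_order \<sigma> d"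
begin

interpretation vertex_order \<sigma> d by (rule \<sigma>)

abbreviation "position \<equiv> class_position d E P \<sigma>"
abbreviation "first_in_class \<equiv> class_first d E P \<sigma>"

lemma position:
  assumes "l \<in> {1..d}" "\<sigma> l \<notin> dead d P"
  shows "position (\<sigma> l) \<in> {1..d}" "first_in_class (\<sigma> l) \<notin> dead d P" "position (\<sigma> l) \<le> l"
    "(first_in_class (\<sigma> l), \<sigma> l) \<in> (live_edges d E P)\<^sup>*"
proof -
  have *: "l \<in> {1..d} \<and> \<sigma> l \<notin> dead d P \<and> (\<sigma> l, \<sigma> l) \<in> (live_edges d E P)\<^sup>*" using assms by simp
  from LeastI[of "\<lambda>l'. l' \<in> {1..d} \<and> \<sigma> l' \<notin> dead d P \<and> (\<sigma> l', \<sigma> l) \<in> (live_edges d E P)\<^sup>*", OF *]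
    Least_le[of "\<lambda>l'. l' \<in> {1..d} \<and> \<sigma> l' \<notin> dead d P \<and> (\<sigma> l', \<sigma> l) \<in> (live_edges d E P)\<^sup>*", OF *]
  show "position (\<sigma> l) \<in> {1..d}" "first_in_class (\<sigma> l) \<notin> dead d P" "position (\<sigma> l) \<le> l"
    "(first_in_class (\<sigma> l), \<sigma> l) \<in> (live_edges d E P)\<^sup>*"
    unfolding class_first_def class_position_def by auto
qed

lemma first_in_class:
  assumes "j \<in> {1..d} - dead d P"
  shows "first_in_class j \<in> {1..d} - dead d P" "(first_in_class j, j) \<in> (live_edges d E P)\<^sup>*"
proof -
  obtain l where "l \<in> {1..d}" "j = \<sigma> l" using assms image by blast
  then show "first_in_class j \<in> {1..d} - dead d P" "(first_in_class j, j) \<in> (live_edges d E P)\<^sup>*"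
    using position[of l] assms \<sigma>_mem[of "position (\<sigma> l)"] by (auto simp: class_first_def)
qed

lemma first_in_class_cong:
  "(i, j) \<in> (live_edges d E P)\<^sup>* \<Longrightarrow> first_in_class i = first_in_class j"
proof -
  assume ij: "(i, j) \<in> (live_edges d E P)\<^sup>*"
  have "(u, i) \<in> (live_edges d E P)\<^sup>* \<longleftrightarrow> (u, j) \<in> (live_edges d E P)\<^sup>*" for u
    using ij live_edges_sym[OF ij] by (meson rtrancl_trans)
  then show ?thesis by (simp add: class_first_def class_position_def)
qed

lemma first_in_class_eq_iff:
  assumes "i \<in> {1..d} - dead d P" "j \<in> {1..d} - dead d P"
  shows "first_in_class i = first_in_class j \<longleftrightarrow> (i, j) \<in> (live_edges d E P)\<^sup>*"
  using first_in_class(2)[OF assms(1)] first_in_class(2)[OF assms(2)] first_in_class_cong[of i j]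
    live_edges_sym by (metis rtrancl_trans)

lemma datum: "rank_one_datum d (dead d P) first_in_class"
proof
  show "dead d P \<subseteq> {1..d}" by (auto simp: dead_def)
  show "first_in_class j \<in> {1..d} - dead d P" if "j \<in> {1..d} - dead d P" for j
    by (rule first_in_class(1)[OF that])
  show "first_in_class (first_in_class j) = first_in_class j" if "j \<in> {1..d} - dead d P" for j
    by (rule first_in_class_cong[OF first_in_class(2)[OF that]])
qed

lemma min_prime_eq_ker_first:
  "P = rank_one_datum.ker d (dead d P) first_in_class (\<lambda>j. x_var j \<notin> P)"
proof (rule min_prime_eq_ker[OF P datum])
  fix j assume "j \<in> {1..d} - dead d P"
  then show "minor (first_in_class j) j \<in> P \<and> first_in_class j \<notin> dead d P"
    using first_in_class[of j] prime_live_edges_minor[OF min_primesD(1,2)[OF P]] by blast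
next
  fix i j assume "{i, j} \<in> E" "i \<notin> dead d P" "j \<notin> dead d P"
  then have "(i, j) \<in> (live_edges d E P)\<^sup>*" by (auto simp: live_edges_def)
  then show "first_in_class i = first_in_class j" by (rule first_in_class_cong)
qed auto

text \<open>Since \<open>P\<close> is itself a rank one kernel, membership of minors is decided by
  comparing representatives.\<close>

lemma minor_mem_iff_connected:
  assumes "i \<in> {1..d} - dead d P" "j \<in> {1..d} - dead d P"
  shows "minor i j \<in> P \<longleftrightarrow> (i, j) \<in> (live_edges d E P)\<^sup>*"
proof -
  have "minor i j \<in> P \<longleftrightarrow> first_in_class i = first_in_class j"
    by (subst min_prime_eq_ker_first, subst rank_one_datum.minor_in_ker[OF datum]) (use assms in auto)
  then show ?thesis using first_in_class_eq_iff[OF assms] by simp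
qed

text \<open>
  If all live neighbours of a dead vertex lay in one class, that vertex could be revived within the
  class, and \<open>P\<close> would not be minimal.
\<close>

lemma dead_separates:
  assumes i: "i \<in> dead d P"
  obtains a c where "a \<in> {1..d} - dead d P" "c \<in> {1..d} - dead d P" "{i, a} \<in> E" "{i, c} \<in> E" "minor a c \<notin> P"
proof (rule ccontr)
  note obt = that
  assume "\<not> thesis"
  then have nbr: "minor a c \<in> P" if "{i, a} \<in> E" "{i, c} \<in> E" "a \<notin> dead d P" "c \<notin> dead d P" for a c
    using edge_mem[OF that(1)] edge_mem[OF that(2)] \<open>\<not> thesis\<close> obt[of a c] that by blast
  interpret D: rank_one_datum d "dead d P" first_in_class by (rule datum)
  define S' where "S' = dead d P - {i}"
  \<comment> \<open>Representative assigned to the revived vertex \<open>i\<close>: that of the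
    class containing all its live neighbours, or \<open>i\<close> itself if it has none.\<close>
  define t where "t = (if \<exists>a. {i, a} \<in> E \<and> a \<notin> dead d P
    then first_in_class (SOME a. {i, a} \<in> E \<and> a \<notin> dead d P) else i)"
  define r' where "r' j = (if j = i then t else first_in_class j)" for j
  have t: "t = first_in_class a \<and> t \<in> {1..d} - dead d P" if a: "{i, a} \<in> E" "a \<notin> dead d P" for a
  proof -
    let ?a = "SOME a. {i, a} \<in> E \<and> a \<notin> dead d P"
    have a': "{i, ?a} \<in> E \<and> ?a \<notin> dead d P" using a by (rule_tac someI[of _ a]) simp
    then have m: "?a \<in> {1..d} - dead d P" "a \<in> {1..d} - dead d P" using edge_mem a by blast+
    have "minor ?a a \<in> P" using nbr a a' by blast
    then have "first_in_class ?a = first_in_class a"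
      using minor_mem_iff_connected[OF m] first_in_class_cong by blast
    then show ?thesis using a D.r_mem[OF m(2)] by (auto simp: t_def)
  qed
  have t': "t = i \<or> t \<in> {1..d} - dead d P \<and> first_in_class t = t"
  proof (cases "\<exists>a. {i, a} \<in> E \<and> a \<notin> dead d P")
    case True
    then obtain a where a: "{i, a} \<in> E" "a \<notin> dead d P" by blast
    then show ?thesis using t[OF a] D.r_idem[of a] edge_mem[OF a(1)] by auto
  next
    case False
    then show ?thesis by (simp only: t_def if_False simp_thms)
  qed
  have iP: "x_var i \<in> P" "y_var i \<in> P" "i \<in> {1..d}" using i by (auto simp: dead_def)
  have live: "j \<in> {1..d} - dead d P" if "j \<in> {1..d} - S'" "j \<noteq> i" for j
    using that by (auto simp: S'_def)
  have ne: "first_in_class j \<noteq> i" if "j \<in> {1..d} - dead d P" for j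
    using D.r_mem[OF that] i by auto
  have D': "rank_one_datum d S' r'"
  proof
    show "S' \<subseteq> {1..d}" by (auto simp: S'_def dead_def)
    fix j assume j: "j \<in> {1..d} - S'"
    show "r' j \<in> {1..d} - S'" using t' iP D.r_mem[OF live[OF j]] by (auto simp: r'_def S'_def)
    show "r' (r' j) = r' j"
      using t' D.r_idem[OF live[OF j]] ne[OF live[OF j]] by (auto simp: r'_def)
  qed
  have "P = rank_one_datum.ker d S' r' (\<lambda>j. x_var j \<notin> P)"
  proof (rule min_prime_eq_ker[OF P D'])
    show "S' \<subseteq> dead d P" by (auto simp: S'_def)
    fix j assume j: "j \<in> {1..d} - S'" "r' j \<noteq> j"
    show "minor (r' j) j \<in> P \<and> r' j \<notin> dead d P"
    proof (cases "j = i")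
      case True
      with j t' have "t \<in> {1..d} - dead d P" by (auto simp: r'_def)
      moreover have "minor t i \<in> P"
      proof -
        note pP = idom_subset.prime_in_imp_ideal[OF idom_subset_xy_polys min_primesD(1)[OF P]]
        have "x_var t * y_var i \<in> P" "x_var i * y_var t \<in> P"
          using iP calculation idom_subset.ideal_mult_left[OF idom_subset_xy_polys pP]
            idom_subset.ideal_mult_right[OF idom_subset_xy_polys pP] var_mem by blast+
        then show ?thesis
          unfolding minor_def by (rule idom_subset.ideal_diff[OF idom_subset_xy_polys pP])
      qed
      ultimately show ?thesis using True by (simp add: r'_def)
    next
      case False
      then show ?thesis using first_in_class[OF live[OF j(1) False]] prime_live_edges_minor[OF min_primesD(1,2)[OF P]]
        by (auto simp: r'_def)
    qed
  next
    fix u v assume uv: "{u, v} \<in> E" "u \<notin> S'" "v \<notin> S'"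
    have *: "r' i = r' v" if "{i, v} \<in> E" "v \<notin> S'" for v
    proof -
      have "v \<noteq> i" "v \<notin> dead d P" using that edge_mem[OF that(1)] by (auto simp: S'_def)
      then show ?thesis using t[OF that(1)] by (simp add: r'_def)
    qed
    show "r' u = r' v"
    proof (cases "u = i \<or> v = i")
      case True
      then show ?thesis using *[of u] *[of v] uv by (metis insert_commute)
    next
      case False
      then have "(u, v) \<in> (live_edges d E P)\<^sup>*" using uv by (auto simp: live_edges_def S'_def)
      then show ?thesis using False first_in_class_cong by (simp add: r'_def)
    qed
  qed simp
  \<comment> \<open>In the new kernel \<open>i\<close> is no longer dead, whereas \<open>P\<close>
    contains its variables: the contradiction.\<close>
  moreover have "x_var i \<notin> (rank_one_datum.ker d S' r' (\<lambda>j. x_var j \<notin> P) :: 'k xy_poly set)"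
    by (rule rank_one_datum.x_var_notin_ker[OF D']) (use iP in \<open>simp add: S'_def\<close>)
  ultimately show False using iP by simp
qed

end

text \<open>The hypothesis is applied with \<open>l\<close> the position of the representative of
  \<open>\<sigma> (Suc k)\<close>. It precedes \<open>Suc k\<close> unless that vertex is its own
  representative, the case in which nothing has to be shown.\<close>

theorem strongly_F_regular_if_contiguous:
  assumes p: "prime CHAR('k::field)" and \<sigma>: "vertex_order \<sigma> d"
    and contiguous: "\<And>(P :: 'k xy_poly set) l k. P \<in> min_primes \<Longrightarrow> l \<in> {1..d} \<Longrightarrow> Suc k \<in> {1..d} \<Longrightarrow> l \<le> k \<Longrightarrow>
      \<sigma> l \<notin> dead d P \<Longrightarrow> \<sigma> (Suc k) \<notin> dead d P \<Longrightarrow> minor (\<sigma> l) (\<sigma> (Suc k)) \<in> P \<Longrightarrow>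
      \<sigma> k \<notin> dead d P \<and> minor (\<sigma> k) (\<sigma> (Suc k)) \<in> P"
  shows "strongly_F_regular (symbolic_Rees_algebra (xy_polys d) (binomial_edge_ideal d E :: 'k xy_poly set))"
proof (rule vertex_order.strongly_F_regular_if_path_contiguous[OF \<sigma> p])
  interpret vertex_order \<sigma> d by (rule \<sigma>)
  fix P :: "'k xy_poly set" assume P: "P \<in> min_primes"
  let ?r = "class_first d E P \<sigma>"
  interpret D: rank_one_datum d "dead d P" ?r "\<lambda>j. x_var j \<notin> P" by (rule datum[OF P \<sigma>])
  have "\<sigma> k \<notin> dead d P \<and> ?r (\<sigma> k) = ?r (\<sigma> (Suc k))"
    if k: "k \<in> {1..<d}" and ne: "?r (\<sigma> (Suc k)) \<noteq> \<sigma> (Suc k)" and live: "\<sigma> (Suc k) \<notin> dead d P" for k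
  proof -
    define l where "l = class_position d E P \<sigma> (\<sigma> (Suc k))"
    have mem: "\<sigma> k \<in> {1..d}" "\<sigma> (Suc k) \<in> {1..d}" using k \<sigma>_mem[of k] \<sigma>_mem[of "Suc k"] by auto
    have k': "Suc k \<in> {1..d}" using k by simp
    note l = position[OF P \<sigma> k' live, folded l_def]
    have r: "?r (\<sigma> (Suc k)) = \<sigma> l" by (simp add: class_first_def l_def)
    have "l \<noteq> Suc k" using ne r by auto
    then have "l \<le> k" using l(3) by simp
    moreover have "minor (\<sigma> l) (\<sigma> (Suc k)) \<in> P"
      using prime_live_edges_minor[OF min_primesD(1,2)[OF P] l(4)] l(1,2) \<sigma>_mem[of l] r by auto
    ultimately have *: "\<sigma> k \<notin> dead d P \<and> minor (\<sigma> k) (\<sigma> (Suc k)) \<in> P"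
      using contiguous[OF P l(1) k' _ _ live] l(2) r by simp
    then have "(\<sigma> k, \<sigma> (Suc k)) \<in> (live_edges d E P)\<^sup>*"
      using minor_mem_iff_connected[OF P \<sigma>] mem live by blast
    then show ?thesis using * first_in_class_cong[OF P \<sigma>] by blast
  qed
  moreover have "?r (\<sigma> 1) = \<sigma> 1" if "\<sigma> 1 \<notin> dead d P"
  proof -
    have "1 \<in> {1..d}" using d by simp
    from position(1,3)[OF P \<sigma> this that] have "class_position d E P \<sigma> (\<sigma> 1) = 1" by simp
    then show ?thesis by (simp add: class_first_def)
  qed
  ultimately show "\<exists>S r b. rank_one_datum d S r \<and> P = rank_one_datum.ker d S r b \<and>
        (\<forall>i\<in>{1..<d}. r (\<sigma> (Suc i)) \<noteq> \<sigma> (Suc i) \<and> \<sigma> (Suc i) \<notin> S \<longrightarrow> \<sigma> i \<notin> S \<and> r (\<sigma> i) = r (\<sigma> (Suc i))) \<and>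
        (\<sigma> 1 \<notin> S \<longrightarrow> r (\<sigma> 1) = \<sigma> 1)"
    using min_prime_eq_ker_first[OF P \<sigma>] D.rank_one_datum_axioms
    by (intro exI[of _ "dead d P"] exI[of _ ?r] exI[of _ "\<lambda>j. x_var j \<notin> P"]) blast
qed

end

subsection \<open>Ascending chains of ideals of polynomials\<close>

text \<open>A monotone subsequence exists; if it decreases, it is constant from the place where it
  attains its minimum, and this tail is increasing as well.\<close>

lemma nat_seq_incseq_subseq:
  fixes a :: "nat \<Rightarrow> nat"
  shows "\<exists>g. strict_mono g \<and> incseq (\<lambda>n. a (g n))"
proof -
  obtain f where f: "strict_mono f" "monoseq (\<lambda>n. a (f n))" using seq_monosub[of a] by blast
  show ?thesis
  proof (cases "incseq (\<lambda>n. a (f n))")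
    case True
    with f show ?thesis by blast
  next
    case False
    then have dec: "decseq (\<lambda>n. a (f n))" using f by (simp add: monoseq_iff)
    define v where "v = (LEAST v. \<exists>n. a (f n) = v)"
    have "\<exists>n. a (f n) = v" unfolding v_def by (rule LeastI[of _ "a (f 0)"]) blast
    then obtain N where N: "a (f N) = v" by blast
    have le: "v \<le> a (f n)" for n unfolding v_def by (rule Least_le) blast
    have "a (f (N + n)) = v" for n
      using decseqD[OF dec, of N "N + n"] le[of "N + n"] N by simp
    then have "incseq (\<lambda>n. a (f (N + n)))" by (simp add: incseq_def)
    moreover have "strict_mono (\<lambda>n. f (N + n))" using f(1) by (simp add: strict_mono_def)
    ultimately show ?thesis by blast
  qed
qed

text \<open>Thinning the sequence once per indeterminate makes all exponents weakly increasing, and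
  then the first remaining monomial divides the second.\<close>

lemma dickson:
  fixes m :: "nat \<Rightarrow> ('v \<Rightarrow>\<^sub>0 nat)"
  assumes V: "finite V" and m: "\<And>n. Poly_Mapping.keys (m n) \<subseteq> V"
  shows "\<exists>i j n. i < j \<and> m j = m i + n"
proof -
  have "\<exists>g. strict_mono g \<and> (\<forall>v\<in>V. incseq (\<lambda>n. Poly_Mapping.lookup (m (g n)) v))"
    using V
  proof induction
    case empty
    then show ?case by (intro exI[of _ id]) (simp add: strict_mono_def)
  next
    case (insert v V)
    then obtain g where g: "strict_mono g" "\<forall>v\<in>V. incseq (\<lambda>n. Poly_Mapping.lookup (m (g n)) v)"
      by (elim exE conjE)
    obtain h where h: "strict_mono h" "incseq (\<lambda>n. Poly_Mapping.lookup (m (g (h n))) v)"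
      using nat_seq_incseq_subseq[of "\<lambda>n. Poly_Mapping.lookup (m (g n)) v"] by (elim exE conjE)
    have "strict_mono (\<lambda>n. g (h n))" using g(1) h(1) by (simp add: strict_mono_def)
    moreover have "incseq (\<lambda>n. Poly_Mapping.lookup (m (g (h n))) w)" if "w \<in> V" for w
      using bspec[OF g(2) that] strict_mono_mono[OF h(1)] by (simp add: incseq_def mono_def)
    ultimately show ?case using h(2) by (intro exI[of _ "\<lambda>n. g (h n)"]) auto
  qed
  then obtain g where g: "strict_mono g" "\<forall>v\<in>V. incseq (\<lambda>n. Poly_Mapping.lookup (m (g n)) v)"
    by (elim exE conjE)
  have "Poly_Mapping.lookup (m (g 0)) v \<le> Poly_Mapping.lookup (m (g 1)) v" for v
  proof (cases "v \<in> V")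
    case True
    then show ?thesis using incseqD[OF bspec[OF g(2) True], of 0 1] by simp
  next
    case False
    then have "v \<notin> Poly_Mapping.keys (m (g 0))" using m by blast
    then show ?thesis by (simp add: in_keys_iff)
  qed
  then have "m (g 1) = m (g 0) + (m (g 1) - m (g 0))"
    by (intro poly_mapping_eqI) (simp add: lookup_add lookup_minus)
  moreover have "g 0 < g 1" using g(1) by (simp add: strict_mono_def)
  ultimately show ?thesis by blast
qed

lemma monomial_order_default: "monomial_order (\<lambda>m :: 'v::linorder \<Rightarrow>\<^sub>0 nat. m)"
proof
  fix m n :: "'v \<Rightarrow>\<^sub>0 nat" assume "n \<noteq> 0"
  then show "m < m + n" using add_strict_left_mono[OF poly_mapping_nat_pos, of n m] by simp
qed (auto simp: inj_def)

text \<open>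
  In a strict chain pick \<open>f\<^sub>n\<close> in the \<open>n\<close>-th gap with minimal leading monomial. By Dickson's lemma one
  of these monomials divides a later one, which can then be cancelled.
\<close>

lemma ideal_chain_not_strict:
  fixes I :: "nat \<Rightarrow> (('v::linorder \<Rightarrow>\<^sub>0 nat) \<Rightarrow>\<^sub>0 'k::field) set"
  assumes V: "finite V" and I: "\<And>n. ideal_in (polys_in V) (I n)" and chain: "\<And>n. I n \<subseteq> I (Suc n)"
  shows "\<exists>n. I (Suc n) \<subseteq> I n"
proof (rule ccontr)
  interpret R: idom_subset "polys_in V :: (('v \<Rightarrow>\<^sub>0 nat) \<Rightarrow>\<^sub>0 'k) set" by (rule idom_subset_polys_in)
  interpret monomial_order "\<lambda>m :: 'v \<Rightarrow>\<^sub>0 nat. m" by (rule monomial_order_default)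
  let ?lead = "lead (\<lambda>m :: 'v \<Rightarrow>\<^sub>0 nat. m)"
  assume neg: "\<nexists>n. I (Suc n) \<subseteq> I n"
  define M where "M = {m :: 'v \<Rightarrow>\<^sub>0 nat. Poly_Mapping.keys m \<subseteq> V}"
  \<comment> \<open>In an infinite descent some earlier monomial would divide a later one by
    Dickson's lemma, and a multiple is never smaller.\<close>
  have wf: "wf {(m, n). m \<in> M \<and> n \<in> M \<and> m < n}"
    unfolding wf_iff_no_infinite_down_chain
  proof
    assume "\<exists>m. \<forall>i. (m (Suc i), m i) \<in> {(m, n). m \<in> M \<and> n \<in> M \<and> m < n}"
    then obtain m where m: "\<And>i. m i \<in> M" "\<And>i. m (Suc i) < m i" by auto
    obtain i j n where ij: "i < j" "m j = m i + n" using dickson[OF V, of m] m(1) by (auto simp: M_def)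
    have "m j < m i" using ij(1)
      by (induction rule: less_Suc_induct) (use m(2) in \<open>auto intro: less_trans\<close>)
    moreover have "m i \<le> m j" using key_less[of n "m i"] ij(2) by (cases "n = 0") auto
    ultimately show False by simp
  qed
  have lead_M: "m \<in> M" if "?lead f m" "f \<in> I n" for f m n
    using that I[of n] by (auto simp: lead_def M_def ideal_in_def polys_in_def)
  have nz: "f \<noteq> 0" if "f \<notin> I n" for f n using that I[of n] by (auto simp: ideal_in_def)
  have "\<exists>f m. f \<in> I (Suc n) - I n \<and> ?lead f m \<and> (\<forall>g m'. g \<in> I (Suc n) - I n \<longrightarrow> ?lead g m' \<longrightarrow> \<not> m' < m)" for n
  proof -
    define L where "L = {m. \<exists>f. f \<in> I (Suc n) - I n \<and> ?lead f m}"
    obtain f where f: "f \<in> I (Suc n) - I n" using neg by blast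
    then obtain m where "?lead f m" using lead_exists nz by blast
    then have "m \<in> L" using f by (auto simp: L_def)
    then obtain m0 where m0: "m0 \<in> L" "\<And>m'. (m', m0) \<in> {(m, n). m \<in> M \<and> n \<in> M \<and> m < n} \<Longrightarrow> m' \<notin> L"
      by (rule wfE_min[OF wf]) blast
    then obtain f0 where f0: "f0 \<in> I (Suc n) - I n" "?lead f0 m0" by (auto simp: L_def)
    have "\<not> m' < m0" if "g \<in> I (Suc n) - I n" "?lead g m'" for g m'
    proof
      assume "m' < m0"
      then have "m' \<notin> L" using m0(2) lead_M that f0 by auto
      then show False using that by (auto simp: L_def)
    qed
    then show ?thesis using f0 by blast
  qed
  then obtain f m where f: "\<And>n. f n \<in> I (Suc n) - I n" "\<And>n. ?lead (f n) (m n)"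
    and min: "\<And>n g m'. g \<in> I (Suc n) - I n \<Longrightarrow> ?lead g m' \<Longrightarrow> \<not> m' < m n"
    by metis
  have "Poly_Mapping.keys (m n) \<subseteq> V" for n
    using lead_M[OF f(2)[of n], of "Suc n"] f(1)[of n] by (simp add: M_def)
  then obtain i j n where ij: "i < j" "m j = m i + n" using dickson[OF V, of m] by blast
  \<comment> \<open>The quotient of the leading coefficients, chosen so that the leading term of
    \<open>f j\<close> cancels in \<open>g\<close>.\<close>
  define c where "c = Poly_Mapping.lookup (f j) (m j) / Poly_Mapping.lookup (f i) (m i)"
  define g where "g = f j - Poly_Mapping.single n c * f i"
  have ci: "Poly_Mapping.lookup (f i) (m i) \<noteq> 0" using f(2)[of i] by (simp add: lead_def in_keys_iff)
  have nV: "Poly_Mapping.keys n \<subseteq> V"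
  proof
    fix v assume "v \<in> Poly_Mapping.keys n"
    then have "v \<in> Poly_Mapping.keys (m j)" by (simp add: ij(2) in_keys_iff lookup_add)
    then show "v \<in> V" using \<open>\<And>n. Poly_Mapping.keys (m n) \<subseteq> V\<close> by blast
  qed
  \<comment> \<open>Because \<open>i < j\<close>, the subtracted multiple of \<open>f i\<close> lies
    in \<open>I j\<close>; so \<open>g\<close> is still in the \<open>j\<close>-th gap, and its
    smaller leading monomial contradicts minimality.\<close>
  have "I (Suc i) \<subseteq> I j" by (rule lift_Suc_mono_le[of I, OF chain]) (use ij in simp)
  then have "f i \<in> I j" using f(1)[of i] by blast
  then have fi: "Poly_Mapping.single n c * f i \<in> I j"
    by (rule R.ideal_mult_left[OF I _ polys_in_single[OF nV]])
  have "g \<in> I (Suc j)"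
    unfolding g_def using f(1)[of j] fi chain by (intro R.ideal_diff[OF I]) auto
  moreover have "g \<notin> I j"
  proof
    assume "g \<in> I j"
    then have "g + Poly_Mapping.single n c * f i \<in> I j" using fi R.ideal_add[OF I] by blast
    then show False using f(1)[of j] by (simp add: g_def)
  qed
  ultimately have g: "g \<in> I (Suc j) - I j" by simp
  then obtain m' where m': "?lead g m'" using lead_exists nz by blast
  have "Poly_Mapping.lookup (Poly_Mapping.single n c * f i) (m j) = c * Poly_Mapping.lookup (f i) (m i)"
    using lookup_single_mult_add[of n c "f i" "m i"] by (simp add: ij(2) add.commute)
  then have "Poly_Mapping.lookup g (m j) = 0"
    using ci by (simp add: g_def lookup_minus c_def)
  then have "m' \<noteq> m j" using m' by (auto simp: lead_def in_keys_iff)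
  moreover have "m' \<le> m j"
  proof -
    have "m' \<in> Poly_Mapping.keys (f j) \<union> Poly_Mapping.keys (Poly_Mapping.single n c * f i)"
      using m' by (auto simp: lead_def g_def in_keys_iff lookup_minus)
    moreover have "k \<le> m j" if k: "k \<in> Poly_Mapping.keys (Poly_Mapping.single n c * f i)" for k
    proof -
      obtain a l where a: "k = a + l" "a \<in> Poly_Mapping.keys (Poly_Mapping.single n c)" "l \<in> Poly_Mapping.keys (f i)"
        using k keys_mult[of "Poly_Mapping.single n c" "f i"] by blast
      then have "a = n" by (simp split: if_splits)
      moreover have "l \<le> m i" using f(2)[of i] a by (simp add: lead_def)
      ultimately show ?thesis using add_left_mono[of l "m i" n] a(1) ij(2) by (simp add: add.commute)
    qed
    ultimately show ?thesis using f(2)[of j] by (auto simp: lead_def)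
  qed
  ultimately show False using min[OF g m'] by simp
qed

subsection \<open>Minimal primes are associated\<close>

text \<open>The annihilator of the residue class of \<open>s\<close> modulo \<open>J\<close> is the
  colon ideal \<open>J : s\<close>.\<close>

lemma (in idom_subset) prime_mem_AssI:
  assumes P: "prime_in A P" and J: "ideal_in A J" and s: "s \<in> A" and eq: "P = {r \<in> A. r * s \<in> J}"
  shows "P \<in> Ass (ring_on A) J"
proof -
  interpret r: ring "ring_on A" by (rule ring_ring_on)
  interpret J: ideal J "ring_on A" using J by (simp add: ideal_ring_on)
  have zero: "J +>\<^bsub>ring_on A\<^esub> x = J \<longleftrightarrow> x \<in> J" if "x \<in> A" for x
    using J.a_rcos_self[of x] J.a_rcos_const[of x] that by auto
  have "(r \<odot>\<^bsub>quotient_module (ring_on A) J\<^esub> (J +>\<^bsub>ring_on A\<^esub> s) = \<zero>\<^bsub>quotient_module (ring_on A) J\<^esub>)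
      \<longleftrightarrow> r * s \<in> J" if "r \<in> A" for r
    using that s J.rcoset_mult_add[of r s] zero[of "r * s"] mult_mem
    by (simp add: quotient_module_def FactRing_def)
  then have "P = {r \<in> carrier (ring_on A). r \<odot>\<^bsub>quotient_module (ring_on A) J\<^esub> (J +>\<^bsub>ring_on A\<^esub> s)
      = \<zero>\<^bsub>quotient_module (ring_on A) J\<^esub>}"
    unfolding eq by auto
  moreover have "J +>\<^bsub>ring_on A\<^esub> s \<in> carrier (quotient_module (ring_on A) J)"
    using s r.a_rcosetsI[OF J.a_subset] by (simp add: quotient_module_def FactRing_def)
  ultimately show ?thesis
    using P unfolding Ass_def associated_primes_def by (auto simp: prime_ring_on)
qed

context edge_ideal
begin

text \<open>
  An element \<open>s\<close> outside of \<open>P\<close> is found such that \<open>P\<close> is the union of the colon ideals \<open>J : s\<^sup>n\<close>, which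
  become stationary.
\<close>

lemma min_primes_subset_Ass:
  assumes "d \<ge> 1"
  shows "(min_primes :: 'k::field xy_poly set set) \<subseteq> Ass (ring_on (xy_polys d)) (binomial_edge_ideal d E)"
proof
  fix P :: "'k xy_poly set" assume P: "P \<in> min_primes"
  interpret R: idom_subset "xy_polys d :: 'k xy_poly set" by (rule idom_subset_xy_polys)
  let ?J = "binomial_edge_ideal d E :: 'k xy_poly set"
  note J = ideal_edge_ideal[where 'k = 'k]
  \<comment> \<open>The vertex order only selects representatives here, for which the identity will
    do.\<close>
  have \<sigma>: "vertex_order id d" using assms by unfold_locales auto
  note pP = min_primesD(1)[OF P]
  interpret D: rank_one_datum d "dead d P" "class_first d E P id" "\<lambda>j. x_var j \<notin> P" by (rule datum[OF P \<sigma>])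
  have ker: "P = D.ker" by (rule min_prime_eq_ker_first[OF P \<sigma>])
  have one: "1 \<in> xy_polys d - P" using pP R.one_mem by (auto simp: prime_in_def)
  \<comment> \<open>A dead vertex has two live neighbours \<open>a, c\<close> whose minor is outside
    \<open>P\<close>; by the expansions below, that minor multiplies both variables of the vertex
    into \<open>J\<close>.\<close>
  have dead: "\<exists>t\<in>xy_polys d - P. t * x_var i \<in> ?J \<and> t * y_var i \<in> ?J" if i: "i \<in> dead d P" for i
  proof -
    obtain a c where ac: "a \<in> {1..d} - dead d P" "c \<in> {1..d} - dead d P" "{i, a} \<in> E" "{i, c} \<in> E" "minor a c \<notin> P"
      using dead_separates[OF P \<sigma> i] by blast
    have eq: "(minor a c * x_var i :: 'k xy_poly) = x_var a * minor i c - x_var c * minor i a"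
      "(minor a c * y_var i :: 'k xy_poly) = y_var a * minor i c - y_var c * minor i a"
      by (simp_all add: minor_def algebra_simps)
    have e: "w * minor i u \<in> ?J" if "{i, u} \<in> E" "w \<in> xy_polys d" for w u
      using R.ideal_mult_left[OF J minor_in_edge_ideal[OF that(1)] that(2)] .
    then have "minor a c * x_var i \<in> ?J" "minor a c * y_var i \<in> ?J"
      unfolding eq using ac(1,2)
      by (intro R.ideal_diff[OF J e[OF ac(4)] e[OF ac(3)]] var_mem; simp)+
    moreover have "minor a c \<in> xy_polys d - P" using ac minor_mem by auto
    ultimately show ?thesis by blast
  qed
  have live: "\<exists>t\<in>xy_polys d - P. t * minor i j \<in> ?J"
    if ij: "(i, j) \<in> (live_edges d E P)\<^sup>*" "i \<in> {1..d} - dead d P" for i j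
    using ij(1)
  proof (induction rule: rtrancl_induct)
    case base
    have "1 * minor i i \<in> ?J" using J by (simp add: minor_def ideal_in_def)
    then show ?case using one by blast
  next
    case (step j k)
    then obtain t where t: "t \<in> xy_polys d - P" "t * minor i j \<in> ?J" by blast
    have jk: "{j, k} \<in> E" "j \<notin> dead d P" using step by (auto simp: live_edges_def)
    then have mem: "j \<in> {1..d}" "k \<in> {1..d}" using edge_mem by blast+
    \<comment> \<open>The relation behind \<open>minor_trans\<close>, with \<open>w\<close> a
      variable of \<open>j\<close> outside \<open>P\<close>, so that the multiplier stays outside
      \<open>P\<close> along the path.\<close>
    have *: "\<exists>w wk wi. w \<in> xy_polys d - P \<and> wk \<in> xy_polys d \<and> wi \<in> xy_polys d \<and>
       (w * minor i k :: 'k xy_poly) = wk * minor i j + wi * minor j k"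
    proof (cases "x_var j \<in> P")
      case True
      then have "y_var j \<notin> P" using jk mem by (auto simp: dead_def)
      then show ?thesis using mem ij(2)
        by (intro exI[of _ "y_var j"] exI[of _ "y_var k"] exI[of _ "y_var i"])
           (auto intro!: var_mem simp: minor_def algebra_simps)
    next
      case False
      then show ?thesis using mem ij(2)
        by (intro exI[of _ "x_var j"] exI[of _ "x_var k"] exI[of _ "x_var i"])
           (auto intro!: var_mem simp: minor_def algebra_simps)
    qed
    then obtain w wk wi where w: "w \<in> xy_polys d - P" "wk \<in> xy_polys d" "wi \<in> xy_polys d"
      "(w * minor i k :: 'k xy_poly) = wk * minor i j + wi * minor j k" by blast
    have "t * wi * minor j k \<in> ?J"
      by (rule R.ideal_mult_left[OF J minor_in_edge_ideal[OF jk(1)]]) (use t(1) w(3) in \<open>auto intro: R.mult_mem\<close>)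
    from R.ideal_add[OF J R.ideal_mult_left[OF J t(2) w(2)] this]
    have "t * wi * minor j k + wk * (t * minor i j) \<in> ?J" .
    also have "t * wi * minor j k + wk * (t * minor i j) = t * (w * minor i k)"
      by (simp only: w(4)) (simp add: algebra_simps)
    finally have "(t * w) * minor i k \<in> ?J" by (simp add: mult.assoc)
    then show ?case using R.prime_mult_notin[OF pP t(1) w(1)] by blast
  qed
  have "\<exists>t\<in>xy_polys d - P. t * D.z u \<in> ?J" if u: "u \<in> D.K" for u
  proof (cases u)
    case (Xvar j)
    show ?thesis
    proof (cases "j \<in> dead d P")
      case True
      then show ?thesis using dead[of j] Xvar by (auto simp: D.z_def)
    next
      case False
      then have "j \<in> {1..d} - dead d P" using u Xvar by (auto simp: D.K_def D.T_def)
      then show ?thesis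
        using live[of "class_first d E P id j" j] first_in_class[OF P \<sigma>, of j] Xvar False by (simp add: D.z_def)
    qed
  next
    case (Yvar j)
    then have "j \<in> dead d P" using u by (auto simp: D.K_def)
    then show ?thesis using dead[of j] Yvar by (auto simp: D.z_def)
  qed
  then obtain t where t: "\<And>u. u \<in> D.K \<Longrightarrow> t u \<in> xy_polys d - P \<and> t u * D.z u \<in> ?J" by metis
  \<comment> \<open>\<open>s1\<close> moves all generators of \<open>P\<close> into
    \<open>J\<close>, while \<open>D.s\<close> takes care of the saturation; their product is the
    element \<open>s\<close> announced above.\<close>
  define s1 where "s1 = (\<Prod>u\<in>D.K. t u)"
  define s where "s = s1 * D.s"
  have s1: "s1 \<in> xy_polys d - P" unfolding s1_def using t by (intro R.prime_prod_notin[OF pP]) auto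
  have "D.pivot j \<notin> P" if "j \<in> D.T" for j
    using D.r_neq[OF that] by (auto simp: D.pivot_def side_def dead_def)
  then have Ds: "D.s \<in> xy_polys d - P" using D.s_notin_prime[OF pP] D.s_mem by blast
  have s: "s \<in> xy_polys d - P" unfolding s_def by (rule R.prime_mult_notin[OF pP s1 Ds])
  have sn: "s ^ n \<in> xy_polys d - P" for n by (rule R.prime_power_notin[OF pP s])
  define I where "I n = {f \<in> xy_polys d. f * s ^ n \<in> ?J}" for n
  have colon: "ideal_in (xy_polys d) {f \<in> xy_polys d. f * w \<in> ?J}" for w
    using J by (auto simp: ideal_in_def distrib_right mult.assoc intro: R.zero_mem R.add_mem R.mult_mem)
  have I: "ideal_in (xy_polys d) (I n)" for n unfolding I_def by (rule colon)
  have step: "f \<in> I (Suc n) \<longleftrightarrow> f \<in> xy_polys d \<and> f * s \<in> I n" for f n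
    using s by (auto simp: I_def mult_ac intro: R.mult_mem)
  have chain: "I n \<subseteq> I (Suc n)" for n
    using step R.ideal_mult_right[OF I, of _ n s] s I[of n] by (auto simp: ideal_in_def)
  have "finite (Xvar ` {1..d} \<union> Yvar ` {1..d})" by simp
  from ideal_chain_not_strict[where I = I, OF this, folded xy_polys_eq, OF I chain]
  obtain n where n: "I (Suc n) \<subseteq> I n" by blast
  have stable: "I (n + k) \<subseteq> I n" for k
  proof (induction k)
    case (Suc k)
    have "I (n + Suc k) \<subseteq> I (Suc n)"
      using Suc step[of _ "n + k"] step[of _ n] by auto
    with n show ?case by blast
  qed simp
  have "P = I n"
  proof
    show "I n \<subseteq> P"
      using pP sn[of n] min_primesD(2)[OF P] by (auto simp: I_def prime_in_def)
    show "P \<subseteq> I n"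
    proof
      fix f assume f: "f \<in> P"
      \<comment> \<open>Saturating the colon ideal \<open>J : s1\<close>, which contains the
        generators, shows that a power of \<open>s\<close> carries \<open>f\<close> into
        \<open>J\<close>.\<close>
      have z: "D.z ` D.K \<subseteq> {f \<in> xy_polys d. f * s1 \<in> ?J}"
      proof safe
        fix u assume u: "u \<in> D.K"
        show zR: "D.z u \<in> (xy_polys d :: 'k xy_poly set)" using D.z_mem u by blast
        have "s1 = t u * (\<Prod>u\<in>D.K - {u}. t u)" unfolding s1_def by (rule prod.remove[OF D.finite_K u])
        then have "D.z u * s1 = (t u * D.z u) * (\<Prod>u\<in>D.K - {u}. t u)" by (simp add: mult_ac)
        also have "\<dots> \<in> ?J" using t u by (intro R.ideal_mult_right[OF J, of "t u * D.z u"] R.prod_mem) auto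
        finally show "D.z u * s1 \<in> ?J" .
      qed
      have "f \<in> D.ker" using f ker by simp
      from D.ker_saturation[OF this colon z] obtain N where N: "D.s ^ N * f * s1 \<in> ?J" by blast
      have fR: "f \<in> xy_polys d" using f pP by (auto simp: prime_in_def ideal_in_def)
      have "f * s ^ Suc N = (D.s ^ N * f * s1) * (s1 ^ N * D.s)"
        by (simp add: s_def power_mult_distrib mult_ac)
      also have "\<dots> \<in> ?J"
        using s1 Ds by (intro R.ideal_mult_right[OF J N] R.mult_mem R.power_mem) auto
      finally have "f \<in> I (Suc N)" using fR by (simp add: I_def)
      moreover have "I (Suc N) \<subseteq> I (n + Suc N)"
        by (rule lift_Suc_mono_le[of I, OF chain]) simp
      ultimately show "f \<in> I n" using stable by blast
    qed
  qed
  then show "P \<in> Ass (ring_on (xy_polys d)) ?J"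
    using R.prime_mem_AssI[OF pP J, of "s ^ n"] sn[of n] by (simp add: I_def)
qed

end

subsection \<open>Contiguous vertex orders\<close>

lemma vertex_order_extend:
  assumes "d \<ge> 1" "bij_betw f {1..d} {1..d}"
  shows "vertex_order (\<lambda>i. if i \<in> {1..d} then f i else i) d"
proof
  let ?g = "\<lambda>i. if i \<in> {1..d} then f i else i"
  have in': "bij_betw ?g {1..d} {1..d}"
    using bij_betw_cong[of "{1..d}" ?g f "{1..d}"] assms(2) by auto
  have out: "bij_betw ?g (- {1..d}) (- {1..d})"
    by (rule bij_betw_byWitness[where f' = ?g]) auto
  show "bij ?g" using bij_betw_combine[OF in' out] by simp
  show "?g ` {1..d} = {1..d}" using in' by (simp only: bij_betw_def)
qed (use assms in simp)

context edge_ideal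
begin

lemma connected_all_minors:
  fixes P :: "'k::field xy_poly set"
  assumes conn: "connected_graph {1..d} E"
    and P: "prime_in (xy_polys d) P" "binomial_edge_ideal d E \<subseteq> P" and dead: "dead d P = {}"
    and ij: "i \<in> {1..d}" "j \<in> {1..d}"
  shows "minor i j \<in> P"
proof -
  have "live_edges d E P = {(a, b). {a, b} \<in> E}" by (simp add: live_edges_def dead)
  then have "(i, j) \<in> (live_edges d E P)\<^sup>*" using conn ij by (simp only: connected_graph_def)
  then show ?thesis using prime_live_edges_minor[OF P] ij dead by blast
qed

lemma connected_pos: "connected_graph {1..d} E \<Longrightarrow> d \<ge> 1"
  by (auto simp: connected_graph_def)

text \<open>If some vertex is dead, it separates two live vertices; these lie in one part, and a
  live vertex outside that part would join them. So all live vertices are in one independent part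
  and all components are singletons. Otherwise there is a single component.\<close>

lemma strongly_F_regular_complete_multipartite:
  assumes p: "prime CHAR('k::field)" and conn: "connected_graph {1..d} E"
    and multi: "complete_multipartite {1..d} E"
  shows "strongly_F_regular (symbolic_Rees_algebra (xy_polys d) (binomial_edge_ideal d E :: 'k xy_poly set))"
proof (rule strongly_F_regular_if_contiguous[OF p, of id])
  show \<sigma>: "vertex_order id d" using connected_pos[OF conn] by unfold_locales auto
  fix P :: "'k xy_poly set" and l k
  assume P: "P \<in> min_primes" and lk: "l \<in> {1..d}" "Suc k \<in> {1..d}" "l \<le> k"
    and live: "id l \<notin> dead d P" "id (Suc k) \<notin> dead d P" and m: "minor (id l) (id (Suc k)) \<in> P"
  note pP = min_primesD(1,2)[OF P]
  show "id k \<notin> dead d P \<and> minor (id k) (id (Suc k)) \<in> P"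
  proof (cases "dead d P = {}")
    case True
    then show ?thesis using connected_all_minors[OF conn pP True, of k "Suc k"] lk by simp
  next
    case False
    then obtain i where "i \<in> dead d P" by blast
    then obtain a c where ac: "a \<in> {1..d} - dead d P" "c \<in> {1..d} - dead d P" "minor a c \<notin> P"
      using dead_separates[OF P \<sigma>] by blast
    obtain Pt where Pt: "partition_on {1..d} Pt"
      and indep0: "\<forall>A\<in>Pt. \<forall>u\<in>A. \<forall>v\<in>A. {u, v} \<notin> E"
      and adj0: "\<forall>A\<in>Pt. \<forall>B\<in>Pt. A \<noteq> B \<longrightarrow> (\<forall>u\<in>A. \<forall>v\<in>B. {u, v} \<in> E)"
      using multi unfolding complete_multipartite_def by (elim exE conjE)
    have indep: "{u, v} \<notin> E" if "A \<in> Pt" "u \<in> A" "v \<in> A" for A u v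
      using indep0 that by simp
    have adj: "{u, v} \<in> E" if "A \<in> Pt" "B \<in> Pt" "A \<noteq> B" "u \<in> A" "v \<in> B" for A B u v
      using adj0 that by simp
    have part: "\<exists>A\<in>Pt. u \<in> A" if "u \<in> {1..d}" for u
      using that partition_onD1[OF Pt] by blast
    have edge_in: "minor u v \<in> P" if "{u, v} \<in> E" for u v
      using minor_in_edge_ideal[OF that] pP(2) by blast
    obtain A C where A: "A \<in> Pt" "a \<in> A" "C \<in> Pt" "c \<in> C" using part ac by blast
    have "A = C" using adj[OF A(1,3) _ A(2,4)] edge_in ac(3) by blast
    have all: "w \<in> A" if w: "w \<in> {1..d} - dead d P" for w
    proof (rule ccontr)
      assume "w \<notin> A"
      moreover obtain B where "B \<in> Pt" "w \<in> B" using part w by blast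
      ultimately have "{a, w} \<in> E" "{w, c} \<in> E" using adj A \<open>A = C\<close> by blast+
      then have "minor a c \<in> P" using minor_trans[OF pP(1), of a w c] edge_in w ac by blast
      then show False using ac by simp
    qed
    have "x \<notin> live_edges d E P" for x
    proof
      assume "x \<in> live_edges d E P"
      then obtain u v where uv: "{u, v} \<in> E" "u \<notin> dead d P" "v \<notin> dead d P" by (auto simp: live_edges_def)
      with edge_mem[OF uv(1)] have "u \<in> A" "v \<in> A" using all by auto
      with indep[OF A(1)] uv(1) show False by blast
    qed
    then have "live_edges d E P = {}" by blast
    \<comment> \<open>Without live edges this forces \<open>l = Suc k\<close>, against
      \<open>l \<le> k\<close>.\<close>
    moreover have "(l, Suc k) \<in> (live_edges d E P)\<^sup>*"
      using minor_mem_iff_connected[OF P \<sigma>, of l "Suc k"] m live lk by simp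
    ultimately show ?thesis using lk by simp
  qed
qed

text \<open>A live path from the left of a vertex \<open>v\<close> to its right visits
  \<open>v\<close> or jumps over it along an edge \<open>{a, b}\<close>. In the second case
  closedness makes \<open>a\<close> and \<open>b\<close> neighbours of \<open>v\<close> and puts all
  live neighbours of \<open>v\<close> into the class of \<open>a\<close>, so \<open>v\<close> cannot
  be dead and belongs to that class.\<close>

lemma strongly_F_regular_closed:
  assumes p: "prime CHAR('k::field)" and conn: "connected_graph {1..d} E"
    and closed: "closed_graph {1..d} E"
  shows "strongly_F_regular (symbolic_Rees_algebra (xy_polys d) (binomial_edge_ideal d E :: 'k xy_poly set))"
proof -
  obtain pos where pos0: "bij_betw pos {1..d} {1..card {1..d}}"
    and cl0: "\<forall>u\<in>{1..d}. \<forall>v\<in>{1..d}. \<forall>w\<in>{1..d}. {u, w} \<in> E \<and> pos u < pos v \<and> pos v < pos w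
      \<longrightarrow> {u, v} \<in> E \<and> {v, w} \<in> E"
    using closed unfolding closed_graph_def by (elim exE conjE)
  have pos: "bij_betw pos {1..d} {1..d}" using pos0 by simp
  have cl: "{u, v} \<in> E \<and> {v, w} \<in> E" if "u \<in> {1..d}" "v \<in> {1..d}" "w \<in> {1..d}"
    "{u, w} \<in> E" "pos u < pos v" "pos v < pos w" for u v w
    using cl0[rule_format, OF that(1-3)] that(4-6) by blast
  define \<sigma> where "\<sigma> i = (if i \<in> {1..d} then inv_into {1..d} pos i else i)" for i
  have \<sigma>: "vertex_order \<sigma> d"
    unfolding \<sigma>_def by (rule vertex_order_extend[OF connected_pos[OF conn] bij_betw_inv_into[OF pos]])
  have pos_\<sigma>: "pos (\<sigma> i) = i" if "i \<in> {1..d}" for i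
    using that pos by (simp add: \<sigma>_def bij_betw_inv_into_right)
  have \<sigma>_pos: "\<sigma> (pos u) = u" "pos u \<in> {1..d}" if "u \<in> {1..d}" for u
  proof -
    show m: "pos u \<in> {1..d}" using bij_betwE[OF pos] that by blast
    show "\<sigma> (pos u) = u"
      using bij_betw_inv_into_left[OF pos that] m unfolding \<sigma>_def by (simp only: if_True)
  qed
  show ?thesis
  proof (rule strongly_F_regular_if_contiguous[OF p \<sigma>])
    fix P :: "'k xy_poly set" and l k
    assume P: "P \<in> min_primes" and lk: "l \<in> {1..d}" "Suc k \<in> {1..d}" "l \<le> k"
      and live: "\<sigma> l \<notin> dead d P" "\<sigma> (Suc k) \<notin> dead d P" and m: "minor (\<sigma> l) (\<sigma> (Suc k)) \<in> P"
    let ?L = "live_edges d E P"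
    have mem: "\<sigma> i \<in> {1..d}" if "i \<in> {1..d}" for i using vertex_order.\<sigma>_mem[OF \<sigma> that] .
    note conn_iff = minor_mem_iff_connected[OF P \<sigma>]
    define v where "v = \<sigma> k"
    have k: "k \<in> {1..d}" using lk by auto
    have v: "v \<in> {1..d}" "pos v = k" using mem[OF k] pos_\<sigma>[OF k] by (auto simp: v_def)
    have LE: "\<sigma> l \<in> {1..d} - dead d P" "\<sigma> (Suc k) \<in> {1..d} - dead d P" using live mem lk by auto
    have path: "(\<sigma> l, \<sigma> (Suc k)) \<in> ?L\<^sup>*" using conn_iff[OF LE] m by simp
    show "\<sigma> k \<notin> dead d P \<and> minor (\<sigma> k) (\<sigma> (Suc k)) \<in> P"
    proof (cases "l = k")
      case True
      then show ?thesis using live m by simp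
    next
      case False
      then have lk': "l < k" using lk by simp
      \<comment> \<open>Some edge of the component of \<open>\<sigma> l\<close> jumps over position
        \<open>k\<close>.\<close>
      define cross where "cross \<longleftrightarrow> (\<exists>a b. (\<sigma> l, a) \<in> ?L\<^sup>* \<and> (a, b) \<in> ?L \<and> pos a < k \<and> k < pos b)"
      have "pos y < k \<or> (\<sigma> l, v) \<in> ?L\<^sup>* \<or> cross" if "(\<sigma> l, y) \<in> ?L\<^sup>*" for y
        using that
      proof (induction rule: rtrancl_induct)
        case base
        then show ?case using lk' pos_\<sigma>[OF lk(1)] by simp
      next
        case (step y z)
        then have "z \<in> {1..d}" using edge_mem by (auto simp: live_edges_def)
        show ?case
        proof (cases "pos y < k \<and> \<not> pos z < k")
          case True
          then consider "pos z = k" | "k < pos z" by linarith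
          then show ?thesis
          proof cases
            case 1
            then have "z = v" using \<sigma>_pos[OF \<open>z \<in> {1..d}\<close>] by (simp add: v_def)
            then show ?thesis using step by (meson rtrancl.rtrancl_into_rtrancl)
          next
            case 2
            then show ?thesis using step True unfolding cross_def by blast
          qed
        qed (use step in blast)
      qed
      from this[OF path] have "(\<sigma> l, v) \<in> ?L\<^sup>* \<or> cross"
        using pos_\<sigma>[OF lk(2)] by simp
      moreover have "v \<notin> dead d P \<and> (\<sigma> l, v) \<in> ?L\<^sup>*" if cross
      proof -
        obtain a b where ab: "(\<sigma> l, a) \<in> ?L\<^sup>*" "(a, b) \<in> ?L" "pos a < k" "k < pos b"
          using \<open>cross\<close> unfolding cross_def by blast
        have abE: "{a, b} \<in> E" "a \<in> {1..d} - dead d P" "b \<in> {1..d} - dead d P"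
          using ab(2) edge_mem by (auto simp: live_edges_def)
        have av: "{a, v} \<in> E" "{v, b} \<in> E" using cl[of a v b] abE v ab(3,4) by auto
        have alive: "(\<sigma> l, v) \<in> ?L\<^sup>*" if "v \<notin> dead d P"
        proof -
          have "(a, v) \<in> ?L" using av abE that by (auto simp: live_edges_def)
          with ab(1) show ?thesis by (rule rtrancl.rtrancl_into_rtrancl)
        qed
        have nbr: "minor a u \<in> P" if u: "{v, u} \<in> E" "u \<in> {1..d} - dead d P" for u
        proof -
          have ne: "u \<noteq> v" using edge_mem[OF u(1)] by auto
          then have "pos u \<noteq> k" using \<sigma>_pos[of u] u(2) v_def by auto
          have edgeP: "minor x y \<in> P" if "{x, y} \<in> E" for x y
            using minor_in_edge_ideal[OF that] min_primesD(2)[OF P] by blast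
          have uE: "{u, v} \<in> E" using u(1) by (simp add: insert_commute)
          have "minor a a \<in> P" using min_primesD(1)[OF P] by (simp add: minor_def prime_in_def ideal_in_def)
          \<comment> \<open>In the four strict cases closedness is applied to whichever of the edges
            \<open>{v, u}\<close>, \<open>{a, v}\<close>, \<open>{v, b}\<close> has the needed
            vertex strictly between its ends. To the left of \<open>v\<close> this yields an edge
            from \<open>u\<close> to \<open>a\<close>, to the right one to \<open>b\<close>, which
            is adjacent to \<open>a\<close>.\<close>
          consider "pos u = pos a" | "pos u = pos b" | "pos u < pos a" | "pos a < pos u" "pos u < k"
            | "k < pos u" "pos u < pos b" | "pos b < pos u" using \<open>pos u \<noteq> k\<close> by linarith
          then show ?thesis
          proof cases
            case 1
            then have "u = a" using u(2) abE(2) by (metis DiffD1 \<sigma>_pos(1))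
            then show ?thesis using \<open>minor a a \<in> P\<close> by simp
          next
            case 2
            then have "u = b" using u(2) abE(3) by (metis DiffD1 \<sigma>_pos(1))
            then show ?thesis using edgeP[OF abE(1)] by simp
          next
            case 3
            then have "{u, a} \<in> E" using cl[of u a v] uE u abE v ab by auto
            then show ?thesis using edgeP[of a u] by (simp add: insert_commute)
          next
            case 4
            then have "{a, u} \<in> E" using cl[of a u v] av u abE v ab by auto
            then show ?thesis using edgeP by blast
          next
            case 5
            then have "{u, b} \<in> E" using cl[of v u b] av u abE v ab by auto
            then have "minor b u \<in> P" using edgeP[of b u] by (simp add: insert_commute)
            then show ?thesis
              using minor_trans[OF min_primesD(1)[OF P], of a b u] edgeP[OF abE(1)] abE u by auto
          next
            case 6
            then have "{b, u} \<in> E" using cl[of v b u] u abE v ab by auto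
            then show ?thesis
              using minor_trans[OF min_primesD(1)[OF P], of a b u] edgeP[OF abE(1)] edgeP abE u by auto
          qed
        qed
        have "v \<notin> dead d P"
        proof
          assume "v \<in> dead d P"
          then obtain u w where uw: "u \<in> {1..d} - dead d P" "w \<in> {1..d} - dead d P" "{v, u} \<in> E" "{v, w} \<in> E" "minor u w \<notin> P"
            using dead_separates[OF P \<sigma>] by blast
          have "(a, u) \<in> ?L\<^sup>*" "(a, w) \<in> ?L\<^sup>*" using nbr uw conn_iff abE by blast+
          then have "(u, w) \<in> ?L\<^sup>*" using live_edges_sym by (meson rtrancl_trans)
          then show False using conn_iff[OF uw(1,2)] uw(5) by simp
        qed
        with alive show ?thesis by blast
      qed
      moreover have "v \<notin> dead d P" if "(\<sigma> l, v) \<in> ?L\<^sup>*"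
        using prime_live_edges_minor[OF min_primesD(1,2)[OF P] that LE(1)] by blast
      ultimately have *: "v \<notin> dead d P" "(\<sigma> l, v) \<in> ?L\<^sup>*" by blast+
      then have "(v, \<sigma> (Suc k)) \<in> ?L\<^sup>*" using path live_edges_sym by (meson rtrancl_trans)
      then show ?thesis using conn_iff[of v "\<sigma> (Suc k)"] LE v * by (simp add: v_def)
    qed
  qed
qed

text \<open>The prime of the generic 2 by d matrix of rank at most one. A smaller prime over the
  edge ideal has no dead vertices either, so connectedness puts all 2-minors into it, and with them
  the whole kernel.\<close>

lemma generic_min_prime:
  assumes conn: "connected_graph {1..d} E"
  obtains P0 :: "'k::field xy_poly set" where "P0 \<in> min_primes" "dead d P0 = {}"
proof -
  interpret R: idom_subset "xy_polys d :: 'k xy_poly set" by (rule idom_subset_xy_polys)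
  interpret D: rank_one_datum d "{}" "\<lambda>_. 1" "\<lambda>_. True"
    using connected_pos[OF conn] by unfold_locales auto
  define P0 where "P0 = (D.ker :: 'k xy_poly set)"
  have live: "x_var j \<notin> P0" if "j \<in> {1..d}" for j
    using D.x_var_notin_ker that by (simp add: P0_def)
  have "P0 \<in> min_primes"
    unfolding R.minimal_primes_iff
  proof (intro conjI allI impI)
    show "prime_in (xy_polys d) P0" unfolding P0_def by (rule D.prime_ker)
    show "binomial_edge_ideal d E \<subseteq> P0"
      unfolding edge_ideal_subset_iff[OF R.prime_in_imp_ideal[OF \<open>prime_in (xy_polys d) P0\<close>]]
      unfolding P0_def using edge_mem D.minor_in_ker by blast
    fix Q assume Q: "prime_in (xy_polys d) Q \<and> binomial_edge_ideal d E \<subseteq> Q \<and> Q \<subseteq> P0"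
    then have dead: "dead d Q = {}" using live by (auto simp: dead_def)
    have "D.ker \<subseteq> Q"
    proof (rule D.ker_subset_prime)
      show "prime_in (xy_polys d) Q" using Q by simp
      show "D.z ` D.K \<subseteq> Q"
      proof -
        have "minor 1 j \<in> Q" if "j \<in> D.T" for j
        proof (rule connected_all_minors[OF conn _ _ dead])
          show "j \<in> {1..d}" using that unfolding D.T_def by blast
        qed (use Q connected_pos[OF conn] in auto)
        then show ?thesis unfolding D.z_image_subset by blast
      qed
      fix j assume "j \<in> D.T"
      have "1 \<in> {1..d}" using connected_pos[OF conn] by simp
      then show "D.pivot j \<notin> Q" using Q live unfolding D.pivot_def side_def if_True by blast
    qed
    then show "Q = P0" using Q by (auto simp: P0_def)
  qed
  moreover have "dead d P0 = {}" using live by (auto simp: dead_def)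
  ultimately show thesis by (rule that)
qed

text \<open>Minimal primes are associated, and the generic one accounts for one of at most two. So
  at most one minimal prime \<open>P1\<close> has dead vertices, and sorting the vertices by its
  components suffices; for primes without dead vertices there is only one component.\<close>

lemma strongly_F_regular_two_associated_primes:
  assumes p: "prime CHAR('k::field)" and conn: "connected_graph {1..d} E"
    and Ass: "finite (Ass (ring_on (xy_polys d)) (binomial_edge_ideal d E :: 'k xy_poly set))"
      "card (Ass (ring_on (xy_polys d)) (binomial_edge_ideal d E :: 'k xy_poly set)) \<le> 2"
  shows "strongly_F_regular (symbolic_Rees_algebra (xy_polys d) (binomial_edge_ideal d E :: 'k xy_poly set))"
proof -
  let ?A = "Ass (ring_on (xy_polys d)) (binomial_edge_ideal d E :: 'k xy_poly set)"
  note d1 = connected_pos[OF conn]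
  have idord: "vertex_order id d" using d1 by unfold_locales auto
  obtain P0 :: "'k xy_poly set" where P0: "P0 \<in> min_primes" "dead d P0 = {}"
    using generic_min_prime[OF conn] .
  obtain P1 :: "'k xy_poly set" where P1: "\<And>P. P \<in> min_primes \<Longrightarrow> dead d P \<noteq> {} \<Longrightarrow> P = P1"
  proof (cases "\<exists>P \<in> min_primes :: 'k xy_poly set set. dead d P \<noteq> {}")
    case True
    then obtain P1 :: "'k xy_poly set" where P1: "P1 \<in> min_primes" "dead d P1 \<noteq> {}" by blast
    have "P = P1" if P: "P \<in> min_primes" "dead d P \<noteq> {}" for P :: "'k xy_poly set"
    proof (rule ccontr)
      assume "P \<noteq> P1"
      moreover have "P \<noteq> P0" "P1 \<noteq> P0" using P P1 P0 by auto
      ultimately have "card {P, P1, P0} = 3" by simp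
      moreover have "{P, P1, P0} \<subseteq> ?A" using min_primes_subset_Ass[OF d1] P P1 P0 by blast
      ultimately show False using card_mono[OF Ass(1), of "{P, P1, P0}"] Ass(2) by simp
    qed
    then show thesis by (rule that)
  next
    case False
    \<comment> \<open>Without a prime having dead vertices the requirement is vacuous, and
      \<open>P0\<close> is a placeholder.\<close>
    then show thesis by (intro that[of P0]) blast
  qed
  \<comment> \<open>Representatives are at least 1, so the value 0 is reserved for dead vertices.
    These are sorted to the front, and each component occupies one run of equal keys.\<close>
  define key where "key j = (if j \<in> dead d P1 then 0 else class_first d E P1 id j)" for j
  define xs where "xs = sort_key key [1..<Suc d]"
  have xs: "distinct xs" "set xs = {1..d}" "length xs = d" "sorted (map key xs)"
    by (auto simp: xs_def)
  have bij: "bij_betw (\<lambda>i. xs ! (i - 1)) {1..d} {1..d}"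
  proof -
    have "bij_betw ((!) xs) {..<d} {1..d}" using bij_betw_nth[OF xs(1), of "{..<d}" "{1..d}"] xs by simp
    moreover have "bij_betw (\<lambda>i. i - 1) {1..d} {..<d}"
      by (rule bij_betw_byWitness[where f' = Suc]) auto
    ultimately show ?thesis using bij_betw_trans[of "\<lambda>i. i - 1" "{1..d}" "{..<d}" "(!) xs" "{1..d}"]
      by (simp add: comp_def)
  qed
  \<comment> \<open>List positions start at 0, positions in the vertex order at 1.\<close>
  define \<sigma> where "\<sigma> i = (if i \<in> {1..d} then xs ! (i - 1) else i)" for i
  have \<sigma>: "vertex_order \<sigma> d" unfolding \<sigma>_def by (rule vertex_order_extend[OF d1 bij])
  have key_mono: "key (\<sigma> i) \<le> key (\<sigma> j)" if "i \<in> {1..d}" "j \<in> {1..d}" "i \<le> j" for i j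
    using sorted_nth_mono[OF xs(4), of "i - 1" "j - 1"] that xs(3) by (simp add: \<sigma>_def)
  show ?thesis
  proof (rule strongly_F_regular_if_contiguous[OF p \<sigma>])
    fix P :: "'k xy_poly set" and l k
    assume P: "P \<in> min_primes" and lk: "l \<in> {1..d}" "Suc k \<in> {1..d}" "l \<le> k"
      and live: "\<sigma> l \<notin> dead d P" "\<sigma> (Suc k) \<notin> dead d P" and m: "minor (\<sigma> l) (\<sigma> (Suc k)) \<in> P"
    have k: "k \<in> {1..d}" using lk by auto
    have mem: "\<sigma> i \<in> {1..d}" if "i \<in> {1..d}" for i using vertex_order.\<sigma>_mem[OF \<sigma> that] .
    show "\<sigma> k \<notin> dead d P \<and> minor (\<sigma> k) (\<sigma> (Suc k)) \<in> P"
    proof (cases "dead d P = {}")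
      case True
      then show ?thesis
        using connected_all_minors[OF conn min_primesD(1,2)[OF P] True] mem[OF k] mem[OF lk(2)] by simp
    next
      case False
      then have [simp]: "P1 = P" using P1[OF P] by simp
      have LE: "\<sigma> l \<in> {1..d} - dead d P" "\<sigma> (Suc k) \<in> {1..d} - dead d P" using live mem lk by auto
      have "(\<sigma> l, \<sigma> (Suc k)) \<in> (live_edges d E P)\<^sup>*"
        using minor_mem_iff_connected[OF P idord LE] m by simp
      then have "key (\<sigma> l) = key (\<sigma> (Suc k))"
        using first_in_class_cong[OF P idord] live by (simp add: key_def)
      \<comment> \<open>The key at position \<open>k\<close> is squeezed between two equal keys of
        one component.\<close>
      moreover have "key (\<sigma> l) \<le> key (\<sigma> k)" "key (\<sigma> k) \<le> key (\<sigma> (Suc k))"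
        using key_mono lk k by auto
      ultimately have eq: "key (\<sigma> k) = key (\<sigma> (Suc k))" by simp
      moreover have "key (\<sigma> (Suc k)) \<ge> 1"
        using first_in_class(1)[OF P idord LE(2)] live by (simp add: key_def)
      ultimately have klive: "\<sigma> k \<notin> dead d P" by (auto simp: key_def)
      then have "(\<sigma> k, \<sigma> (Suc k)) \<in> (live_edges d E P)\<^sup>*"
        using first_in_class_eq_iff[OF P idord, of "\<sigma> k" "\<sigma> (Suc k)"] eq LE mem[OF k] by (simp add: key_def)
      then show ?thesis
        using minor_mem_iff_connected[OF P idord, of "\<sigma> k" "\<sigma> (Suc k)"] LE mem[OF k] klive by simp
    qed
  qed
qed

end

theorem theorem2:
  fixes d :: nat and E :: "nat set set" and R J :: "'k::field xy_poly set"
  assumes char: "prime CHAR('k)"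
    and F_finite: "F_finite TYPE('k)"
    and graph: "simple_graph {1..d} E" "connected_graph {1..d} E"
    and R: "R = xy_polys d"
    and J: "J = binomial_edge_ideal d E"
    and cases: "complete_multipartite {1..d} E \<or>
      (finite (Ass (ring_on R) J) \<and> card (Ass (ring_on R) J) \<le> 2) \<or>
      (closed_graph {1..d} E \<and> unmixed (ring_on R) J)"
  shows "strongly_F_regular (symbolic_Rees_algebra R J)"
proof -
  interpret edge_ideal d E by unfold_locales (rule graph(1))
  show ?thesis
    using cases strongly_F_regular_complete_multipartite[OF char graph(2)] strongly_F_regular_two_associated_primes[OF char graph(2)]
      strongly_F_regular_closed[OF char graph(2)]
    unfolding R J by blast
qed

end
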